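(* Let $H$ be a Hamiltonian on $[0,L)$, let $m$ be the corresponding $m$-function and set $\eta(x)=\int_0^x\operatorname{tr}H(t)\,dt$. Then the following conditions are equivalent: (i) For some $a_0\ge 0$, $b_0\in\mathbb{R}$ and $c_0>0$ with $a_0c_0-b_0^2\ge 0$ one has $$\frac{1}{\eta(x)}\int_0^x H(t)\,dt\to\begin{pmatrix} a_0 & b_0\\ b_0 & c_0\end{pmatrix},\qquad x\to 0.$$ (ii) For some $\zeta_0\in\mathbb{C}$ with $\operatorname{Im}\zeta_0\ge 0$ one has $m(z)\to\zeta_0$ as $z\to\infty$ in any closed sector in $\mathbb{C}_+$. In this case, with $h_0=\sqrt{a_0c_0-b_0^2}$, the quantities are related by $$\zeta_0=\frac{\mathrm{i}h_0-b_0}{c_0},\qquad a_0=\frac{|\zeta_0|^2}{|\zeta_0|^2+1},\quad b_0=\frac{-\operatorname{Re}\zeta_0}{|\zeta_0|^2+1},\quad c_0=\frac{1}{|\zeta_0|^2+1}.$$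
   Context: Let $J=\begin{pmatrix} 0 & -1 \\ 1 & 0 \end{pmatrix}$ and $L\in(0,\infty]$. A Hamiltonian on $[0,L)$ is a function $H=\begin{pmatrix} a & b \\ b & c \end{pmatrix}$ with real-valued, locally integrable entries on $[0,L)$ such that $H(x)\ge 0$ and $H(x)\ne 0$ for almost all $x$, $\int_0^L\operatorname{tr}H(x)\,dx=\infty$, and it is not the case that $b=c=0$ almost everywhere. Consider the canonical system $JY'=zHY$ on $[0,L)$, $z\in\mathbb{C}$, and let $U(z,x)$ be its $2\times2$ fundamental matrix solution with $U(z,0)=I_2$. The $m$-function $m:\mathbb{C}\setminus\mathbb{R}\to\mathbb{C}$ is the unique function such that $U(z,\cdot)\begin{pmatrix} 1 \\ m(z) \end{pmatrix}\in L^2([0,L);H)$ for every $z\in\mathbb{C}\setminus\mathbb{R}$, where $f\in L^2([0,L);H)$ means $\int_0^L f^*Hf\,dx<\infty$. It is a Herglotz--Nevanlinna function (holomorphic on $\mathbb{C}\setminus\mathbb{R}$, maps the open upper half-plane $\mathbb{C}_+$ into its closure, $m(\bar z)=\overline{m(z)}$). A closed sector in $\mathbb{C}_+$ is a set $\{z\neq0:\delta_1\le\arg z\le\delta_2\}$ with $0<\delta_1\le\delta_2<\pi$. *)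

theory Defs
  imports "HOL-Analysis.Analysis"
begin

definition interval_0 :: "ereal \<Rightarrow> real set" where
  "interval_0 L = {x. 0 \<le> x \<and> ereal x < L}"

definition Jmat :: "complex^2^2" where
  "Jmat = vector [vector [0, -1], vector [1, 0]]"

text \<open>Values outside \<open>[0, L)\<close> are irrelevant throughout. Local integrability on \<open>[0, L)\<close> means
  integrability on \<open>[0, x]\<close> for every \<open>x\<close> in \<open>[0, L)\<close>.\<close>

definition hamiltonian :: "ereal \<Rightarrow> (real \<Rightarrow> real^2^2) \<Rightarrow> bool" where
  "hamiltonian L H \<longleftrightarrow>
     0 < L \<and>
     (\<forall>x\<in>interval_0 L. transpose (H x) = H x) \<and>
     (\<forall>x\<in>interval_0 L. H absolutely_integrable_on {0..x}) \<and>
     (AE x in lebesgue. x \<in> interval_0 L \<longrightarrow> (\<forall>v. 0 \<le> v \<bullet> (H x *v v)) \<and> H x \<noteq> 0) \<and>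
     (\<integral>\<^sup>+ x\<in>interval_0 L. ennreal (trace (H x)) \<partial>lebesgue) = \<infinity> \<and>
     \<not> (AE x in lebesgue. x \<in> interval_0 L \<longrightarrow> H x $ 1 $ 2 = 0 \<and> H x $ 2 $ 2 = 0)"

text \<open>Solutions are locally absolutely continuous and satisfy \<open>J Y' = z H Y\<close> almost everywhere.
  Local absolute continuity is expressed by writing \<open>U\<close> as the indefinite integral of a locally
  integrable function, its derivative \<open>U'\<close>.\<close>

definition fundamental_solution ::
  "ereal \<Rightarrow> (real \<Rightarrow> real^2^2) \<Rightarrow> complex \<Rightarrow> (real \<Rightarrow> complex^2^2) \<Rightarrow> bool" where
  "fundamental_solution L H z U \<longleftrightarrow>
     U 0 = mat 1 \<and>
     (\<exists>U'. (\<forall>x\<in>interval_0 L. U' absolutely_integrable_on {0..x} \<and>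
              U x = U 0 + integral {0..x} U') \<and>
           (AE x in lebesgue. x \<in> interval_0 L \<longrightarrow>
              Jmat ** U' x = mat z ** map_matrix complex_of_real (H x) ** U x))"

text \<open>The integrand is \<open>f\<^sup>* H f\<close>, which is nonnegative almost everywhere if \<open>H\<close> is a Hamiltonian.\<close>

definition in_L2 :: "ereal \<Rightarrow> (real \<Rightarrow> real^2^2) \<Rightarrow> (real \<Rightarrow> complex^2) \<Rightarrow> bool" where
  "in_L2 L H f \<longleftrightarrow>
     (\<lambda>x. \<Sum>i\<in>UNIV. cnj (f x $ i) * (map_matrix complex_of_real (H x) *v f x) $ i)
       absolutely_integrable_on interval_0 L"

text \<open>The value of \<open>m\<close> on the real axis is irrelevant. For a Hamiltonian \<open>H\<close> with fundamental
  solutions \<open>U\<close>, the condition determines \<open>m\<close> on the complement of the real axis.\<close>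

definition m_function ::
  "ereal \<Rightarrow> (real \<Rightarrow> real^2^2) \<Rightarrow> (complex \<Rightarrow> real \<Rightarrow> complex^2^2) \<Rightarrow> (complex \<Rightarrow> complex) \<Rightarrow> bool"
  where
  "m_function L H U m \<longleftrightarrow>
     (\<forall>z. z \<notin> \<real> \<longrightarrow> in_L2 L H (\<lambda>x. U z x *v vector [1, m z]))"

definition eta :: "(real \<Rightarrow> real^2^2) \<Rightarrow> real \<Rightarrow> real" where
  "eta H x = integral {0..x} (\<lambda>t. trace (H t))"

definition average_tendsto :: "(real \<Rightarrow> real^2^2) \<Rightarrow> real \<Rightarrow> real \<Rightarrow> real \<Rightarrow> bool" where
  "average_tendsto H a b c \<longleftrightarrow>
     ((\<lambda>x. (1 / eta H x) *\<^sub>R integral {0..x} H)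
        \<longlongrightarrow> vector [vector [a, b], vector [b, c]]) (at_right 0)"

definition closed_sector :: "real \<Rightarrow> real \<Rightarrow> complex set" where
  "closed_sector \<delta>1 \<delta>2 = {z. z \<noteq> 0 \<and> \<delta>1 \<le> Arg z \<and> Arg z \<le> \<delta>2}"

definition sector_tendsto :: "(complex \<Rightarrow> complex) \<Rightarrow> complex \<Rightarrow> bool" where
  "sector_tendsto m \<zeta> \<longleftrightarrow>
     (\<forall>\<delta>1 \<delta>2. 0 < \<delta>1 \<and> \<delta>1 \<le> \<delta>2 \<and> \<delta>2 < pi \<longrightarrow>
        (m \<longlongrightarrow> \<zeta>) (inf at_infinity (principal (closed_sector \<delta>1 \<delta>2))))"

end

theory Submission
  imports Defs "HOL-Complex_Analysis.Complex_Analysis" "HOL-Real_Asymp.Real_Asymp"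
begin

no_notation fps_nth (infixl "$" 75)

text \<open>
  Write \<open>t = tr H\<close>, \<open>\<eta>\<close> for its primitive, and let \<open>(u, v)\<close> be the square integrable solution with
  initial value \<open>(1, m(z))\<close>. Because \<open>\<integral> t = \<infinity>\<close>, it satisfies \<open>Im (cnj u v) \<ge> 0\<close> everywhere, and this
  inequality on \<open>[0, x]\<close> with \<open>\<eta>(x)\<close> of the order \<open>1 / |z|\<close> is all that is used about \<open>m\<close>. A real affine
  change of coordinates reduces the theorem to \<open>\<zeta>\<^sub>0 = 0\<close> and \<open>\<zeta>\<^sub>0 = i\<close>.

  For \<open>\<zeta>\<^sub>0 = 0\<close> the condition on \<open>H\<close> is that the mean of \<open>a\<close> tends to \<open>0\<close>, and both implications are direct
  estimates. For \<open>\<zeta>\<^sub>0 = i\<close> put \<open>\<kappa> = a - c + 2 i b\<close>, \<open>p = v + i u\<close>, \<open>q = v - i u\<close>; the condition is that the mean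
  of \<open>\<kappa>\<close> tends to \<open>0\<close>, and \<open>p' = (i z / 2) (t p - cnj \<kappa> q)\<close>, \<open>q' = (i z / 2) (\<kappa> p - t q)\<close>. If the mean
  of \<open>\<kappa>\<close> vanishes, then up to small errors \<open>p\<close> decays and \<open>q\<close> grows exponentially, so that \<open>|q| \<le> |p|\<close>
  forces \<open>q(0) / p(0)\<close> to be small. Conversely, if \<open>m \<rightarrow> i\<close>, rescale \<open>p\<close> along a sequence \<open>x \<rightarrow> 0\<close> and take
  a locally uniform limit \<open>P\<close>, an entire function of \<open>z\<close>. It has modulus at least \<open>2\<close> on the real line, no zeros in
  the upper half-plane, and \<open>P(z) = 2 i - z + O(z\<^sup>2)\<close>; by Phragmen--Lindeloef \<open>|P(i y)|\<close> then decays at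
  the maximal rate \<open>exp (- y / 2)\<close>, and the equation for \<open>ln (|p|\<^sup>2 + |q|\<^sup>2)\<close> shows that this is only possible
  if the mean of \<open>\<kappa>\<close> is small.
\<close>

section \<open>Indefinite integrals\<close>

text \<open>The coefficients are merely integrable, so solutions have no usable pointwise
  derivative. Every differential identity is therefore carried as a pair of a function and an
  integrand, and used only after integration; the product and chain rules are proved for such pairs.
  A limit in the open upper half-plane can be moved to \<i> by subtracting a real number and
  dividing by a positive one, while a real limit can only be moved to 0. Hence the two base cases.
  The critical rate 1/2 comes from the normalisation: with \<open>\<eta>(x)\<close> scaled to 1,
  \<open>|P(i y)|\<close> is \<open>2 - y + O(y^2)\<close>, which is tangent to
  \<open>2 exp (- y / 2)\<close> at the origin, and the equation for the logarithm admits no faster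
  decay than this exponential. So the slope at the origin fixes the rate at infinity. Compactness is
  applied to entire functions only, and no limit of Hamiltonians is formed: a single
  \<open>y\<close> at which the limit is small is carried back to a finite member of the sequence,
  where the mean of \<kappa> is estimated directly.\<close>

definition primitive_on :: "real \<Rightarrow> (real \<Rightarrow> 'a::euclidean_space) \<Rightarrow> (real \<Rightarrow> 'a) \<Rightarrow> bool" where
  "primitive_on X f g \<longleftrightarrow>
     g absolutely_integrable_on {0..X} \<and> (\<forall>x\<in>{0..X}. f x - f 0 = integral {0..x} g)"

lemma primitive_on_eq:
  assumes "primitive_on X f g" "0 \<le> x" "x \<le> X"
  shows "f x = f 0 + integral {0..x} g"
proof -
  have "f x - f 0 = integral {0..x} g" using assms unfolding primitive_on_def by simp
  then show ?thesis by (metis add.commute diff_add_cancel)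
qed

lemma primitive_on_absint:
  assumes "primitive_on X f g" "0 \<le> x" "y \<le> X"
  shows "g absolutely_integrable_on {x..y}"
  using assms unfolding primitive_on_def
  by (meson absolutely_integrable_on_subinterval atLeastatMost_subset_iff order.trans)

lemma primitive_on_int:
  assumes "primitive_on X f g" "0 \<le> x" "y \<le> X"
  shows "g integrable_on {x..y}"
  using primitive_on_absint[OF assms] set_lebesgue_integral_eq_integral(1) by blast

lemma primitive_on_diff_eq:
  assumes "primitive_on X f g" "0 \<le> x" "x \<le> y" "y \<le> X"
  shows "f y - f x = integral {x..y} g"
proof -
  have "integral {0..x} g + integral {x..y} g = integral {0..y} g"
    by (rule Henstock_Kurzweil_Integration.integral_combine[OF assms(2,3)
          primitive_on_int[OF assms(1) order.refl assms(4)]])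
  moreover have "f x - f 0 = integral {0..x} g" "f y - f 0 = integral {0..y} g"
    using assms unfolding primitive_on_def by auto
  ultimately show ?thesis by (simp add: algebra_simps)
qed

lemma primitive_on_mono:
  assumes "primitive_on X f g" "Y \<le> X"
  shows "primitive_on Y f g"
  using assms primitive_on_absint[OF assms(1), of 0 Y] unfolding primitive_on_def by auto

lemma primitive_on_cong:
  assumes "primitive_on X f g"
    and "\<And>x. 0 \<le> x \<Longrightarrow> x \<le> X \<Longrightarrow> f1 x = f x" "\<And>x. 0 \<le> x \<Longrightarrow> x \<le> X \<Longrightarrow> g1 x = g x"
  shows "primitive_on X f1 g1"
proof (cases "0 \<le> X")
  case True
  have "g1 absolutely_integrable_on {0..X}"
    by (rule absolutely_integrable_spike[where S="{}" and f=g]) (use assms in \<open>auto simp: primitive_on_def\<close>)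
  moreover have "integral {0..x} g1 = integral {0..x} g" if "x \<le> X" for x
    using that assms(3) by (intro Henstock_Kurzweil_Integration.integral_cong) auto
  ultimately show ?thesis using assms True unfolding primitive_on_def by auto
next
  case False
  then show ?thesis by (auto simp: primitive_on_def)
qed

lemma primitive_on_continuous:
  assumes "primitive_on X f g"
  shows "continuous_on {0..X} f"
proof -
  have "continuous_on {0..X} (\<lambda>x. f 0 + integral {0..x} g)"
    by (intro continuous_intros indefinite_integral_continuous_1 primitive_on_int[OF assms]) auto
  then show ?thesis
    by (rule continuous_on_eq) (use primitive_on_eq[OF assms] in \<open>simp flip: primitive_on_eq[OF assms]\<close>)
qed

lemma primitive_on_const: "primitive_on X (\<lambda>x. c) (\<lambda>x. 0)"
  by (auto simp: primitive_on_def)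

lemma primitive_on_linear:
  assumes "primitive_on X f g" "bounded_linear h"
  shows "primitive_on X (\<lambda>x. h (f x)) (\<lambda>x. h (g x))"
  unfolding primitive_on_def
proof (intro conjI ballI)
  show "(\<lambda>x. h (g x)) absolutely_integrable_on {0..X}"
    using absolutely_integrable_linear[where f=g and s="{0..X}", OF _ assms(2)] assms(1)
    by (simp add: primitive_on_def comp_def)
  fix x assume x: "x \<in> {0..X}"
  have "integral {0..x} (\<lambda>x. h (g x)) = h (integral {0..x} g)"
    using Henstock_Kurzweil_Integration.integral_linear[where f=g and S="{0..x}", OF _ assms(2)] primitive_on_int[OF assms(1), of 0 x] x
    by (simp add: comp_def)
  moreover have "h (f x) - h (f 0) = h (f x - f 0)"
    by (simp add: assms(2) bounded_linear.linear linear_diff)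
  ultimately show "h (f x) - h (f 0) = integral {0..x} (\<lambda>x. h (g x))"
    using assms x by (simp add: primitive_on_def)
qed

lemma primitive_on_add:
  assumes "primitive_on X f g" "primitive_on X f1 g1"
  shows "primitive_on X (\<lambda>x. f x + f1 x) (\<lambda>x. g x + g1 x)"
  unfolding primitive_on_def
proof (intro conjI ballI)
  show "(\<lambda>x. g x + g1 x) absolutely_integrable_on {0..X}"
    using assms by (auto simp: primitive_on_def)
  fix x assume x: "x \<in> {0..X}"
  then have x': "x \<le> X" by simp
  have "integral {0..x} (\<lambda>x. g x + g1 x) = integral {0..x} g + integral {0..x} g1"
    by (rule Henstock_Kurzweil_Integration.integral_add[OF primitive_on_int[OF assms(1) order.refl x']
          primitive_on_int[OF assms(2) order.refl x']])
  also have "\<dots> = (f x - f 0) + (f1 x - f1 0)"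
    using assms x by (simp add: primitive_on_def)
  finally show "f x + f1 x - (f 0 + f1 0) = integral {0..x} (\<lambda>x. g x + g1 x)"
    by (simp only: add_diff_add)
qed

lemma primitive_on_minus:
  assumes "primitive_on X f g"
  shows "primitive_on X (\<lambda>x. - f x) (\<lambda>x. - g x)"
  using primitive_on_linear[OF assms bounded_linear_minus[OF bounded_linear_ident]] by simp

lemma primitive_on_diff:
  assumes "primitive_on X f g" "primitive_on X f1 g1"
  shows "primitive_on X (\<lambda>x. f x - f1 x) (\<lambda>x. g x - g1 x)"
  using primitive_on_add[OF assms(1) primitive_on_minus[OF assms(2)]] by simp

lemma primitive_on_cmult:
  fixes f :: "real \<Rightarrow> 'a::{euclidean_space, real_normed_algebra}"
  assumes "primitive_on X f g"
  shows "primitive_on X (\<lambda>x. c * f x) (\<lambda>x. c * g x)"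
  using primitive_on_linear[OF assms bounded_linear_mult_right[of c]] by simp

section \<open>Product and chain rules for indefinite integrals\<close>

lemma absint_continuous_mult:
  fixes p :: "'a::euclidean_space \<Rightarrow> 'b::euclidean_space \<Rightarrow> 'c::euclidean_space"
    and f :: "real \<Rightarrow> 'a" and g :: "real \<Rightarrow> 'b"
  assumes "bounded_bilinear p" "continuous_on {x..y} f" "g absolutely_integrable_on {x..y}"
  shows "(\<lambda>t. p (f t) (g t)) absolutely_integrable_on {x..y}"
proof (rule absolutely_integrable_bounded_measurable_product[where h=p and f=f and g=g])
  show "bilinear p" using assms(1) by (simp add: bilinear_conv_bounded_bilinear)
  show "f \<in> borel_measurable (lebesgue_on {x..y})"
    by (rule continuous_imp_measurable_on_sets_lebesgue[OF assms(2)]) simp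
  show "bounded (f ` {x..y})"
    by (intro compact_imp_bounded compact_continuous_image assms compact_Icc)
qed (use assms in auto)

text \<open>Cut \<open>[0, X]\<close> into equal pieces shorter than \<delta> and telescope: the
  increments of \<open>D\<close> add up to at most \<epsilon> times the total increment of
  \<open>V\<close>, and \<epsilon> is arbitrary. This takes the place of almost everywhere
  differentiability in the product and chain rules.\<close>

lemma eq_if_small_increments:
  fixes D :: "real \<Rightarrow> 'a::real_normed_vector" and V :: "real \<Rightarrow> real"
  assumes "0 \<le> X"
    and inc: "\<And>\<epsilon>. \<epsilon> > 0 \<Longrightarrow> \<exists>\<delta>>0. \<forall>x y. 0 \<le> x \<longrightarrow> x \<le> y \<longrightarrow> y \<le> X \<longrightarrow> y - x < \<delta> \<longrightarrow>
                norm (D y - D x) \<le> \<epsilon> * (V y - V x)"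
  shows "D X = D 0"
proof -
  have "norm (D X - D 0) \<le> \<epsilon> * (V X - V 0)" if eps: "\<epsilon> > 0" for \<epsilon>
  proof -
    obtain \<delta> where "\<delta> > 0" and \<delta>: "\<And>x y. 0 \<le> x \<Longrightarrow> x \<le> y \<Longrightarrow> y \<le> X \<Longrightarrow> y - x < \<delta> \<Longrightarrow>
                norm (D y - D x) \<le> \<epsilon> * (V y - V x)"
      using inc[OF eps] by blast
    obtain n :: nat where n: "X / \<delta> < n" using reals_Archimedean2 by blast
    then have "n > 0" using assms(1) \<open>\<delta> > 0\<close>
      by (metis divide_nonneg_pos gr0I linorder_not_le of_nat_0)
    define s where "s i = X * real i / real n" for i
    have step: "norm (D (s (Suc i)) - D (s i)) \<le> \<epsilon> * (V (s (Suc i)) - V (s i))" if "i < n" for i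
    proof (rule \<delta>)
      show "0 \<le> s i" using assms by (simp add: s_def)
      show "s i \<le> s (Suc i)" using assms
        by (auto simp: s_def intro!: divide_right_mono mult_left_mono)
      have "X * real (Suc i) / real n \<le> X * real n / real n"
        using assms \<open>i < n\<close> by (intro divide_right_mono mult_left_mono) auto
      then show "s (Suc i) \<le> X" using \<open>n > 0\<close> by (simp add: s_def)
      have "s (Suc i) - s i = X / n" by (simp add: s_def algebra_simps add_divide_distrib)
      also have "\<dots> < \<delta>" using n \<open>\<delta> > 0\<close> \<open>n > 0\<close> by (simp add: field_simps)
      finally show "s (Suc i) - s i < \<delta>" .
    qed
    have "D X - D 0 = (\<Sum>i<n. D (s (Suc i)) - D (s i))"
      using \<open>n > 0\<close> sum_lessThan_telescope[of "\<lambda>i. D (s i)" n] by (simp add: s_def)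
    then have "norm (D X - D 0) \<le> (\<Sum>i<n. norm (D (s (Suc i)) - D (s i)))"
      by (simp add: norm_sum)
    also have "\<dots> \<le> (\<Sum>i<n. \<epsilon> * (V (s (Suc i)) - V (s i)))"
      by (intro sum_mono step) auto
    also have "\<dots> = \<epsilon> * (\<Sum>i<n. V (s (Suc i)) - V (s i))"
      by (simp add: sum_distrib_left)
    also have "\<dots> = \<epsilon> * (V X - V 0)"
      using \<open>n > 0\<close> sum_lessThan_telescope[of "\<lambda>i. V (s i)" n] by (simp add: s_def)
    finally show ?thesis .
  qed
  then have *: "norm (D X - D 0) \<le> \<epsilon> * (V X - V 0)" if "\<epsilon> > 0" for \<epsilon> using that by blast
  have "((\<lambda>\<epsilon>. \<epsilon> * (V X - V 0)) \<longlongrightarrow> 0 * (V X - V 0)) (at_right 0)"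
    by (intro tendsto_intros)
  then have "norm (D X - D 0) \<le> 0 * (V X - V 0)"
    by (rule tendsto_lowerbound) (auto simp: eventually_at_right_less intro!: eventually_at_rightI[of 0 1] *)
  then show ?thesis by simp
qed

text \<open>The preceding principle for \<open>F\<close> minus the integral of \<open>g\<close>: it
  is enough to compare increments with integrals on short intervals, with an error small relative to
  the increment of some \<open>V\<close>.\<close>

lemma primitive_onI_increments:
  fixes F :: "real \<Rightarrow> 'a::euclidean_space" and V :: "real \<Rightarrow> real"
  assumes "g absolutely_integrable_on {0..X}"
    and inc: "\<And>\<epsilon>. \<epsilon> > 0 \<Longrightarrow> \<exists>\<delta>>0. \<forall>x y. 0 \<le> x \<longrightarrow> x \<le> y \<longrightarrow> y \<le> X \<longrightarrow> y - x < \<delta> \<longrightarrow>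
                norm (F y - F x - integral {x..y} g) \<le> \<epsilon> * (V y - V x)"
  shows "primitive_on X F g"
  unfolding primitive_on_def
proof (intro conjI ballI)
  fix z assume z: "z \<in> {0..X}"
  define D where "D x = F x - integral {0..x} g" for x
  have gint: "g integrable_on {0..X}" using assms(1) set_lebesgue_integral_eq_integral(1) by blast
  have "D z = D 0"
  proof (rule eq_if_small_increments)
    fix \<epsilon> :: real assume "\<epsilon> > 0"
    then obtain \<delta> where "\<delta> > 0" and \<delta>: "\<And>x y. 0 \<le> x \<Longrightarrow> x \<le> y \<Longrightarrow> y \<le> X \<Longrightarrow> y - x < \<delta> \<Longrightarrow>
                norm (F y - F x - integral {x..y} g) \<le> \<epsilon> * (V y - V x)"
      using inc by blast
    have "norm (D y - D x) \<le> \<epsilon> * (V y - V x)" if "0 \<le> x" "x \<le> y" "y \<le> z" "y - x < \<delta>" for x y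
    proof -
      have "integral {0..x} g + integral {x..y} g = integral {0..y} g"
        using that z by (intro Henstock_Kurzweil_Integration.integral_combine
            integrable_on_subinterval[OF gint]) auto
      then have "D y - D x = F y - F x - integral {x..y} g"
        by (simp add: D_def algebra_simps)
      then show ?thesis using \<delta>[of x y] that z by auto
    qed
    then show "\<exists>\<delta>>0. \<forall>x y. 0 \<le> x \<longrightarrow> x \<le> y \<longrightarrow> y \<le> z \<longrightarrow> y - x < \<delta> \<longrightarrow>
                norm (D y - D x) \<le> \<epsilon> * (V y - V x)"
      using \<open>\<delta> > 0\<close> by blast
  qed (use z in auto)
  then show "F z - F 0 = integral {0..z} g" by (simp add: D_def algebra_simps)
qed (rule assms)

lemma primitive_on_uniform:
  assumes "primitive_on X f g" "\<epsilon> > 0"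
  shows "\<exists>\<delta>>0. \<forall>x\<in>{0..X}. \<forall>y\<in>{0..X}. \<bar>y - x\<bar> < \<delta> \<longrightarrow> norm (f y - f x) < \<epsilon>"
proof -
  have "uniformly_continuous_on {0..X} f"
    using primitive_on_continuous[OF assms(1)] compact_uniformly_continuous by blast
  then show ?thesis
    using assms(2) unfolding uniformly_continuous_on_def by (simp add: dist_norm)
qed

text \<open>On a short interval from \<open>x\<close> to \<open>y\<close> the integrand is compared
  with \<open>p (f y) (g' t) + p (f' t) (g x)\<close>, whose integral is exactly the increment of
  the product. The difference contains a factor \<open>f y - f t\<close> or
  \<open>g x - g t\<close>, small by uniform continuity.\<close>

lemma primitive_on_bilinear:
  fixes f :: "real \<Rightarrow> 'a::euclidean_space" and g :: "real \<Rightarrow> 'b::euclidean_space"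
    and p :: "'a \<Rightarrow> 'b \<Rightarrow> 'c::euclidean_space"
  assumes bil: "bounded_bilinear p" and f: "primitive_on X f f'" and g: "primitive_on X g g'"
  shows "primitive_on X (\<lambda>x. p (f x) (g x)) (\<lambda>x. p (f x) (g' x) + p (f' x) (g x))"
proof -
  interpret bounded_bilinear p by (rule bil)
  have flip: "bounded_bilinear (\<lambda>x y. p y x)" by (rule bounded_bilinear.flip[OF bil])
  obtain K where K: "\<And>a b. norm (p a b) \<le> norm a * norm b * K" "K > 0"
    using pos_bounded by blast
  define V where "V x = K * integral {0..x} (\<lambda>t. norm (g' t) + norm (f' t))" for x
  have ai: "(\<lambda>t. p (f t) (g' t)) absolutely_integrable_on {0..X}"
    using absint_continuous_mult[OF bil primitive_on_continuous[OF f]] g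
    by (simp add: primitive_on_def)
  have ai': "(\<lambda>t. p (f' t) (g t)) absolutely_integrable_on {0..X}"
    using absint_continuous_mult[OF flip primitive_on_continuous[OF g]] f
    by (simp add: primitive_on_def)
  have ni: "(\<lambda>t. norm (g' t) + norm (f' t)) integrable_on {0..X}"
    using f g by (simp add: integrable_add primitive_on_def absolutely_integrable_on_def)
  show ?thesis
  proof (rule primitive_onI_increments[where V=V])
    show "(\<lambda>x. p (f x) (g' x) + p (f' x) (g x)) absolutely_integrable_on {0..X}"
      using ai ai' by simp
    fix \<epsilon> :: real assume "\<epsilon> > 0"
    obtain \<delta>1 where "\<delta>1 > 0" and \<delta>1: "\<And>x y. x \<in> {0..X} \<Longrightarrow> y \<in> {0..X} \<Longrightarrow> \<bar>y - x\<bar> < \<delta>1 \<Longrightarrow> norm (f y - f x) < \<epsilon>"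
      using primitive_on_uniform[OF f \<open>\<epsilon> > 0\<close>] by blast
    obtain \<delta>2 where "\<delta>2 > 0" and \<delta>2: "\<And>x y. x \<in> {0..X} \<Longrightarrow> y \<in> {0..X} \<Longrightarrow> \<bar>y - x\<bar> < \<delta>2 \<Longrightarrow> norm (g y - g x) < \<epsilon>"
      using primitive_on_uniform[OF g \<open>\<epsilon> > 0\<close>] by blast
    have "norm (p (f y) (g y) - p (f x) (g x) - integral {x..y} (\<lambda>t. p (f t) (g' t) + p (f' t) (g t)))
            \<le> \<epsilon> * (V y - V x)"
      if xy: "0 \<le> x" "x \<le> y" "y \<le> X" "y - x < min \<delta>1 \<delta>2" for x y
    proof -
      have sub: "{x..y} \<subseteq> {0..X}" using xy by auto
      note fi = primitive_on_int[OF f xy(1,3)] and gi = primitive_on_int[OF g xy(1,3)]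
      have i1: "(\<lambda>t. p (f t) (g' t) + p (f' t) (g t)) integrable_on {x..y}"
        using integrable_on_subinterval[OF set_lebesgue_integral_eq_integral(1)[OF ai] sub]
          integrable_on_subinterval[OF set_lebesgue_integral_eq_integral(1)[OF ai'] sub]
        by (rule integrable_add)
      have e1: "((\<lambda>t. p (f y) (g' t)) has_integral p (f y) (g y - g x)) {x..y}"
        using has_integral_linear[OF integrable_integral[OF gi] bounded_linear_right[of "f y"]]
          primitive_on_diff_eq[OF g xy(1-3)] by (simp add: comp_def)
      have e2: "((\<lambda>t. p (f' t) (g x)) has_integral p (f y - f x) (g x)) {x..y}"
        using has_integral_linear[OF integrable_integral[OF fi] bounded_linear_left[of "g x"]]
          primitive_on_diff_eq[OF f xy(1-3)] by (simp add: comp_def)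
      have eq: "p (f y) (g y) - p (f x) (g x) - integral {x..y} (\<lambda>t. p (f t) (g' t) + p (f' t) (g t))
         = integral {x..y} (\<lambda>t. p (f y) (g' t) + p (f' t) (g x) - (p (f t) (g' t) + p (f' t) (g t)))"
      proof -
        have "integral {x..y} (\<lambda>t. p (f y) (g' t) + p (f' t) (g x) - (p (f t) (g' t) + p (f' t) (g t)))
          = p (f y) (g y - g x) + p (f y - f x) (g x) - integral {x..y} (\<lambda>t. p (f t) (g' t) + p (f' t) (g t))"
          by (intro integral_unique has_integral_diff has_integral_add e1 e2 integrable_integral i1)
        then show ?thesis by (simp add: diff_left diff_right)
      qed
      have "norm (integral {x..y} (\<lambda>t. p (f y) (g' t) + p (f' t) (g x) - (p (f t) (g' t) + p (f' t) (g t))))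
          \<le> integral {x..y} (\<lambda>t. \<epsilon> * (K * (norm (g' t) + norm (f' t))))"
      proof (rule Henstock_Kurzweil_Integration.integral_norm_bound_integral)
        show "(\<lambda>t. p (f y) (g' t) + p (f' t) (g x) - (p (f t) (g' t) + p (f' t) (g t))) integrable_on {x..y}"
          by (intro has_integral_integrable[OF has_integral_diff[OF has_integral_add[OF e1 e2] integrable_integral[OF i1]]])
        show "(\<lambda>t. \<epsilon> * (K * (norm (g' t) + norm (f' t)))) integrable_on {x..y}"
          using integrable_on_subinterval[OF ni sub] by (intro integrable_on_mult_right)
        fix t assume t: "t \<in> {x..y}"
        have "p (f y) (g' t) + p (f' t) (g x) - (p (f t) (g' t) + p (f' t) (g t))
            = p (f y - f t) (g' t) + p (f' t) (g x - g t)"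
          by (simp add: diff_left diff_right)
        also have "norm \<dots> \<le> norm (f y - f t) * norm (g' t) * K + norm (f' t) * norm (g x - g t) * K"
          by (meson K(1) add_mono norm_triangle_le)
        also have "\<dots> \<le> \<epsilon> * norm (g' t) * K + norm (f' t) * \<epsilon> * K"
          using \<delta>1[of t y] \<delta>2[of t x] t xy K(2)
          by (intro add_mono mult_right_mono mult_left_mono) auto
        also have "\<dots> = \<epsilon> * (K * (norm (g' t) + norm (f' t)))" by (simp add: algebra_simps)
        finally show "norm (p (f y) (g' t) + p (f' t) (g x) - (p (f t) (g' t) + p (f' t) (g t)))
           \<le> \<epsilon> * (K * (norm (g' t) + norm (f' t)))" .
      qed
      also have "\<dots> = \<epsilon> * (V y - V x)"
      proof -
        have "integral {0..x} (\<lambda>t. norm (g' t) + norm (f' t)) + integral {x..y} (\<lambda>t. norm (g' t) + norm (f' t))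
           = integral {0..y} (\<lambda>t. norm (g' t) + norm (f' t))"
          using xy by (intro Henstock_Kurzweil_Integration.integral_combine integrable_on_subinterval[OF ni]) auto
        then have "V y - V x = K * integral {x..y} (\<lambda>t. norm (g' t) + norm (f' t))"
          unfolding V_def right_diff_distrib[symmetric] by simp
        then show ?thesis by simp
      qed
      finally show ?thesis using eq by simp
    qed
    then show "\<exists>\<delta>>0. \<forall>x y. 0 \<le> x \<longrightarrow> x \<le> y \<longrightarrow> y \<le> X \<longrightarrow> y - x < \<delta> \<longrightarrow>
       norm (p (f y) (g y) - p (f x) (g x) - integral {x..y} (\<lambda>x. p (f x) (g' x) + p (f' x) (g x)))
            \<le> \<epsilon> * (V y - V x)"
      using \<open>\<delta>1 > 0\<close> \<open>\<delta>2 > 0\<close> by (intro exI[of _ "min \<delta>1 \<delta>2"]) auto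
  qed
qed

lemma primitive_on_mult:
  fixes f :: "real \<Rightarrow> 'a::{euclidean_space, real_normed_algebra}"
  assumes "primitive_on X f f'" "primitive_on X g g'"
  shows "primitive_on X (\<lambda>x. f x * g x) (\<lambda>x. f x * g' x + f' x * g x)"
  using primitive_on_bilinear[OF bounded_bilinear_mult assms] .

text \<open>The error is split into two halves. Linearising \<open>F\<close> at \<open>f x\<close>
  costs the oscillation of \<open>F'\<close> between \<open>f x\<close> and \<open>f y\<close>;
  freezing \<open>F' (f t)\<close> at \<open>f x\<close> under the integral costs the same. Each is
  at most \<open>\<epsilon> / 2\<close> times the variation of \<open>f\<close>.\<close>

lemma primitive_on_chain:
  fixes f :: "real \<Rightarrow> real" and F :: "real \<Rightarrow> 'b::euclidean_space"
  assumes f: "primitive_on X f f'"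
    and F: "\<And>s. s \<in> {\<alpha>..\<beta>} \<Longrightarrow> (F has_vector_derivative F' s) (at s within {\<alpha>..\<beta>})"
    and F': "continuous_on {\<alpha>..\<beta>} F'"
    and im: "\<And>x. 0 \<le> x \<Longrightarrow> x \<le> X \<Longrightarrow> f x \<in> {\<alpha>..\<beta>}"
  shows "primitive_on X (\<lambda>x. F (f x)) (\<lambda>x. f' x *\<^sub>R F' (f x))"
proof -
  define V where "V x = integral {0..x} (\<lambda>t. norm (f' t))" for x
  have contF': "continuous_on {0..X} (\<lambda>t. F' (f t))"
    by (rule continuous_on_compose2[OF F' primitive_on_continuous[OF f]]) (use im in auto)
  have ai: "(\<lambda>t. f' t *\<^sub>R F' (f t)) absolutely_integrable_on {0..X}"
    by (rule absint_continuous_mult[OF bounded_bilinear.flip[OF bounded_bilinear_scaleR] contF'])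
      (use f in \<open>simp add: primitive_on_def\<close>)
  have ni: "(\<lambda>t. norm (f' t)) integrable_on {0..X}"
    using f unfolding primitive_on_def absolutely_integrable_on_def by auto
  have uc: "uniformly_continuous_on {\<alpha>..\<beta>} F'"
    using F' compact_uniformly_continuous by blast
  show ?thesis
  proof (rule primitive_onI_increments[where V=V, OF ai])
    fix \<epsilon> :: real assume "\<epsilon> > 0"
    obtain \<delta>1 where "\<delta>1 > 0" and \<delta>1: "\<And>x y. x \<in> {\<alpha>..\<beta>} \<Longrightarrow> y \<in> {\<alpha>..\<beta>} \<Longrightarrow> \<bar>y - x\<bar> < \<delta>1 \<Longrightarrow> norm (F' y - F' x) < \<epsilon> / 2"
      using uc half_gt_zero[OF \<open>\<epsilon> > 0\<close>] unfolding uniformly_continuous_on_def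
      by (metis dist_norm real_norm_def)
    obtain \<delta> where "\<delta> > 0" and \<delta>: "\<And>x y. x \<in> {0..X} \<Longrightarrow> y \<in> {0..X} \<Longrightarrow> \<bar>y - x\<bar> < \<delta> \<Longrightarrow> norm (f y - f x) < \<delta>1"
      using primitive_on_uniform[OF f \<open>\<delta>1 > 0\<close>] by blast
    have "norm (F (f y) - F (f x) - integral {x..y} (\<lambda>t. f' t *\<^sub>R F' (f t))) \<le> \<epsilon> * (V y - V x)"
      if xy: "0 \<le> x" "x \<le> y" "y \<le> X" "y - x < \<delta>" for x y
    proof -
      have sub: "{x..y} \<subseteq> {0..X}" using xy by auto
      have close: "norm (f y - f x) < \<delta>1" using \<delta>[of x y] xy by auto
      have fxy: "f x \<in> {\<alpha>..\<beta>}" "f y \<in> {\<alpha>..\<beta>}" using im xy by auto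
      \<comment> \<open>\<open>f\<close> itself may leave this segment between \<open>x\<close> and
        \<open>y\<close>, which is harmless: \<open>F\<close> is linearised only along the
        segment.\<close>
      define S where "S = closed_segment (f x) (f y)"
      have Ssub: "S \<subseteq> {\<alpha>..\<beta>}" using fxy unfolding S_def
        by (metis closed_segment_subset convex_real_interval(5))
      have "norm (F (f y) - F (f x) - (f y - f x) *\<^sub>R F' (f x)) \<le> norm (f y - f x) * (\<epsilon> / 2)"
      proof (rule differentiable_bound_linearization[where f'="\<lambda>s h. h *\<^sub>R F' s" and S=S])
        show "f x + t *\<^sub>R (f y - f x) \<in> S" if "t \<in> {0..1}" for t
          using that unfolding S_def closed_segment_def
          by (auto simp: algebra_simps intro!: exI[of _ t])
        show "(F has_derivative (\<lambda>h. h *\<^sub>R F' s)) (at s within S)" if "s \<in> S" for s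
          using F[of s] that Ssub unfolding has_vector_derivative_def
          by (meson has_derivative_subset subsetD)
        show "f x \<in> S" by (simp add: S_def)
        show "onorm ((\<lambda>h. h *\<^sub>R F' s) - (\<lambda>h. h *\<^sub>R F' (f x))) \<le> \<epsilon> / 2" if "s \<in> S" for s
          unfolding fun_diff_def
        proof (rule onorm_le)
          fix h :: real
          have "\<bar>s - f x\<bar> \<le> \<bar>f y - f x\<bar>"
            using that unfolding S_def by (auto simp: closed_segment_eq_real_ivl split: if_splits)
          then have "norm (F' s - F' (f x)) \<le> \<epsilon> / 2"
            using \<delta>1[of "f x" s] fxy that Ssub close by auto
          moreover have "norm (h *\<^sub>R F' s - h *\<^sub>R F' (f x)) = norm (F' s - F' (f x)) * norm h"
            by (simp flip: scaleR_diff_right)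
          ultimately show "norm (h *\<^sub>R F' s - h *\<^sub>R F' (f x)) \<le> \<epsilon> / 2 * norm h"
            by (metis mult_right_mono norm_ge_zero)
        qed
      qed
      moreover have "norm (f y - f x) \<le> V y - V x"
      proof -
        have "norm (integral {x..y} f') \<le> integral {x..y} (\<lambda>t. norm (f' t))"
          using primitive_on_int[OF f xy(1,3)] integrable_on_subinterval[OF ni sub]
          by (intro Henstock_Kurzweil_Integration.integral_norm_bound_integral) auto
        moreover have "integral {0..x} (\<lambda>t. norm (f' t)) + integral {x..y} (\<lambda>t. norm (f' t))
            = integral {0..y} (\<lambda>t. norm (f' t))"
          using xy by (intro Henstock_Kurzweil_Integration.integral_combine integrable_on_subinterval[OF ni]) auto
        ultimately show ?thesis using primitive_on_diff_eq[OF f xy(1-3)] unfolding V_def by simp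
      qed
      ultimately have p1: "norm (F (f y) - F (f x) - (f y - f x) *\<^sub>R F' (f x)) \<le> \<epsilon> / 2 * (V y - V x)"
        using \<open>\<epsilon> > 0\<close> by (smt (verit) mult.commute mult_left_mono half_gt_zero)
      have e1: "((\<lambda>t. f' t *\<^sub>R F' (f x)) has_integral (f y - f x) *\<^sub>R F' (f x)) {x..y}"
        using has_integral_linear[OF integrable_integral[OF primitive_on_int[OF f xy(1,3)]] bounded_linear_scaleR_left[of "F' (f x)"]]
          primitive_on_diff_eq[OF f xy(1-3)] by (simp add: comp_def)
      have i1: "(\<lambda>t. f' t *\<^sub>R F' (f t)) integrable_on {x..y}"
        using ai sub by (meson absolutely_integrable_on_subinterval set_lebesgue_integral_eq_integral(1))
      have "norm (integral {x..y} (\<lambda>t. f' t *\<^sub>R F' (f x) - f' t *\<^sub>R F' (f t)))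
          \<le> integral {x..y} (\<lambda>t. \<epsilon> / 2 * norm (f' t))"
      proof (rule Henstock_Kurzweil_Integration.integral_norm_bound_integral)
        show "(\<lambda>t. f' t *\<^sub>R F' (f x) - f' t *\<^sub>R F' (f t)) integrable_on {x..y}"
          using e1 i1 by (intro integrable_diff) auto
        show "(\<lambda>t. \<epsilon> / 2 * norm (f' t)) integrable_on {x..y}"
          using integrable_on_subinterval[OF ni sub] by (intro integrable_on_mult_right)
        fix t assume t: "t \<in> {x..y}"
        have "norm (F' (f x) - F' (f t)) < \<epsilon> / 2"
          using \<delta>1[of "f t" "f x"] \<delta>[of t x] im[of t] im[of x] t xy by auto
        then have "norm (F' (f x) - F' (f t)) * norm (f' t) \<le> \<epsilon> / 2 * norm (f' t)"
          by (intro mult_right_mono) auto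
        then show "norm (f' t *\<^sub>R F' (f x) - f' t *\<^sub>R F' (f t)) \<le> \<epsilon> / 2 * norm (f' t)"
          by (simp add: mult.commute flip: scaleR_diff_right)
      qed
      also have "\<dots> = \<epsilon> / 2 * (V y - V x)"
      proof -
        have "integral {0..x} (\<lambda>t. norm (f' t)) + integral {x..y} (\<lambda>t. norm (f' t))
            = integral {0..y} (\<lambda>t. norm (f' t))"
          using xy by (intro Henstock_Kurzweil_Integration.integral_combine integrable_on_subinterval[OF ni]) auto
        then show ?thesis by (simp add: V_def algebra_simps flip: distrib_left)
      qed
      finally have p2: "norm ((f y - f x) *\<^sub>R F' (f x) - integral {x..y} (\<lambda>t. f' t *\<^sub>R F' (f t))) \<le> \<epsilon> / 2 * (V y - V x)"
        using integral_unique[OF has_integral_diff[OF e1 integrable_integral[OF i1]]] by simp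
      have "norm (F (f y) - F (f x) - integral {x..y} (\<lambda>t. f' t *\<^sub>R F' (f t))) \<le> \<epsilon> / 2 * (V y - V x) + \<epsilon> / 2 * (V y - V x)"
        using norm_triangle_mono[OF p1 p2] by simp
      then show ?thesis by simp
    qed
    then show "\<exists>\<delta>>0. \<forall>x y. 0 \<le> x \<longrightarrow> x \<le> y \<longrightarrow> y \<le> X \<longrightarrow> y - x < \<delta> \<longrightarrow>
       norm (F (f y) - F (f x) - integral {x..y} (\<lambda>x. f' x *\<^sub>R F' (f x))) \<le> \<epsilon> * (V y - V x)"
      using \<open>\<delta> > 0\<close> by blast
  qed
qed

lemma primitive_on_integral:
  assumes "g absolutely_integrable_on {0..X}"
  shows "primitive_on X (\<lambda>x. integral {0..x} g) g"
  using assms by (simp add: primitive_on_def)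

lemma primitive_on_le:
  fixes f g :: "real \<Rightarrow> real"
  assumes "primitive_on X f f'" "primitive_on X g g'" "0 \<le> X"
    and "\<And>x. 0 \<le> x \<Longrightarrow> x \<le> X \<Longrightarrow> f' x \<le> g' x"
  shows "f X - f 0 \<le> g X - g 0"
proof -
  have "integral {0..X} f' \<le> integral {0..X} g'"
    using assms primitive_on_int[OF assms(1) order.refl order.refl] primitive_on_int[OF assms(2) order.refl order.refl]
    by (intro integral_le) auto
  then show ?thesis using assms(1-3) by (simp add: primitive_on_def)
qed

lemma primitive_on_norm_le:
  fixes f :: "real \<Rightarrow> 'a::euclidean_space" and g :: "real \<Rightarrow> real"
  assumes "primitive_on X f f'" "primitive_on X g g'" "0 \<le> X"
    and "\<And>x. 0 \<le> x \<Longrightarrow> x \<le> X \<Longrightarrow> norm (f' x) \<le> g' x"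
  shows "norm (f X - f 0) \<le> g X - g 0"
proof -
  have "norm (integral {0..X} f') \<le> integral {0..X} g'"
    by (rule Henstock_Kurzweil_Integration.integral_norm_bound_integral
       [OF primitive_on_int[OF assms(1) order.refl order.refl] primitive_on_int[OF assms(2) order.refl order.refl]])
     (use assms in auto)
  then show ?thesis using assms(1-3) by (simp add: primitive_on_def)
qed

lemma primitive_on_chain_UNIV:
  fixes f :: "real \<Rightarrow> real" and F :: "real \<Rightarrow> 'b::euclidean_space"
  assumes f: "primitive_on X f f'"
    and F: "\<And>s. (F has_vector_derivative F' s) (at s)"
    and F': "continuous_on UNIV F'"
  shows "primitive_on X (\<lambda>x. F (f x)) (\<lambda>x. f' x *\<^sub>R F' (f x))"
proof -
  have "bounded (f ` {0..X})"
    by (rule compact_imp_bounded[OF compact_continuous_image[OF primitive_on_continuous[OF f] compact_Icc]])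
  then obtain B where B: "\<And>x. x \<in> {0..X} \<Longrightarrow> \<bar>f x\<bar> \<le> B"
    unfolding bounded_iff by (metis imageI real_norm_def)
  show ?thesis
  proof (rule primitive_on_chain[OF f, where \<alpha>="-B" and \<beta>=B])
    show "(F has_vector_derivative F' s) (at s within {- B..B})" for s
      using F has_vector_derivative_at_within by blast
    show "continuous_on {-B..B} F'" using F' continuous_on_subset by blast
    show "f x \<in> {-B..B}" if "0 \<le> x" "x \<le> X" for x
      using B[of x] that by auto
  qed
qed

lemma primitive_on_exp:
  fixes f :: "real \<Rightarrow> real" and w :: complex
  assumes "primitive_on X f f'"
  shows "primitive_on X (\<lambda>x. exp (w * of_real (f x))) (\<lambda>x. w * of_real (f' x) * exp (w * of_real (f x)))"
proof -
  have "((\<lambda>s. exp (w * of_real s)) has_vector_derivative w * exp (w * of_real s)) (at s)" for s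
    by (rule has_vector_derivative_real_field) (auto intro!: derivative_eq_intros)
  then have "primitive_on X (\<lambda>x. exp (w * of_real (f x))) (\<lambda>x. f' x *\<^sub>R (w * exp (w * of_real (f x))))"
    by (intro primitive_on_chain_UNIV[OF assms]) (auto intro!: continuous_intros)
  then show ?thesis by (simp add: scaleR_conv_of_real mult_ac)
qed

lemma primitive_on_exp_real:
  fixes f :: "real \<Rightarrow> real"
  assumes "primitive_on X f f'"
  shows "primitive_on X (\<lambda>x. exp (f x)) (\<lambda>x. f' x * exp (f x))"
proof -
  have "(exp has_vector_derivative exp s) (at s)" for s :: real
    by (simp add: DERIV_exp flip: has_real_derivative_iff_has_vector_derivative)
  then show ?thesis
    using primitive_on_chain_UNIV[OF assms, of exp exp] continuous_on_exp[OF continuous_on_id[of "UNIV :: real set"]]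
    by simp
qed

text \<open>On a compact interval a positive \<open>f\<close> is bounded away from 0, so
  \<open>F\<close> has to be smooth on the positive half-line only. Serves the logarithm and the
  reciprocal.\<close>

lemma primitive_on_chain_pos:
  fixes f F :: "real \<Rightarrow> real"
  assumes f: "primitive_on X f f'" and X: "0 \<le> X"
    and F: "\<And>s. s > 0 \<Longrightarrow> (F has_real_derivative F' s) (at s)"
    and F': "continuous_on {0<..} F'"
    and pos: "\<And>x. 0 \<le> x \<Longrightarrow> x \<le> X \<Longrightarrow> 0 < f x"
  shows "primitive_on X (\<lambda>x. F (f x)) (\<lambda>x. f' x * F' (f x))"
proof -
  note cont = primitive_on_continuous[OF f]
  obtain x0 where x0: "x0 \<in> {0..X}" "\<And>x. x \<in> {0..X} \<Longrightarrow> f x0 \<le> f x"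
    using continuous_attains_inf[OF compact_Icc _ cont] X by auto
  obtain x1 where x1: "x1 \<in> {0..X}" "\<And>x. x \<in> {0..X} \<Longrightarrow> f x \<le> f x1"
    using continuous_attains_sup[OF compact_Icc _ cont] X by auto
  have p0: "0 < f x0" using pos x0 by auto
  have "primitive_on X (\<lambda>x. F (f x)) (\<lambda>x. f' x *\<^sub>R F' (f x))"
  proof (rule primitive_on_chain[OF f, where \<alpha>="f x0" and \<beta>="f x1"])
    show "(F has_vector_derivative F' s) (at s within {f x0..f x1})" if "s \<in> {f x0..f x1}" for s
      using F[of s] p0 that has_vector_derivative_at_within
      by (auto simp: has_real_derivative_iff_has_vector_derivative)
    show "continuous_on {f x0..f x1} F'"
      by (rule continuous_on_subset[OF F']) (use p0 in auto)
    show "f x \<in> {f x0..f x1}" if "0 \<le> x" "x \<le> X" for x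
      using that x0 x1 by auto
  qed
  then show ?thesis by simp
qed

lemma primitive_on_ln:
  fixes f :: "real \<Rightarrow> real"
  assumes "primitive_on X f f'" "0 \<le> X" "\<And>x. 0 \<le> x \<Longrightarrow> x \<le> X \<Longrightarrow> 0 < f x"
  shows "primitive_on X (\<lambda>x. ln (f x)) (\<lambda>x. f' x / f x)"
proof -
  have "primitive_on X (\<lambda>x. ln (f x)) (\<lambda>x. f' x * (1 / f x))"
    by (rule primitive_on_chain_pos[OF assms(1,2)])
      (use assms in \<open>auto intro!: derivative_eq_intros continuous_intros\<close>)
  then show ?thesis by simp
qed

lemma primitive_on_inverse:
  fixes f :: "real \<Rightarrow> real"
  assumes "primitive_on X f f'" "0 \<le> X" "\<And>x. 0 \<le> x \<Longrightarrow> x \<le> X \<Longrightarrow> 0 < f x"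
  shows "primitive_on X (\<lambda>x. 1 / f x) (\<lambda>x. - f' x / (f x)\<^sup>2)"
proof -
  have "primitive_on X (\<lambda>x. 1 / f x) (\<lambda>x. f' x * (- 1 / (f x)\<^sup>2))"
    by (rule primitive_on_chain_pos[OF assms(1,2), where F'="\<lambda>s. -1/s\<^sup>2"])
      (use assms in \<open>auto intro!: derivative_eq_intros continuous_intros simp: power2_eq_square\<close>)
  then show ?thesis by simp
qed

lemma primitive_on_of_real:
  assumes "primitive_on X f f'"
  shows "primitive_on X (\<lambda>x. complex_of_real (f x)) (\<lambda>x. of_real (f' x))"
  by (rule primitive_on_linear[OF assms bounded_linear_of_real])

lemma primitive_on_Re:
  assumes "primitive_on X f f'"
  shows "primitive_on X (\<lambda>x. Re (f x)) (\<lambda>x. Re (f' x))"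
  by (rule primitive_on_linear[OF assms bounded_linear_Re])

lemma primitive_on_Im:
  assumes "primitive_on X f f'"
  shows "primitive_on X (\<lambda>x. Im (f x)) (\<lambda>x. Im (f' x))"
  by (rule primitive_on_linear[OF assms bounded_linear_Im])

lemma primitive_on_cnj:
  assumes "primitive_on X f f'"
  shows "primitive_on X (\<lambda>x. cnj (f x)) (\<lambda>x. cnj (f' x))"
  by (rule primitive_on_linear[OF assms bounded_linear_cnj])

lemma primitive_on_cmod_sq:
  assumes "primitive_on X f f'"
  shows "primitive_on X (\<lambda>x. (cmod (f x))\<^sup>2) (\<lambda>x. 2 * Re (cnj (f x) * f' x))"
proof -
  have "primitive_on X (\<lambda>x. Re (cnj (f x) * f x)) (\<lambda>x. Re (cnj (f x) * f' x + cnj (f' x) * f x))"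
    by (intro primitive_on_Re primitive_on_mult primitive_on_cnj assms)
  moreover have "Re (cnj (f x) * f x) = (cmod (f x))\<^sup>2" for x
    by (simp add: cmod_power2 flip: power2_eq_square)
  moreover have "Re (cnj (f x) * f' x + cnj (f' x) * f x) = 2 * Re (cnj (f x) * f' x)" for x
    by simp
  ultimately show ?thesis by (simp only:)
qed

text \<open>The product of \<open>N\<close> and \<open>exp (- k * \<tau>)\<close> has a nonpositive
  integrand, hence does not increase.\<close>

lemma gronwall:
  fixes N \<tau> :: "real \<Rightarrow> real"
  assumes N: "primitive_on X N N'" and \<tau>: "primitive_on X \<tau> t" and X: "0 \<le> X" and \<tau>0: "\<tau> 0 = 0"
    and le: "\<And>x. 0 \<le> x \<Longrightarrow> x \<le> X \<Longrightarrow> N' x \<le> k * t x * N x"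
  shows "N X \<le> N 0 * exp (k * \<tau> X)"
proof -
  have e: "primitive_on X (\<lambda>x. exp (- k * \<tau> x)) (\<lambda>x. - k * t x * exp (- k * \<tau> x))"
    using primitive_on_exp_real[OF primitive_on_cmult[OF \<tau>, of "- k"]] by simp
  have "N X * exp (- k * \<tau> X) - N 0 * exp (- k * \<tau> 0) \<le> 0 - 0"
  proof (rule primitive_on_le[OF primitive_on_mult[OF N e] primitive_on_const[of X 0] X])
    fix x assume "0 \<le> x" "x \<le> X"
    have "N x * (- k * t x * exp (- k * \<tau> x)) + N' x * exp (- k * \<tau> x)
       = (N' x - k * t x * N x) * exp (- k * \<tau> x)" by (simp add: algebra_simps)
    also have "\<dots> \<le> 0" using le[OF \<open>0 \<le> x\<close> \<open>x \<le> X\<close>] by (simp add: mult_le_0_iff)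
    finally show "N x * (- k * t x * exp (- k * \<tau> x)) + N' x * exp (- k * \<tau> x) \<le> 0" .
  qed
  then have "N X * exp (- k * \<tau> X) \<le> N 0" by (simp add: \<tau>0)
  then show ?thesis by (simp add: exp_minus field_simps)
qed

section \<open>Canonical systems in scalar form\<close>

text \<open>The sign conditions are imposed at every point rather than almost everywhere, so that
  integrands can be estimated pointwise; a change on a null set arranges this. A compact interval
  suffices because both limits concern the behaviour at 0 once \<open>m\<close> has been reduced to
  an inequality on such intervals.\<close>

locale canonical_system =
  fixes X :: real and a b c :: "real \<Rightarrow> real"
  assumes X_pos: "0 < X"
    and abs_int: "a absolutely_integrable_on {0..X}" "b absolutely_integrable_on {0..X}"
      "c absolutely_integrable_on {0..X}"
    and nonneg: "\<And>x. 0 \<le> a x" "\<And>x. 0 \<le> c x"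
    and det_nonneg: "\<And>x. (b x)\<^sup>2 \<le> a x * c x"
    and trace_pos: "\<And>x. 0 < a x + c x"
begin

definition \<eta> :: "real \<Rightarrow> real" where
  "\<eta> x = integral {0..x} (\<lambda>s. a s + c s)"

text \<open>The second row of \<open>J Y' = z H Y\<close> gives the integrand of \<open>u\<close>,
  the first row that of \<open>- v\<close>.\<close>

definition solution :: "complex \<Rightarrow> (real \<Rightarrow> complex) \<Rightarrow> (real \<Rightarrow> complex) \<Rightarrow> bool" where
  "solution z u v \<longleftrightarrow>
     primitive_on X u (\<lambda>x. z * (of_real (b x) * u x + of_real (c x) * v x)) \<and>
     primitive_on X v (\<lambda>x. - z * (of_real (a x) * u x + of_real (b x) * v x))"

lemma abs_b_le: "\<bar>b x\<bar> \<le> (a x + c x) / 2"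
proof -
  have "(2 * b x)\<^sup>2 \<le> 4 * (a x * c x)" using det_nonneg[of x] by (simp add: power2_eq_square)
  also have "\<dots> \<le> (a x + c x)\<^sup>2" using sum_squares_bound[of "a x" "c x"] by (simp add: power2_sum)
  finally have "\<bar>2 * b x\<bar> \<le> a x + c x"
    using nonneg[of x] by (metis abs_le_square_iff abs_of_nonneg add_nonneg_nonneg)
  then show ?thesis by simp
qed

lemma trace_abs_int: "(\<lambda>s. a s + c s) absolutely_integrable_on {0..X}"
  using abs_int by simp

lemma eta_primitive: "primitive_on X \<eta> (\<lambda>s. a s + c s)"
  using primitive_on_integral[OF trace_abs_int] unfolding \<eta>_def[abs_def] .

lemma eta_0 [simp]: "\<eta> 0 = 0" by (simp add: \<eta>_def)

lemma eta_continuous: "continuous_on {0..X} \<eta>"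
  by (rule primitive_on_continuous[OF eta_primitive])

text \<open>A vanishing integral of the nonnegative trace would make the trace vanish almost
  everywhere on an interval of positive length. The strict sign is what allows division by
  \<open>\<eta>\<close>.\<close>

lemma eta_pos: assumes "0 < x" "x \<le> X" shows "0 < \<eta> x"
proof -
  note p = primitive_on_mono[OF eta_primitive \<open>x \<le> X\<close>]
  have i: "(\<lambda>s. a s + c s) integrable_on {0..x}" by (rule primitive_on_int[OF p]) auto
  have nn: "0 \<le> \<eta> x" unfolding \<eta>_def by (rule integral_nonneg[OF i]) (simp add: nonneg)
  have "\<eta> x \<noteq> 0"
  proof
    assume "\<eta> x = 0"
    let ?f = "\<lambda>s. indicator {0..x} s *\<^sub>R (a s + c s)"
    have "set_integrable lebesgue {0..x} (\<lambda>s. a s + c s)"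
      by (rule primitive_on_absint[OF p]) auto
    then have "integrable lebesgue ?f" "integral\<^sup>L lebesgue ?f = 0"
      using \<open>\<eta> x = 0\<close> set_lebesgue_integral_eq_integral(2)[of "{0..x}" "\<lambda>s. a s + c s"]
      by (simp_all add: \<eta>_def set_integrable_def set_lebesgue_integral_def)
    then have "AE s in lebesgue. ?f s = 0"
      by (subst (asm) integral_nonneg_eq_0_iff_AE) (auto simp: nonneg)
    then have "AE s in lebesgue. s \<notin> {0..x}"
      using trace_pos by (auto simp: indicator_def less_le elim: eventually_mono)
    then have "negligible {0..x}"
      by (simp add: negligible_iff_null_sets AE_iff_null_sets)
    then show False using \<open>0 < x\<close> negligible_interval(1)[of 0 x] by simp
  qed
  then show ?thesis using nn by simp
qed

lemma eta_mono: assumes "0 \<le> x" "x \<le> y" "y \<le> X" shows "\<eta> x \<le> \<eta> y"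
proof -
  have "\<eta> y - \<eta> x = integral {x..y} (\<lambda>s. a s + c s)"
    by (rule primitive_on_diff_eq[OF eta_primitive assms])
  also have "\<dots> \<ge> 0"
    by (rule integral_nonneg[OF primitive_on_int[OF eta_primitive assms(1,3)]]) (simp add: nonneg)
  finally show ?thesis by simp
qed

lemma solution_linear:
  assumes "solution z u v" "solution z u1 v1"
  shows "solution z (\<lambda>x. \<alpha> * u x + \<beta> * u1 x) (\<lambda>x. \<alpha> * v x + \<beta> * v1 x)"
proof -
  note sol = assms[unfolded solution_def]
  show ?thesis
    unfolding solution_def
    by (intro conjI; rule primitive_on_cong, rule primitive_on_add[OF primitive_on_cmult primitive_on_cmult],
        rule sol[THEN conjunct1] sol[THEN conjunct2], rule sol[THEN conjunct1] sol[THEN conjunct2])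
      (auto simp: algebra_simps)
qed

lemma solution_cnj:
  assumes "solution z u v"
  shows "solution (cnj z) (\<lambda>x. cnj (u x)) (\<lambda>x. cnj (v x))"
  using assms[unfolded solution_def, THEN conjunct1, THEN primitive_on_cnj]
    assms[unfolded solution_def, THEN conjunct2, THEN primitive_on_cnj]
  unfolding solution_def by simp

text \<open>Deliberately bilinear, without conjugation. With \<open>w = cnj z\<close> and a
  conjugated solution it becomes the energy identity, with \<open>w = z\<close> the constancy of the
  Wronskian, and for general \<open>w\<close> the variation of constants formula.\<close>

lemma lagrange:
  assumes "solution w u v" "solution z u1 v1"
  shows "primitive_on X (\<lambda>x. v x * u1 x - u x * v1 x)
    (\<lambda>x. (z - w) * (of_real (a x) * (u x * u1 x) + of_real (b x) * (u x * v1 x + v x * u1 x) + of_real (c x) * (v x * v1 x)))"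
proof -
  have "primitive_on X (\<lambda>x. v x * u1 x - u x * v1 x)
    (\<lambda>x. (v x * (z * (of_real (b x) * u1 x + of_real (c x) * v1 x)) + (- w * (of_real (a x) * u x + of_real (b x) * v x)) * u1 x)
       - (u x * (- z * (of_real (a x) * u1 x + of_real (b x) * v1 x)) + (w * (of_real (b x) * u x + of_real (c x) * v x)) * v1 x))"
    using assms unfolding solution_def by (intro primitive_on_diff primitive_on_mult) auto
  then show ?thesis by (rule primitive_on_cong) (auto simp: algebra_simps)
qed

lemma norm_sq_primitive:
  assumes "solution z u v"
  shows "primitive_on X (\<lambda>x. (cmod (u x))\<^sup>2 + (cmod (v x))\<^sup>2)
    (\<lambda>x. 2 * Re (cnj (u x) * (z * (of_real (b x) * u x + of_real (c x) * v x))) + 2 * Re (cnj (v x) * (- z * (of_real (a x) * u x + of_real (b x) * v x))))"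
  using assms unfolding solution_def by (intro primitive_on_add primitive_on_cmod_sq) auto

text \<open>The trace \<open>t\<close> dominates the norm of \<open>H\<close>: from
  \<open>|b| <= t / 2\<close> and \<open>|u| |v| <= N / 2\<close> the integrand of the squared norm
  \<open>N\<close> is at most \<open>2 |z| t N\<close>. The bound depends on
  \<open>|z| \<eta>(x)\<close> only, which is the natural scale of the whole proof.\<close>

lemma growth:
  assumes sol: "solution z u v" and x: "0 \<le> x" "x \<le> X"
  shows "(cmod (u x))\<^sup>2 + (cmod (v x))\<^sup>2 \<le> ((cmod (u 0))\<^sup>2 + (cmod (v 0))\<^sup>2) * exp (2 * cmod z * \<eta> x)"
proof (rule gronwall[OF primitive_on_mono[OF norm_sq_primitive[OF sol] x(2)]
        primitive_on_mono[OF eta_primitive x(2)] x(1) eta_0])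
  fix x
  let ?N = "(cmod (u x))\<^sup>2 + (cmod (v x))\<^sup>2"
  let ?U = "cmod (u x)" and ?V = "cmod (v x)" and ?t = "a x + c x"
  have "2 * (?U * ?V) \<le> ?N" using sum_squares_bound[of ?U ?V] by (metis mult.assoc)
  then have UV: "?U * ?V \<le> ?N / 2" by (subst le_divide_eq_numeral1) (metis mult.commute)
  have r1: "Re (cnj (u x) * (z * (of_real (b x) * u x + of_real (c x) * v x))) \<le> ?U * (cmod z * (\<bar>b x\<bar> * ?U + c x * ?V))"
  proof -
    have "Re (cnj (u x) * (z * (of_real (b x) * u x + of_real (c x) * v x))) \<le> cmod (cnj (u x) * (z * (of_real (b x) * u x + of_real (c x) * v x)))"
      by (rule complex_Re_le_cmod)
    also have "\<dots> = ?U * (cmod z * cmod (of_real (b x) * u x + of_real (c x) * v x))" by (simp add: norm_mult)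
    also have "cmod (of_real (b x) * u x + of_real (c x) * v x) \<le> \<bar>b x\<bar> * ?U + c x * ?V"
      using norm_triangle_ineq[of "of_real (b x) * u x" "of_real (c x) * v x"] nonneg[of x] by (simp add: norm_mult)
    finally show ?thesis by (simp add: mult_left_mono)
  qed
  have r2: "Re (cnj (v x) * (- z * (of_real (a x) * u x + of_real (b x) * v x))) \<le> ?V * (cmod z * (a x * ?U + \<bar>b x\<bar> * ?V))"
  proof -
    have "Re (cnj (v x) * (- z * (of_real (a x) * u x + of_real (b x) * v x))) \<le> cmod (cnj (v x) * (- z * (of_real (a x) * u x + of_real (b x) * v x)))"
      by (rule complex_Re_le_cmod)
    also have "\<dots> = ?V * (cmod z * cmod (of_real (a x) * u x + of_real (b x) * v x))" by (simp add: norm_mult)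
    also have "cmod (of_real (a x) * u x + of_real (b x) * v x) \<le> a x * ?U + \<bar>b x\<bar> * ?V"
      using norm_triangle_ineq[of "of_real (a x) * u x" "of_real (b x) * v x"] nonneg[of x] by (simp add: norm_mult)
    finally show ?thesis by (simp add: mult_left_mono)
  qed
  have "?U * (cmod z * (\<bar>b x\<bar> * ?U + c x * ?V)) + ?V * (cmod z * (a x * ?U + \<bar>b x\<bar> * ?V))
     = cmod z * (\<bar>b x\<bar> * ?N + ?t * (?U * ?V))" by (simp add: algebra_simps power2_eq_square)
  also have "\<dots> \<le> cmod z * (?t / 2 * ?N + ?t * (?N / 2))"
    using abs_b_le[of x] UV nonneg[of x] by (intro mult_left_mono add_mono mult_right_mono) auto
  also have "\<dots> = cmod z * ?t * ?N" by (simp add: field_simps)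
  finally have fin: "?U * (cmod z * (\<bar>b x\<bar> * ?U + c x * ?V)) + ?V * (cmod z * (a x * ?U + \<bar>b x\<bar> * ?V))
     \<le> cmod z * ?t * ?N" .
  have "2 * (Re (cnj (u x) * (z * (of_real (b x) * u x + of_real (c x) * v x)))
      + Re (cnj (v x) * (- z * (of_real (a x) * u x + of_real (b x) * v x)))) \<le> 2 * (cmod z * ?t * ?N)"
    by (rule mult_left_mono[OF order.trans[OF add_mono[OF r1 r2] fin]]) simp
  then show "2 * Re (cnj (u x) * (z * (of_real (b x) * u x + of_real (c x) * v x)))
      + 2 * Re (cnj (v x) * (- z * (of_real (a x) * u x + of_real (b x) * v x)))
     \<le> 2 * cmod z * ?t * ?N"
    by (metis (no_types, opaque_lifting) distrib_left mult.assoc)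
qed

end

section \<open>A Phragmen--Lindeloef argument\<close>

text \<open>Maximum principle for \<open>f\<close> damped by \<open>exp (- \<epsilon> h)\<close>,
  where \<open>Re h\<close> grows at least like \<open>|z|\<close> to the power 3/2 and so beats the
  exponential growth of \<open>f\<close>; then \<epsilon> tends to 0.\<close>

lemma phragmen_lindeloef_quadrant:
  fixes f :: "complex \<Rightarrow> complex"
  assumes holo: "f holomorphic_on A" and A: "open A" "{z. 0 \<le> Re z \<and> 0 \<le> Im z} \<subseteq> A"
    and re: "\<And>x. 0 \<le> x \<Longrightarrow> cmod (f (of_real x)) \<le> M"
    and im: "\<And>y. 0 \<le> y \<Longrightarrow> cmod (f (\<i> * of_real y)) \<le> M"
    and growth: "\<And>z. 0 \<le> Re z \<Longrightarrow> 0 \<le> Im z \<Longrightarrow> cmod (f z) \<le> C * exp (K * cmod z)"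
    and M: "0 < M" and z: "0 \<le> Re z" "0 \<le> Im z"
  shows "cmod (f z) \<le> M"
proof -
  \<comment> \<open>The 3/2 power of \<open>1 + w\<close> after turning the quadrant by
    \<open>- pi / 4\<close>: the argument stays within \<open>3 * pi / 8\<close>, below
    \<open>pi / 2\<close>, so \<open>Re h\<close> is positive and comparable to \<open>|h|\<close>.
    The shift by 1 moves the branch point out of the closed quadrant.\<close>
  define h where "h w = exp (3/2 * (Ln (1 + w) - \<i> * of_real (pi / 4)))" for w
  define c0 where "c0 = cos (3 * pi / 8)"
  have c0: "0 < c0" unfolding c0_def by (rule cos_gt_zero_pi) auto
  have ne: "1 + w \<notin> \<real>\<^sub>\<le>\<^sub>0" "1 + w \<noteq> 0" if "0 \<le> Re w" for w
    using that by (auto simp: complex_nonpos_Reals_iff complex_eq_iff)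
  have Re_h: "c0 * exp (3/2 * ln (cmod (1 + w))) \<le> Re (h w)" if w: "0 \<le> Re w" "0 \<le> Im w" for w
  proof -
    let ?\<theta> = "3/2 * (Im (Ln (1 + w)) - pi / 4)"
    have "0 \<le> Im (Ln (1 + w))" using Im_Ln_pos_le[OF ne(2)[OF w(1)]] w by simp
    moreover have "\<bar>Im (Ln (1 + w))\<bar> < pi / 2" using Re_Ln_pos_lt[OF ne(2)[OF w(1)]] w by simp
    ultimately have "\<bar>Im (Ln (1 + w)) - pi / 4\<bar> \<le> pi / 4" by linarith
    then have "\<bar>?\<theta>\<bar> \<le> 3 * pi / 8" unfolding abs_mult by simp
    then have "c0 \<le> cos \<bar>?\<theta>\<bar>" unfolding c0_def
      by (intro cos_monotone_0_pi_le) auto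
    then have "c0 \<le> cos ?\<theta>" by (simp only: cos_abs_real)
    moreover have "Re (h w) = exp (3/2 * ln (cmod (1 + w))) * cos ?\<theta>"
      unfolding h_def using ne(2)[OF w(1)] by (simp add: Re_exp)
    ultimately show ?thesis by (simp add: mult.commute[of c0])
  qed
  have bound: "cmod (f z) * exp (- \<epsilon> * Re (h z)) \<le> M" if \<epsilon>: "0 < \<epsilon>" for \<epsilon>
  proof -
    have e: "0 < \<epsilon> * c0" using \<epsilon> c0 by simp
    have "((\<lambda>R. exp (K * R - e * exp (3/2 * ln R))) \<longlongrightarrow> 0) at_top" if "0 < e" for e
      using that by real_asymp
    then have "((\<lambda>R. C * exp (K * R - (\<epsilon> * c0) * exp (3/2 * ln R))) \<longlongrightarrow> 0) at_top"
      using e by (intro tendsto_mult_right_zero) blast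
    then have "\<forall>\<^sub>F R in at_top. C * exp (K * R - (\<epsilon> * c0) * exp (3/2 * ln R)) < M"
      using M by (simp add: order_tendstoD(2))
    then have "\<forall>\<^sub>F R in at_top. C * exp (K * R - (\<epsilon> * c0) * exp (3/2 * ln R)) < M \<and> cmod z \<le> R \<and> 0 < R"
      by (intro eventually_conj eventually_ge_at_top eventually_gt_at_top)
    \<comment> \<open>\<open>R\<close> is so large that the damped function is below
      \<open>M\<close> on the arc \<open>|w| = R\<close> and that the quarter disc contains
      \<open>z\<close>.\<close>
    then obtain R where R: "C * exp (K * R - (\<epsilon> * c0) * exp (3/2 * ln R)) < M" "cmod z \<le> R" "0 < R"
      by (metis (mono_tags, lifting) eventually_happens trivial_limit_at_top_linorder)
    define S where "S = {w. 0 \<le> Re w \<and> 0 \<le> Im w} \<inter> cball 0 R"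
    define g where "g w = f w * exp (- of_real \<epsilon> * h w)" for w
    have "closed S" unfolding S_def
      by (intro closed_Int closed_Collect_conj closed_halfspace_Re_ge closed_halfspace_Im_ge closed_cball)
    then have clS: "closure S = S" by simp
    have "h holomorphic_on {w. 0 < Re (1 + w)}"
      unfolding h_def
      by (intro holomorphic_intros) (auto simp: complex_nonpos_Reals_iff)
    then have gh: "g holomorphic_on A \<inter> {w. 0 < Re (1 + w)}"
      unfolding g_def by (intro holomorphic_intros holomorphic_on_subset[OF holo]) (auto intro: holomorphic_on_subset)
    have SA: "S \<subseteq> A \<inter> {w. 0 < Re (1 + w)}" using A(2) by (auto simp: S_def)
    have gnorm: "cmod (g w) = cmod (f w) * exp (- \<epsilon> * Re (h w))" for w
      by (simp add: g_def norm_mult)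
    have hpos: "0 \<le> Re (h w)" if "0 \<le> Re w" "0 \<le> Im w" for w
      using Re_h[OF that] c0 by (meson exp_ge_zero less_imp_le mult_nonneg_nonneg order_trans)
    have "cmod (g z) \<le> M"
    proof (rule maximum_modulus_frontier[of g S])
      show "g holomorphic_on interior S"
        using gh holomorphic_on_subset SA interior_subset by (meson subset_trans)
      show "continuous_on (closure S) g"
        unfolding clS using holomorphic_on_imp_continuous_on[OF gh] continuous_on_subset SA by blast
      show "bounded S" unfolding S_def by (meson bounded_Int bounded_cball)
      show "z \<in> S" using z R by (simp add: S_def)
      fix w assume "w \<in> frontier S"
      then have w: "w \<in> S" "w \<notin> interior S" using clS by (auto simp: frontier_def)
      have w2: "0 \<le> Re w" "0 \<le> Im w" "cmod w \<le> R" using w by (auto simp: S_def)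
      have "Re w = 0 \<or> Im w = 0 \<or> cmod w = R"
      proof (rule ccontr)
        assume "\<not> ?thesis"
        then have "w \<in> {w. 0 < Re w} \<inter> {w. 0 < Im w} \<inter> ball 0 R" using w2 by auto
        moreover have "open ({w. 0 < Re w} \<inter> {w. 0 < Im w} \<inter> ball 0 R)"
          by (intro open_Int open_halfspace_Re_gt open_halfspace_Im_gt open_ball)
        moreover have "{w. 0 < Re w} \<inter> {w. 0 < Im w} \<inter> ball 0 R \<subseteq> S" by (auto simp: S_def)
        ultimately show False using w(2) interiorI by blast
      qed
      moreover have "exp (- \<epsilon> * Re (h w)) \<le> 1" using hpos[OF w2(1,2)] \<epsilon> by simp
      then have g_le: "cmod (g w) \<le> cmod (f w)" unfolding gnorm by (simp add: mult_left_le)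
      moreover have "cmod (f w) \<le> M" if "Re w = 0"
        using im[OF w2(2)] that by (metis complex_eq_iff Im_i_times Re_complex_of_real Im_complex_of_real Re_i_times minus_zero)
      moreover have "cmod (f w) \<le> M" if "Im w = 0"
        using re[OF w2(1)] that by (metis complex_eq_iff Re_complex_of_real Im_complex_of_real)
      moreover have "cmod (g w) \<le> M" if "cmod w = R"
      proof -
        have "(cmod w)\<^sup>2 \<le> (cmod (1 + w))\<^sup>2"
          unfolding cmod_power2 using w2 by (auto intro!: add_mono power_mono)
        then have "cmod w \<le> cmod (1 + w)" by (rule power2_le_imp_le) simp
        then have "R \<le> cmod (1 + w)" using that by simp
        then have "ln R \<le> ln (cmod (1 + w))" using R(3) by (subst ln_le_cancel_iff) auto
        then have "exp (3/2 * ln R) \<le> exp (3/2 * ln (cmod (1 + w)))" by simp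
        then have "c0 * exp (3/2 * ln R) \<le> Re (h w)"
          using Re_h[OF w2(1,2)] c0 by (meson dual_order.trans mult_left_mono less_imp_le)
        then have "\<epsilon> * (c0 * exp (3/2 * ln R)) \<le> \<epsilon> * Re (h w)"
          using \<epsilon> by (intro mult_left_mono) auto
        then have "cmod (g w) \<le> cmod (f w) * exp (- ((\<epsilon> * c0) * exp (3/2 * ln R)))"
          unfolding gnorm by (intro mult_left_mono) (auto simp: mult.assoc)
        also have "\<dots> \<le> C * exp (K * R) * exp (- ((\<epsilon> * c0) * exp (3/2 * ln R)))"
          using growth[OF w2(1,2)] that by (intro mult_right_mono) auto
        also have "\<dots> = C * exp (K * R - (\<epsilon> * c0) * exp (3/2 * ln R))"
          by (simp add: exp_diff exp_minus field_simps)
        finally show ?thesis using R(1) by linarith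
      qed
      ultimately show "cmod (g w) \<le> M" by linarith
    qed
    then show ?thesis by (simp add: gnorm)
  qed
  have "((\<lambda>\<epsilon>. cmod (f z) * exp (- \<epsilon> * Re (h z))) \<longlongrightarrow> cmod (f z) * exp (- 0 * Re (h z))) (at_right 0)"
    by (intro tendsto_intros)
  then have "cmod (f z) * exp (- 0 * Re (h z)) \<le> M"
    by (rule tendsto_upperbound[OF _ eventually_at_rightI[of 0 1]])
      (simp_all only: bound greaterThanLessThan_iff zero_less_one trivial_limit_at_right_real not_False_eq_True)
  then show ?thesis by simp
qed

text \<open>For a bounded function a linear damping is enough: \<open>1 - \<i> \<epsilon> z\<close>
  has modulus at least 1 in the closed upper half-plane, is unbounded there, and tends to 1 with
  \<epsilon>.\<close>

lemma bounded_halfplane_le_one: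
  fixes f :: "complex \<Rightarrow> complex"
  assumes holo: "f holomorphic_on A" and A: "open A" "{z. 0 \<le> Im z} \<subseteq> A"
    and re: "\<And>x. cmod (f (of_real x)) \<le> 1"
    and bounded: "\<And>z. 0 \<le> Im z \<Longrightarrow> cmod (f z) \<le> M"
    and z: "0 \<le> Im z"
  shows "cmod (f z) \<le> 1"
proof -
  have M: "0 \<le> M" using bounded[OF z] norm_ge_zero order_trans by blast
  have bound: "cmod (f z) \<le> cmod (1 - \<i> * of_real \<epsilon> * z)" if \<epsilon>: "0 < \<epsilon>" for \<epsilon>
  proof -
    \<comment> \<open>With this radius \<open>\<epsilon> R - 1 >= M\<close>, so the quotient is at
      most 1 on the arc.\<close>
    define R where "R = max (cmod z) ((M + 1) / \<epsilon>)"
    define S where "S = {w. 0 \<le> Im w} \<inter> cball 0 R"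
    define g where "g w = f w / (1 - \<i> * of_real \<epsilon> * w)" for w
    have ge1: "1 \<le> cmod (1 - \<i> * of_real \<epsilon> * w)" if "0 \<le> Im w" for w
    proof -
      have "1 \<le> Re (1 - \<i> * of_real \<epsilon> * w)" using that \<epsilon> by simp
      then show ?thesis using complex_Re_le_cmod order_trans by blast
    qed
    have "closed S" unfolding S_def
      by (intro closed_Int closed_halfspace_Im_ge closed_cball)
    then have clS: "closure S = S" by simp
    have gh: "g holomorphic_on {w. 0 \<le> Im w}"
      unfolding g_def using ge1 A(2)
      by (intro holomorphic_intros holomorphic_on_subset[OF holo]) force+
    have SA: "S \<subseteq> {w. 0 \<le> Im w}" by (auto simp: S_def)
    have "cmod (g z) \<le> 1"
    proof (rule maximum_modulus_frontier[of g S])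
      show "g holomorphic_on interior S"
        using gh holomorphic_on_subset SA interior_subset by (meson subset_trans)
      show "continuous_on (closure S) g"
        unfolding clS using holomorphic_on_imp_continuous_on[OF gh] continuous_on_subset SA by blast
      show "bounded S" unfolding S_def by (meson bounded_Int bounded_cball)
      show "z \<in> S" using z by (simp add: S_def R_def)
      fix w assume "w \<in> frontier S"
      then have w: "w \<in> S" "w \<notin> interior S" using clS by (auto simp: frontier_def)
      have w2: "0 \<le> Im w" "cmod w \<le> R" using w by (auto simp: S_def)
      have "Im w = 0 \<or> cmod w = R"
      proof (rule ccontr)
        assume "\<not> ?thesis"
        then have "w \<in> {w. 0 < Im w} \<inter> ball 0 R" using w2 by auto
        moreover have "open ({w. 0 < Im w} \<inter> ball 0 R)"
          by (intro open_Int open_halfspace_Im_gt open_ball)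
        moreover have "{w. 0 < Im w} \<inter> ball 0 R \<subseteq> S" by (auto simp: S_def)
        ultimately show False using w(2) interiorI by blast
      qed
      moreover have "cmod (g w) \<le> 1" if "Im w = 0"
      proof -
        have "cmod (f w) \<le> 1" using re[of "Re w"] that
          by (metis complex_eq_iff Re_complex_of_real Im_complex_of_real)
        then show ?thesis using ge1[OF w2(1)] by (simp add: g_def norm_divide divide_le_eq)
      qed
      moreover have "cmod (g w) \<le> 1" if "cmod w = R"
      proof -
        have "\<epsilon> * R \<ge> M + 1" using \<epsilon> unfolding R_def by (simp add: field_simps max_def)
        moreover have "cmod (\<i> * of_real \<epsilon> * w) - cmod 1 \<le> cmod (\<i> * of_real \<epsilon> * w - 1)"
          by (rule norm_triangle_ineq2)
        then have "\<epsilon> * R - 1 \<le> cmod (1 - \<i> * of_real \<epsilon> * w)"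
          using \<epsilon> that by (simp add: norm_mult norm_minus_commute)
        ultimately have "cmod (f w) \<le> cmod (1 - \<i> * of_real \<epsilon> * w)"
          using bounded[OF w2(1)] by linarith
        then show ?thesis using ge1[OF w2(1)] by (simp add: g_def norm_divide divide_le_eq)
      qed
      ultimately show "cmod (g w) \<le> 1" by blast
    qed
    then show ?thesis using ge1[OF z] by (simp add: g_def norm_divide divide_le_eq split: if_splits)
  qed
  have "((\<lambda>\<epsilon>. cmod (1 - \<i> * of_real \<epsilon> * z)) \<longlongrightarrow> cmod (1 - \<i> * of_real 0 * z)) (at_right 0)"
    by (intro tendsto_intros)
  then have "cmod (f z) \<le> cmod (1 - \<i> * of_real 0 * z)"
    by (rule tendsto_lowerbound) (auto intro!: eventually_at_rightI[of 0 1] bound)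
  then show ?thesis by simp
qed

text \<open>Exponential growth is critical for a half-plane but not for a quadrant. The bound on the
  imaginary axis cuts the half-plane into two quadrants, on each of which \<open>f\<close> is
  bounded; boundedness then improves the constant to the one on the real line.\<close>

lemma phragmen_lindeloef_halfplane:
  fixes f :: "complex \<Rightarrow> complex"
  assumes holo: "f holomorphic_on A" and A: "open A" "{z. 0 \<le> Im z} \<subseteq> A"
    and re: "\<And>x. cmod (f (of_real x)) \<le> 1"
    and im: "\<And>y. 0 \<le> y \<Longrightarrow> cmod (f (\<i> * of_real y)) \<le> M"
    and growth: "\<And>z. 0 \<le> Im z \<Longrightarrow> cmod (f z) \<le> C * exp (K * cmod z)"
    and z: "0 \<le> Im z"
  shows "cmod (f z) \<le> 1"
proof (rule bounded_halfplane_le_one[OF holo A re _ z])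
  fix w :: complex assume w: "0 \<le> Im w"
  define M' where "M' = max M 1"
  show "cmod (f w) \<le> M'"
  proof (cases "0 \<le> Re w")
    case True
    show ?thesis
    proof (rule phragmen_lindeloef_quadrant[OF holo A(1)])
      show "{z. 0 \<le> Re z \<and> 0 \<le> Im z} \<subseteq> A" using A(2) by auto
      show "cmod (f (of_real x)) \<le> M'" for x using re[of x] by (simp add: M'_def)
      show "cmod (f (\<i> * of_real y)) \<le> M'" if "0 \<le> y" for y using im[OF that] by (simp add: M'_def)
    qed (use growth w True in \<open>auto simp: M'_def\<close>)
  next
    case False
    \<comment> \<open>Multiplication by \<i> maps the first quadrant to the second, the positive
      real axis to the imaginary axis and the imaginary axis to the negative real axis.\<close>
    have "cmod ((f \<circ> (\<lambda>z. \<i> * z)) (- \<i> * w)) \<le> M'"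
    proof (rule phragmen_lindeloef_quadrant[where f="f \<circ> (\<lambda>z. \<i> * z)" and A="(\<lambda>z. \<i> * z) -` A" and C=C and K=K])
      show "(f \<circ> (\<lambda>z. \<i> * z)) holomorphic_on ((\<lambda>z. \<i> * z) -` A)"
        by (rule holomorphic_on_compose[OF _ holomorphic_on_subset[OF holo]]) (auto intro!: holomorphic_intros)
      show "open ((\<lambda>z. \<i> * z) -` A)"
        by (rule open_vimage[OF A(1)]) (intro continuous_intros)
      show "{z. 0 \<le> Re z \<and> 0 \<le> Im z} \<subseteq> (\<lambda>z. \<i> * z) -` A" by (auto intro!: subsetD[OF A(2)])
      show "cmod ((f \<circ> (\<lambda>z. \<i> * z)) (of_real x)) \<le> M'" if "0 \<le> x" for x
        using im[OF that] by (simp add: M'_def)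
      show "cmod ((f \<circ> (\<lambda>z. \<i> * z)) (\<i> * of_real y)) \<le> M'" for y
        using re[of "- y"] by (simp add: M'_def)
      show "cmod ((f \<circ> (\<lambda>z. \<i> * z)) z) \<le> C * exp (K * cmod z)" if "0 \<le> Re z" for z
        using growth[of "\<i> * z"] that by (simp add: norm_mult)
    qed (use False w in \<open>auto simp: M'_def\<close>)
    then show ?thesis by simp
  qed
qed

text \<open>If the modulus of \<open>P\<close> were at least \<open>2 exp (- \<alpha> y)\<close> for all large \<open>y\<close>, then by
  Phragmen--Lindeloef it would be so for all \<open>y \<ge> 0\<close>, which contradicts the expansion at the origin.\<close>

lemma small_value_on_imaginary_axis:
  fixes P :: "complex \<Rightarrow> complex"
  assumes holo: "P holomorphic_on UNIV"
    and re: "\<And>x. 2 \<le> cmod (P (of_real x))"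
    and lower: "\<And>z. 0 < Im z \<Longrightarrow> exp (- K * cmod z) \<le> cmod (P z)" and K: "0 \<le> K"
    and at0: "\<And>z. cmod z \<le> 1 \<Longrightarrow> cmod (P z - (2 * \<i> - z)) \<le> C * (cmod z)\<^sup>2"
    and \<alpha>: "0 \<le> \<alpha>" "\<alpha> < 1/2"
  shows "\<exists>y\<ge>Y. cmod (P (\<i> * of_real y)) < 2 * exp (- \<alpha> * y)"
proof (rule ccontr)
  assume "\<not> ?thesis"
  then have far: "2 * exp (- \<alpha> * y) \<le> cmod (P (\<i> * of_real y))" if "Y \<le> y" for y
    using that by force
  \<comment> \<open>A neighbourhood of the closed half-plane on which \<open>1 / P\<close> is
    holomorphic: \<open>re\<close> and \<open>lower\<close> exclude zeros there.\<close>
  define A where "A = {z. P z \<noteq> 0}"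
  have contP: "continuous_on UNIV P" using holo holomorphic_on_imp_continuous_on by blast
  have "A = P -` (- {0})" by (auto simp: A_def)
  then have "open A" using contP by (simp add: open_vimage open_Compl)
  have lower': "exp (- K * cmod z) \<le> cmod (P z)" if "0 \<le> Im z" for z
  proof (cases "Im z = 0")
    case True
    then have "2 \<le> cmod (P z)" using re[of "Re z"]
      by (metis complex_eq_iff Re_complex_of_real Im_complex_of_real)
    moreover have "exp (- K * cmod z) \<le> 1" using K by simp
    ultimately show ?thesis by linarith
  qed (use lower that in auto)
  have AH: "{z. 0 \<le> Im z} \<subseteq> A"
    using lower' unfolding A_def by (smt (verit, ccfv_SIG) Collect_mono exp_gt_zero norm_zero)
  \<comment> \<open>At most 1 on the real line by \<open>re\<close>, and far up the imaginary axis
    by the assumption to be refuted; \<open>lower\<close> makes it grow at most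
    exponentially.\<close>
  define G where "G z = 2 * exp (\<i> * of_real \<alpha> * z) / P z" for z
  have normG: "cmod (G z) = 2 * exp (- \<alpha> * Im z) / cmod (P z)" for z
    by (simp add: G_def norm_divide norm_mult)
  have Ggrowth: "cmod (G z) \<le> 2 * exp (K * cmod z)" if "0 \<le> Im z" for z
  proof -
    have e1: "exp (- \<alpha> * Im z) \<le> 1" using \<alpha> that by simp
    have "cmod (G z) \<le> 2 * exp (- \<alpha> * Im z) / exp (- K * cmod z)"
      unfolding normG using lower'[OF that] by (intro divide_left_mono mult_pos_pos order_less_le_trans[OF exp_gt_zero lower'[OF that]]) auto
    also have "\<dots> \<le> 2 * 1 / exp (- K * cmod z)"
      by (intro divide_right_mono mult_left_mono e1) auto
    also have "\<dots> = 2 * exp (K * cmod z)" by (simp add: exp_minus field_simps)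
    finally show ?thesis .
  qed
  have G1: "cmod (G z) \<le> 1" if "0 \<le> Im z" for z
  proof (rule phragmen_lindeloef_halfplane[OF _ \<open>open A\<close> AH _ _ Ggrowth that])
    show "G holomorphic_on A"
      unfolding G_def by (intro holomorphic_intros holomorphic_on_subset[OF holo]) (auto simp: A_def)
    show "cmod (G (of_real x)) \<le> 1" for x using re[of x] by (simp add: normG divide_le_eq)
    show "cmod (G (\<i> * of_real y)) \<le> max 1 (2 * exp (K * \<bar>Y\<bar>))" if "0 \<le> y" for y
    proof (cases "Y \<le> y")
      case True
      then have "cmod (G (\<i> * of_real y)) \<le> 1"
        using far[OF True] unfolding normG by (auto simp: divide_le_eq intro: order_less_le_trans)
      then show ?thesis by simp
    next
      case False
      have "cmod (G (\<i> * of_real y)) \<le> 2 * exp (K * y)"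
        using Ggrowth[of "\<i> * of_real y"] that by (simp add: norm_mult)
      also have "\<dots> \<le> 2 * exp (K * \<bar>Y\<bar>)" using False K that by (auto intro!: mult_left_mono)
      finally show ?thesis by simp
    qed
  qed
  have low: "2 * exp (- \<alpha> * y) \<le> cmod (P (\<i> * of_real y))" if "0 \<le> y" for y
  proof -
    have "\<i> * of_real y \<in> A" using that AH by auto
    then have "0 < cmod (P (\<i> * of_real y))" by (simp add: A_def)
    then show ?thesis using G1[of "\<i> * of_real y"] that by (simp add: normG divide_le_eq)
  qed
  \<comment> \<open>Both bounds for \<open>|P(\<i> y)|\<close> equal 2 at \<open>y = 0\<close>. The
    lower one has slope \<open>- 2 * \<alpha>\<close>, the upper one slope -1, which is smaller
    because \<alpha> is below 1/2.\<close>
  have key: "1 - 2 * \<alpha> \<le> \<bar>C\<bar> * y" if y: "0 < y" "y \<le> 1" for y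
  proof -
    have "cmod (P (\<i> * of_real y)) \<le> cmod (P (\<i> * of_real y) - (2 * \<i> - \<i> * of_real y)) + cmod (2 * \<i> - \<i> * of_real y)"
      by (metis diff_add_cancel norm_triangle_ineq)
    also have "cmod (P (\<i> * of_real y) - (2 * \<i> - \<i> * of_real y)) \<le> C * y\<^sup>2"
      using at0[of "\<i> * of_real y"] y by (simp add: norm_mult)
    also have "2 * \<i> - \<i> * of_real y = \<i> * of_real (2 - y)" by (simp add: algebra_simps)
    also have "cmod (\<i> * of_real (2 - y)) = 2 - y" using y by (simp only: norm_mult norm_of_real) simp
    finally have u: "cmod (P (\<i> * of_real y)) \<le> C * y\<^sup>2 + (2 - y)" by simp
    have "1 + (- \<alpha> * y) \<le> exp (- \<alpha> * y)" by (rule exp_ge_add_one_self)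
    then have "2 * (1 - \<alpha> * y) \<le> 2 * exp (- \<alpha> * y)" by simp
    moreover have "2 - 2 * \<alpha> * y = 2 * (1 - \<alpha> * y)" by (simp add: algebra_simps)
    ultimately have "2 - 2 * \<alpha> * y \<le> C * y\<^sup>2 + (2 - y)" using u low[of y] y by linarith
    also have "C * y\<^sup>2 \<le> \<bar>C\<bar> * y\<^sup>2" by (intro mult_right_mono) auto
    finally have "(1 - 2 * \<alpha>) * y \<le> (\<bar>C\<bar> * y) * y" by (simp add: algebra_simps power2_eq_square)
    then show ?thesis using y by simp
  qed
  \<comment> \<open>Makes \<open>|C| y\<close> at most half of
    \<open>1 - 2 * \<alpha>\<close>.\<close>
  define y where "y = min 1 ((1 - 2 * \<alpha>) / (2 * (\<bar>C\<bar> + 1)))"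
  have y: "0 < y" "y \<le> 1" unfolding y_def using \<alpha> by auto
  have "\<bar>C\<bar> * y \<le> (\<bar>C\<bar> + 1) * ((1 - 2 * \<alpha>) / (2 * (\<bar>C\<bar> + 1)))"
    using \<alpha> by (intro mult_mono) (auto simp: y_def)
  also have "\<dots> = (1 - 2 * \<alpha>) / 2" by (simp add: field_simps)
  finally have "1 - 2 * \<alpha> \<le> (1 - 2 * \<alpha>) / 2" using key[OF y] by (rule order.trans[rotated])
  then show False using \<alpha> by simp
qed

section \<open>Holomorphic dependence on the spectral parameter\<close>

context canonical_system
begin

lemma solution_bound:
  assumes sol: "solution z u v" and x: "0 \<le> x" "x \<le> X"
    and r: "0 \<le> r" "(cmod (u 0))\<^sup>2 + (cmod (v 0))\<^sup>2 \<le> r\<^sup>2"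
  shows "cmod (u x) \<le> r * exp (cmod z * \<eta> x)" "cmod (v x) \<le> r * exp (cmod z * \<eta> x)"
proof -
  have "((cmod (u 0))\<^sup>2 + (cmod (v 0))\<^sup>2) * exp (2 * cmod z * \<eta> x) \<le> r\<^sup>2 * exp (2 * cmod z * \<eta> x)"
    by (rule mult_right_mono[OF r(2)]) simp
  also have "\<dots> = (r * exp (cmod z * \<eta> x))\<^sup>2"
    by (simp add: power_mult_distrib mult.assoc flip: exp_double)
  finally have *: "(cmod (u x))\<^sup>2 + (cmod (v x))\<^sup>2 \<le> (r * exp (cmod z * \<eta> x))\<^sup>2"
    using growth[OF sol x] by (rule order.trans[rotated])
  have "(cmod (u x))\<^sup>2 \<le> (r * exp (cmod z * \<eta> x))\<^sup>2" "(cmod (v x))\<^sup>2 \<le> (r * exp (cmod z * \<eta> x))\<^sup>2"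
    using * zero_le_power2[of "cmod (u x)"] zero_le_power2[of "cmod (v x)"] by linarith+
  then show "cmod (u x) \<le> r * exp (cmod z * \<eta> x)" "cmod (v x) \<le> r * exp (cmod z * \<eta> x)"
    using r(1) by (auto intro: power2_le_imp_le)
qed

text \<open>The complex bilinear form of the matrix \<open>H(x)\<close> in the vectors
  \<open>(p, q)\<close> and \<open>(r, s)\<close>; conjugation is put into the arguments where it is
  wanted.\<close>

definition form :: "real \<Rightarrow> complex \<Rightarrow> complex \<Rightarrow> complex \<Rightarrow> complex \<Rightarrow> complex" where
  "form x p q r s = of_real (a x) * (p * r) + of_real (b x) * (p * s + q * r) + of_real (c x) * (q * s)"

lemma form_bound:
  assumes "cmod p \<le> B" "cmod q \<le> B" "cmod r \<le> D" "cmod s \<le> D"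
  shows "cmod (form x p q r s) \<le> 2 * (B * D) * (a x + c x)"
proof -
  have B: "0 \<le> B" "0 \<le> D" using assms norm_ge_zero order_trans by blast+
  have pr: "cmod (p * r) \<le> B * D" "cmod (q * s) \<le> B * D" "cmod (p * s) \<le> B * D" "cmod (q * r) \<le> B * D"
    unfolding norm_mult using assms B by (auto intro: mult_mono)
  have "cmod (form x p q r s) \<le> a x * cmod (p * r) + \<bar>b x\<bar> * cmod (p * s + q * r) + c x * cmod (q * s)"
    unfolding form_def using nonneg[of x]
    by (intro order.trans[OF norm_triangle_ineq] add_mono) (simp_all add: norm_mult)
  also have "\<dots> \<le> a x * (B * D) + (a x + c x) / 2 * (B * D + B * D) + c x * (B * D)"
    using pr nonneg[of x] abs_b_le[of x]
    by (intro add_mono mult_mono order.trans[OF norm_triangle_ineq]) auto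
  also have "\<dots> = 2 * (B * D) * (a x + c x)" by (simp add: field_simps)
  finally show ?thesis .
qed

lemma form_diff: "form x p q r s - form x p q r' s' = form x p q (r - r') (s - s')"
  by (simp add: form_def algebra_simps)

lemma lagrange_form:
  assumes "solution w u v" "solution z u1 v1"
  shows "primitive_on X (\<lambda>x. v x * u1 x - u x * v1 x) (\<lambda>x. (z - w) * form x (u x) (v x) (u1 x) (v1 x))"
  using lagrange[OF assms] unfolding form_def .

lemma form_absint:
  assumes "solution w u v" "solution z u1 v1"
  shows "(\<lambda>x. form x (u x) (v x) (u1 x) (v1 x)) absolutely_integrable_on {0..X}"
proof -
  note cont = assms[unfolded solution_def, THEN conjunct1, THEN primitive_on_continuous]
    assms[unfolded solution_def, THEN conjunct2, THEN primitive_on_continuous]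
  have h: "(\<lambda>x. complex_of_real (g x) * f x) absolutely_integrable_on {0..X}"
    if "g absolutely_integrable_on {0..X}" "continuous_on {0..X} f" for f g
  proof -
    have "(\<lambda>x. f x * complex_of_real (g x)) absolutely_integrable_on {0..X}"
      by (rule absint_continuous_mult[OF bounded_bilinear_mult that(2)])
        (use absolutely_integrable_linear[OF that(1) bounded_linear_of_real[where 'a=complex]] in \<open>simp add: comp_def\<close>)
    then show ?thesis by (simp add: mult.commute)
  qed
  show ?thesis unfolding form_def
    by (intro set_integral_add h abs_int continuous_intros cont)
qed

lemma form_integral_bound:
  assumes sol: "solution w u v" "solution z u1 v1" and x: "0 \<le> x" "x \<le> X"
    and B: "\<And>s. 0 \<le> s \<Longrightarrow> s \<le> x \<Longrightarrow> cmod (u s) \<le> B" "\<And>s. 0 \<le> s \<Longrightarrow> s \<le> x \<Longrightarrow> cmod (v s) \<le> B"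
      "\<And>s. 0 \<le> s \<Longrightarrow> s \<le> x \<Longrightarrow> cmod (u1 s) \<le> D" "\<And>s. 0 \<le> s \<Longrightarrow> s \<le> x \<Longrightarrow> cmod (v1 s) \<le> D"
  shows "cmod (integral {0..x} (\<lambda>s. form s (u s) (v s) (u1 s) (v1 s))) \<le> 2 * (B * D) * \<eta> x"
proof -
  have "norm (integral {0..x} (\<lambda>s. form s (u s) (v s) (u1 s) (v1 s)) - integral {0..0} (\<lambda>s. form s (u s) (v s) (u1 s) (v1 s)))
    \<le> 2 * (B * D) * \<eta> x - 2 * (B * D) * \<eta> 0"
    by (rule primitive_on_norm_le[OF primitive_on_mono[OF primitive_on_integral[OF form_absint[OF sol]] x(2)]
         primitive_on_cmult[OF primitive_on_mono[OF eta_primitive x(2)]] x(1)])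
      (intro form_bound B, auto)
  then show ?thesis by simp
qed

end

text \<open>\<open>(u1, v1)\<close> and \<open>(u2, v2)\<close> are the two columns of the
  fundamental matrix.\<close>

locale canonical_family = canonical_system +
  fixes u1 v1 u2 v2 :: "complex \<Rightarrow> real \<Rightarrow> complex"
  assumes sol1: "\<And>z. solution z (u1 z) (v1 z)" and sol2: "\<And>z. solution z (u2 z) (v2 z)"
    and init: "\<And>z. u1 z 0 = 1" "\<And>z. v1 z 0 = 0" "\<And>z. u2 z 0 = 0" "\<And>z. v2 z 0 = 1"
begin

lemma det_eq_1:
  assumes "0 \<le> x" "x \<le> X"
  shows "u1 z x * v2 z x - u2 z x * v1 z x = 1"
  using primitive_on_eq[OF lagrange_form[OF sol1[of z] sol2[of z]] assms]
  by (simp add: init algebra_simps)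

text \<open>Variation of constants: the Lagrange identities against both columns at \<open>w\<close>
  are two linear equations for \<open>(U x, V x)\<close> with determinant 1. The explicit factor
  \<open>z - w\<close> is what differentiation in the parameter needs.\<close>

lemma solution_expansion:
  fixes w :: complex
  assumes sol: "solution z U V" and x: "0 \<le> x" "x \<le> X"
  defines "I1 \<equiv> integral {0..x} (\<lambda>s. form s (u1 w s) (v1 w s) (U s) (V s))"
    and "I2 \<equiv> integral {0..x} (\<lambda>s. form s (u2 w s) (v2 w s) (U s) (V s))"
  shows "U x = U 0 * u1 w x + V 0 * u2 w x + (z - w) * (u1 w x * I2 - u2 w x * I1)"
    and "V x = U 0 * v1 w x + V 0 * v2 w x + (z - w) * (v1 w x * I2 - v2 w x * I1)"
proof -
  have e1: "v1 w x * U x - u1 w x * V x = - V 0 + (z - w) * I1"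
    using primitive_on_eq[OF lagrange_form[OF sol1[of w] sol] x] by (simp add: init I1_def)
  have e2: "v2 w x * U x - u2 w x * V x = U 0 + (z - w) * I2"
    using primitive_on_eq[OF lagrange_form[OF sol2[of w] sol] x] by (simp add: init I2_def)
  note d = det_eq_1[OF x, of w]
  have "U x = (u1 w x * v2 w x - u2 w x * v1 w x) * U x" using d by simp
  also have "\<dots> = u1 w x * (v2 w x * U x - u2 w x * V x) - u2 w x * (v1 w x * U x - u1 w x * V x)"
    by (simp add: algebra_simps)
  also have "\<dots> = U 0 * u1 w x + V 0 * u2 w x + (z - w) * (u1 w x * I2 - u2 w x * I1)"
    unfolding e1 e2 by (simp add: algebra_simps)
  finally show "U x = U 0 * u1 w x + V 0 * u2 w x + (z - w) * (u1 w x * I2 - u2 w x * I1)" .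
  have "V x = (u1 w x * v2 w x - u2 w x * v1 w x) * V x" using d by simp
  also have "\<dots> = v1 w x * (v2 w x * U x - u2 w x * V x) - v2 w x * (v1 w x * U x - u1 w x * V x)"
    by (simp add: algebra_simps)
  also have "\<dots> = U 0 * v1 w x + V 0 * v2 w x + (z - w) * (v1 w x * I2 - v2 w x * I1)"
    unfolding e1 e2 by (simp add: algebra_simps)
  finally show "V x = U 0 * v1 w x + V 0 * v2 w x + (z - w) * (v1 w x * I2 - v2 w x * I1)" .
qed

text \<open>By the expansion the difference quotient at \<open>w\<close> is a combination of two
  integrals, and only their continuity in \<open>z\<close> is left. It comes in two rounds: the
  growth bound makes the integrals bounded, hence the solutions Lipschitz in \<open>z\<close> at
  \<open>w\<close>, hence the integrals Lipschitz as well.\<close>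

lemma solution_holomorphic:
  assumes sol: "\<And>z. solution z (U z) (V z)" and ini: "\<And>z. U z 0 = \<alpha>" "\<And>z. V z 0 = \<beta>"
    and x: "0 \<le> x" "x \<le> X"
  shows "(\<lambda>z. U z x) holomorphic_on UNIV" "(\<lambda>z. V z x) holomorphic_on UNIV"
proof -
  define I1 where "I1 w z s = integral {0..s} (\<lambda>s. form s (u1 w s) (v1 w s) (U z s) (V z s))" for w z s
  define I2 where "I2 w z s = integral {0..s} (\<lambda>s. form s (u2 w s) (v2 w s) (U z s) (V z s))" for w z s
  define r where "r = 1 + cmod \<alpha> + cmod \<beta>"
  have r0: "0 \<le> r" and r1: "1 \<le> r" by (auto simp: r_def)
  have r2: "(cmod \<alpha>)\<^sup>2 + (cmod \<beta>)\<^sup>2 \<le> r\<^sup>2"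
    unfolding r_def power2_eq_square by (simp add: algebra_simps)
  have exp: "U z s - U w s = (z - w) * (u1 w s * I2 w z s - u2 w s * I1 w z s)"
       "V z s - V w s = (z - w) * (v1 w s * I2 w z s - v2 w s * I1 w z s)" if "0 \<le> s" "s \<le> x" for s z w
    using solution_expansion[OF sol[of z], of s w] solution_expansion[OF sol[of w], of s w] that x
    by (simp_all add: ini I1_def I2_def)
  have diffable: "(\<lambda>z. U z x) field_differentiable at w \<and> (\<lambda>z. V z x) field_differentiable at w" for w
  proof -
    \<comment> \<open>One bound on \<open>[0, x]\<close> for all solutions involved, with parameters
      in the unit disc around \<open>w\<close>.\<close>
    define B where "B = r * exp ((cmod w + 1) * \<eta> x)"
    have B0: "0 \<le> B" using r0 by (simp add: B_def)
    have bnd: "cmod (f s) \<le> B \<and> cmod (g s) \<le> B"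
      if "solution z f g" "(cmod (f 0))\<^sup>2 + (cmod (g 0))\<^sup>2 \<le> r\<^sup>2" "cmod (z - w) \<le> 1" "0 \<le> s" "s \<le> x" for z s f g
    proof -
      have "cmod z \<le> cmod w + 1" using that(3) norm_triangle_sub[of z w] by simp
      moreover have "\<eta> s \<le> \<eta> x" "0 \<le> \<eta> s" using eta_mono[of s x] eta_mono[of 0 s] that x by auto
      ultimately have "cmod z * \<eta> s \<le> (cmod w + 1) * \<eta> x" by (intro mult_mono) auto
      then have "r * exp (cmod z * \<eta> s) \<le> B" unfolding B_def using r0 by (simp add: mult_left_mono)
      then show ?thesis
        using solution_bound[OF that(1) that(4) _ r0 that(2)] that x by (meson order_trans)
    qed
    have one: "(cmod 1)\<^sup>2 + (cmod 0)\<^sup>2 \<le> r\<^sup>2" "(cmod 0)\<^sup>2 + (cmod 1)\<^sup>2 \<le> r\<^sup>2"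
      using r1 by (simp_all add: power2_nonneg_ge_1_iff)
    have bU: "cmod (U z s) \<le> B" "cmod (V z s) \<le> B" if "cmod (z - w) \<le> 1" "0 \<le> s" "s \<le> x" for z s
      using bnd[OF sol[of z] _ that] ini r2 by auto
    have b1: "cmod (u1 w s) \<le> B" "cmod (v1 w s) \<le> B" "cmod (u2 w s) \<le> B" "cmod (v2 w s) \<le> B" if "0 \<le> s" "s \<le> x" for s
      using bnd[OF sol1[of w] _ _ that] bnd[OF sol2[of w] _ _ that] one init by auto
    have I_bound: "cmod (I1 w z s) \<le> 2 * (B * B) * \<eta> x" "cmod (I2 w z s) \<le> 2 * (B * B) * \<eta> x"
      if "cmod (z - w) \<le> 1" "0 \<le> s" "s \<le> x" for z s
    proof -
      have "2 * (B * B) * \<eta> s \<le> 2 * (B * B) * \<eta> x"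
        using eta_mono[of s x] that x by (intro mult_left_mono) auto
      then show "cmod (I1 w z s) \<le> 2 * (B * B) * \<eta> x" "cmod (I2 w z s) \<le> 2 * (B * B) * \<eta> x"
        unfolding I1_def I2_def
        using form_integral_bound[OF sol1[of w] sol[of z], of s B B] form_integral_bound[OF sol2[of w] sol[of z], of s B B]
          that x b1 bU by (smt (verit))+
    qed
    define C where "C = 2 * B * (2 * (B * B) * \<eta> x)"
    have comb: "cmod (p * i - q * j) \<le> C"
      if "cmod p \<le> B" "cmod q \<le> B" "cmod i \<le> 2 * (B * B) * \<eta> x" "cmod j \<le> 2 * (B * B) * \<eta> x" for p q i j
    proof -
      have "cmod (p * i - q * j) \<le> cmod p * cmod i + cmod q * cmod j"
        using norm_triangle_ineq4[of "p * i" "q * j"] by (simp add: norm_mult)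
      also have "\<dots> \<le> B * (2 * (B * B) * \<eta> x) + B * (2 * (B * B) * \<eta> x)"
        using that B0 by (intro add_mono mult_mono) auto
      finally show ?thesis by (simp add: C_def)
    qed
    have lip: "cmod (U z s - U w s) \<le> cmod (z - w) * C" "cmod (V z s - V w s) \<le> cmod (z - w) * C"
      if "cmod (z - w) \<le> 1" "0 \<le> s" "s \<le> x" for z s
      using exp[OF that(2,3), of z w] comb[OF b1(1)[OF that(2,3)] b1(3)[OF that(2,3)] I_bound(2)[OF that] I_bound(1)[OF that]]
        comb[OF b1(2)[OF that(2,3)] b1(4)[OF that(2,3)] I_bound(2)[OF that] I_bound(1)[OF that]]
      by (auto simp: norm_mult intro: mult_left_mono)
    have Ilip: "cmod (I1 w z x - I1 w w x) \<le> cmod (z - w) * (2 * (B * C) * \<eta> x)"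
        "cmod (I2 w z x - I2 w w x) \<le> cmod (z - w) * (2 * (B * C) * \<eta> x)"
      if z: "cmod (z - w) \<le> 1" for z
    proof -
      have key: "cmod (integral {0..x} (\<lambda>s. form s (f s) (g s) (U z s) (V z s)) - integral {0..x} (\<lambda>s. form s (f s) (g s) (U w s) (V w s)))
         \<le> cmod (z - w) * (2 * (B * C) * \<eta> x)"
        if fg: "solution w f g" "\<And>s. 0 \<le> s \<Longrightarrow> s \<le> x \<Longrightarrow> cmod (f s) \<le> B \<and> cmod (g s) \<le> B" for f g
      proof -
        note p1 = primitive_on_mono[OF primitive_on_diff[OF primitive_on_integral[OF form_absint[OF fg(1) sol[of z]]]
               primitive_on_integral[OF form_absint[OF fg(1) sol[of w]]]] x(2)]
        have "norm (integral {0..x} (\<lambda>s. form s (f s) (g s) (U z s) (V z s)) - integral {0..x} (\<lambda>s. form s (f s) (g s) (U w s) (V w s))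
              - (integral {0..0} (\<lambda>s. form s (f s) (g s) (U z s) (V z s)) - integral {0..0} (\<lambda>s. form s (f s) (g s) (U w s) (V w s))))
           \<le> 2 * (B * (cmod (z - w) * C)) * \<eta> x - 2 * (B * (cmod (z - w) * C)) * \<eta> 0"
          by (rule primitive_on_norm_le[OF p1 primitive_on_cmult[OF primitive_on_mono[OF eta_primitive x(2)]] x(1)])
            (unfold form_diff, intro form_bound, use fg(2) lip[OF z] in auto)
        then show ?thesis by (simp add: mult_ac)
      qed
      show "cmod (I1 w z x - I1 w w x) \<le> cmod (z - w) * (2 * (B * C) * \<eta> x)"
        "cmod (I2 w z x - I2 w w x) \<le> cmod (z - w) * (2 * (B * C) * \<eta> x)"
        unfolding I1_def I2_def using key[OF sol1] key[OF sol2] b1 by auto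
    qed
    have lim: "((\<lambda>z. I w z x) \<longlongrightarrow> I w w x) (at w)"
      if "\<And>z. cmod (z - w) \<le> 1 \<Longrightarrow> cmod (I w z x - I w w x) \<le> cmod (z - w) * K" for I :: "complex \<Rightarrow> complex \<Rightarrow> real \<Rightarrow> complex" and K
    proof (rule LIM_zero_cancel, rule Lim_null_comparison)
      show "\<forall>\<^sub>F z in at w. cmod (I w z x - I w w x) \<le> cmod (z - w) * K"
        unfolding eventually_at by (rule exI[of _ 1]) (use that in \<open>auto simp: dist_norm\<close>)
      have "((\<lambda>z. cmod (z - w) * K) \<longlongrightarrow> cmod (w - w) * K) (at w)" by (intro tendsto_intros)
      then show "((\<lambda>z. cmod (z - w) * K) \<longlongrightarrow> 0) (at w)" by simp
    qed
    have L: "((\<lambda>z. I1 w z x) \<longlongrightarrow> I1 w w x) (at w)" "((\<lambda>z. I2 w z x) \<longlongrightarrow> I2 w w x) (at w)"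
      using lim[of I1] lim[of I2] Ilip by blast+
    have "((\<lambda>z. U z x) has_field_derivative (u1 w x * I2 w w x - u2 w x * I1 w w x)) (at w)"
      unfolding has_field_derivative_iff
    proof (rule Lim_transform_eventually)
      show "((\<lambda>z. u1 w x * I2 w z x - u2 w x * I1 w z x) \<longlongrightarrow> u1 w x * I2 w w x - u2 w x * I1 w w x) (at w)"
        by (intro tendsto_intros L)
      show "\<forall>\<^sub>F z in at w. u1 w x * I2 w z x - u2 w x * I1 w z x = (U z x - U w x) / (z - w)"
        using exp(1)[OF x(1) order.refl, of _ w] by (intro eventually_at_filter[THEN iffD2] always_eventually) simp
    qed
    moreover have "((\<lambda>z. V z x) has_field_derivative (v1 w x * I2 w w x - v2 w x * I1 w w x)) (at w)"
      unfolding has_field_derivative_iff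
    proof (rule Lim_transform_eventually)
      show "((\<lambda>z. v1 w x * I2 w z x - v2 w x * I1 w z x) \<longlongrightarrow> v1 w x * I2 w w x - v2 w x * I1 w w x) (at w)"
        by (intro tendsto_intros L)
      show "\<forall>\<^sub>F z in at w. v1 w x * I2 w z x - v2 w x * I1 w z x = (V z x - V w x) / (z - w)"
        using exp(2)[OF x(1) order.refl, of _ w] by (intro eventually_at_filter[THEN iffD2] always_eventually) simp
    qed
    ultimately show ?thesis unfolding field_differentiable_def by blast
  qed
  then show "(\<lambda>z. U z x) holomorphic_on UNIV" "(\<lambda>z. V z x) holomorphic_on UNIV"
    by (auto simp: holomorphic_on_def)
qed

end

section \<open>The real limit\<close>

text \<open>A closed sector becomes the cone \<open>\<sigma> |z| <= Im z\<close>, which is invariant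
  under positive dilations and enters the estimates directly.\<close>

definition cone_tendsto :: "(complex \<Rightarrow> complex) \<Rightarrow> complex \<Rightarrow> bool" where
  "cone_tendsto m \<zeta> \<longleftrightarrow> (\<forall>\<sigma>>0. \<forall>\<epsilon>>0. \<exists>R. \<forall>z. R \<le> cmod z \<and> 0 < cmod z \<and> \<sigma> * cmod z \<le> Im z \<longrightarrow> cmod (m z - \<zeta>) < \<epsilon>)"

section \<open>Pointwise inequalities and the energy identity\<close>

context canonical_system
begin

text \<open>Weighted arithmetic-geometric mean. If the mean of \<open>a\<close> is of order
  \<open>\<epsilon>\<^sup>2\<close>, this weight bounds the mean of \<open>|b|\<close> by order
  \<epsilon>.\<close>

lemma abs_b_le_weighted:
  assumes "0 < \<epsilon>" shows "\<bar>b x\<bar> \<le> a x / (2 * \<epsilon>) + \<epsilon> * c x / 2"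
proof (rule power2_le_imp_le)
  have "(\<bar>b x\<bar>)\<^sup>2 \<le> a x * c x" using det_nonneg by simp
  also have "\<dots> = 4 * ((a x / (2 * \<epsilon>)) * (\<epsilon> * c x / 2))" using assms by (simp add: field_simps)
  also have "\<dots> \<le> (a x / (2 * \<epsilon>) + \<epsilon> * c x / 2)\<^sup>2"
    using zero_le_power2[of "a x / (2 * \<epsilon>) - \<epsilon> * c x / 2"] unfolding power2_diff power2_sum
    by (simp only: mult.assoc)
  finally show "(\<bar>b x\<bar>)\<^sup>2 \<le> (a x / (2 * \<epsilon>) + \<epsilon> * c x / 2)\<^sup>2" .
  show "0 \<le> a x / (2 * \<epsilon>) + \<epsilon> * c x / 2" using assms nonneg[of x] by simp
qed

text \<open>Lets \<open>x\<close> be chosen so that \<open>|z| \<eta>(x)\<close> has a prescribed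
  value.\<close>

lemma eta_attains:
  assumes "0 < s" "s \<le> \<eta> X"
  obtains x where "0 < x" "x \<le> X" "\<eta> x = s"
proof -
  obtain x where "0 \<le> x" "x \<le> X" "\<eta> x = s"
    using IVT'[of \<eta> 0 s X] assms eta_continuous X_pos by auto
  then show ?thesis using that[of x] assms by (metis eta_0 less_eq_real_def)
qed

lemma eta_less_imp_less:
  assumes "0 \<le> y" "x \<le> X" "\<eta> x < \<eta> y" "y \<le> X" shows "x < y"
  using eta_mono[of y x] assms by (meson linorder_not_le)

definition energy :: "(real \<Rightarrow> complex) \<Rightarrow> (real \<Rightarrow> complex) \<Rightarrow> real \<Rightarrow> real" where
  "energy u v x = a x * (cmod (u x))\<^sup>2 + 2 * b x * Re (cnj (u x) * v x) + c x * (cmod (v x))\<^sup>2"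

lemma energy_form: "form x (cnj (u x)) (cnj (v x)) (u x) (v x) = of_real (energy u v x)"
  unfolding form_def energy_def cmod_power2
  by (simp add: complex_eq_iff power2_eq_square algebra_simps)

text \<open>Lagrange identity for the solution and its conjugate, whose parameters differ by
  \<open>2 \<i> Im z\<close>. Consequently nonnegativity of \<open>Im (cnj u v)\<close> at
  \<open>x\<close> bounds the energy spent up to \<open>x\<close>.\<close>

lemma energy_primitive:
  assumes "solution z u v"
  shows "primitive_on X (\<lambda>x. Im (cnj (u x) * v x)) (\<lambda>x. - Im z * energy u v x)"
proof -
  have "primitive_on X (\<lambda>x. - (1/2) * Im (cnj (v x) * u x - cnj (u x) * v x))
     (\<lambda>x. - (1/2) * Im ((z - cnj z) * form x (cnj (u x)) (cnj (v x)) (u x) (v x)))"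
    by (intro primitive_on_cmult primitive_on_Im lagrange_form solution_cnj assms)
  then show ?thesis
    by (rule primitive_on_cong) (simp_all add: energy_form field_simps)
qed

text \<open>Cauchy-Schwarz for the semidefinite form \<open>H(x)\<close>, each row of
  \<open>H Y\<close> being tested against a unit vector. The defect is \<open>det H\<close> times
  \<open>|u|^2\<close> or \<open>|v|^2\<close>.\<close>

lemma energy_bounds:
  shows "(cmod (of_real (b x) * u x + of_real (c x) * v x))\<^sup>2 \<le> c x * energy u v x" (is ?A)
    and "(cmod (of_real (a x) * u x + of_real (b x) * v x))\<^sup>2 \<le> a x * energy u v x" (is ?B)
    and "0 \<le> energy u v x" (is ?C)
proof -
  have "c x * energy u v x - (cmod (of_real (b x) * u x + of_real (c x) * v x))\<^sup>2 = (a x * c x - (b x)\<^sup>2) * (cmod (u x))\<^sup>2"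
    unfolding energy_def cmod_power2 by (simp add: power2_eq_square algebra_simps)
  moreover have "0 \<le> (a x * c x - (b x)\<^sup>2) * (cmod (u x))\<^sup>2" using det_nonneg[of x] by simp
  ultimately show A: ?A by linarith
  have "a x * energy u v x - (cmod (of_real (a x) * u x + of_real (b x) * v x))\<^sup>2 = (a x * c x - (b x)\<^sup>2) * (cmod (v x))\<^sup>2"
    unfolding energy_def cmod_power2 by (simp add: power2_eq_square algebra_simps)
  moreover have "0 \<le> (a x * c x - (b x)\<^sup>2) * (cmod (v x))\<^sup>2" using det_nonneg[of x] by simp
  ultimately show B: ?B by linarith
  have "0 \<le> (a x + c x) * energy u v x"
    using order.trans[OF zero_le_power2 A] order.trans[OF zero_le_power2 B] by (simp add: distrib_right)
  then show ?C using trace_pos[of x] by (simp add: zero_le_mult_iff)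
qed

text \<open>Linearised form of \<open>|row|^2 <= t E\<close>, with \<open>t\<close> the trace and
  \<open>E\<close> the energy, so that the two can be integrated separately; \<nu> balances the two
  integrals.\<close>

lemma energy_bound_weighted:
  assumes "0 < \<nu>"
  shows "cmod (of_real (b x) * u x + of_real (c x) * v x) \<le> \<nu> / 2 * (a x + c x) + energy u v x / (2 * \<nu>)"
    and "cmod (of_real (a x) * u x + of_real (b x) * v x) \<le> \<nu> / 2 * (a x + c x) + energy u v x / (2 * \<nu>)"
proof -
  note e0 = energy_bounds(3)[of u v x]
  have t: "(a x + c x) * energy u v x \<le> (\<nu> / 2 * (a x + c x) + energy u v x / (2 * \<nu>))\<^sup>2"
  proof -
    have "(a x + c x) * energy u v x = 4 * ((\<nu> / 2 * (a x + c x)) * (energy u v x / (2 * \<nu>)))"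
      using assms by (simp add: field_simps)
    then show ?thesis
      using zero_le_power2[of "\<nu> / 2 * (a x + c x) - energy u v x / (2 * \<nu>)"]
      unfolding power2_diff power2_sum by (simp only: mult.assoc)
  qed
  have nn: "0 \<le> \<nu> / 2 * (a x + c x) + energy u v x / (2 * \<nu>)" using e0 nonneg[of x] assms by simp
  have "c x * energy u v x \<le> (a x + c x) * energy u v x" "a x * energy u v x \<le> (a x + c x) * energy u v x"
    using e0 nonneg[of x] by (auto intro: mult_right_mono)
  then show "cmod (of_real (b x) * u x + of_real (c x) * v x) \<le> \<nu> / 2 * (a x + c x) + energy u v x / (2 * \<nu>)"
    "cmod (of_real (a x) * u x + of_real (b x) * v x) \<le> \<nu> / 2 * (a x + c x) + energy u v x / (2 * \<nu>)"
    using energy_bounds(1,2)[where u=u and v=v and x=x] t nn by (auto intro!: power2_le_imp_le elim!: order.trans)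
qed

end

text \<open>The inequality says that \<open>m z\<close> lies in the Weyl disc of every interval
  \<open>[0, x]\<close>.\<close>

locale weyl_family = canonical_family +
  fixes m :: "complex \<Rightarrow> complex"
  assumes weyl: "\<And>z x. 0 < Im z \<Longrightarrow> 0 \<le> x \<Longrightarrow> x \<le> X \<Longrightarrow>
     0 \<le> Im (cnj (u1 z x + m z * u2 z x) * (v1 z x + m z * v2 z x))"
begin

definition uw where "uw z x = u1 z x + m z * u2 z x"
definition vw where "vw z x = v1 z x + m z * v2 z x"

lemma sol_weyl: "solution z (uw z) (vw z)"
  using solution_linear[OF sol1[of z] sol2[of z], of 1 "m z"] by (simp add: uw_def[abs_def] vw_def[abs_def])

lemma weyl_init [simp]: "uw z 0 = 1" "vw z 0 = m z"
  by (simp_all add: uw_def vw_def init)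

lemma weyl_nonneg: "0 < Im z \<Longrightarrow> 0 \<le> x \<Longrightarrow> x \<le> X \<Longrightarrow> 0 \<le> Im (cnj (uw z x) * vw z x)"
  using weyl by (simp add: uw_def vw_def)

lemma weyl_energy:
  assumes "0 < Im z" "0 \<le> x" "x \<le> X"
  shows "Im z * integral {0..x} (energy (uw z) (vw z)) \<le> Im (m z)"
proof -
  have "integral {0..x} (\<lambda>s. - Im z * energy (uw z) (vw z) s) = - Im z * integral {0..x} (energy (uw z) (vw z))"
    by (rule integral_mult_right)
  then show ?thesis
    using primitive_on_eq[OF energy_primitive[OF sol_weyl[of z]] assms(2,3)] weyl_nonneg[OF assms] by simp
qed

text \<open>If the mean of \<open>a\<close> is at most \<open>\<epsilon>\<^sup>2\<close>, the mean
  of \<open>|b|\<close> is of order \<epsilon> and essentially only \<open>c\<close> acts: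
  \<open>v\<close> stays near \<open>m z\<close>, and \<open>u\<close> ends near
  \<open>1 + z C m z\<close> with \<open>C\<close> the integral of \<open>c\<close>. The Weyl
  inequality then reads \<open>Im z C |m|^2 <= Im m\<close> up to errors, and \<open>Im z C\<close>
  is at least \<open>\<sigma> S / 2\<close>. The parameter \<open>S\<close> is free and will be
  large; \<open>M exp S\<close> bounds the solution and \<open>E\<close> collects the
  errors.\<close>

lemma m_bound_step:
  fixes \<sigma> S \<epsilon> x :: real and z :: complex
  defines "M \<equiv> 1 + cmod (m z)" and "E \<equiv> exp S * S * (2 + 2 * S)"
  assumes z: "0 < Im z" "\<sigma> * cmod z \<le> Im z" and x: "0 < x" "x \<le> X" "cmod z * \<eta> x = S" "0 < S"
    and \<epsilon>: "0 < \<epsilon>" "\<epsilon> \<le> 1/2" and A: "integral {0..x} a \<le> \<epsilon>\<^sup>2 * \<eta> x"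
  shows "\<sigma> * S / 2 * (cmod (m z))\<^sup>2 \<le> cmod (m z) + \<epsilon> * (E * (1 + S + exp S)) * M\<^sup>2"
proof -
  let ?u = "uw z" and ?v = "vw z"
  define B where "B = M * exp S"
  have M1: "1 \<le> M" by (simp add: M_def)
  have B0: "0 \<le> B" using M1 by (simp add: B_def)
  have E0: "0 \<le> E" using x by (simp add: E_def)
  have prA: "primitive_on X (\<lambda>x. integral {0..x} a) a" by (rule primitive_on_integral[OF abs_int(1)])
  have prC: "primitive_on X (\<lambda>x. integral {0..x} c) c" by (rule primitive_on_integral[OF abs_int(3)])
  have A_mono: "integral {0..\<tau>} a \<le> \<epsilon>\<^sup>2 * \<eta> x" if "0 \<le> \<tau>" "\<tau> \<le> x" for \<tau>
  proof -
    have "integral {0..x} a - integral {0..\<tau>} a = integral {\<tau>..x} a"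
      using primitive_on_diff_eq[OF prA that x(2)] .
    also have "0 \<le> integral {\<tau>..x} a"
      by (rule integral_nonneg[OF primitive_on_int[OF prA that(1) x(2)]]) (rule nonneg)
    finally show ?thesis using A by linarith
  qed
  have eta_le: "\<eta> \<tau> \<le> \<eta> x" if "0 \<le> \<tau>" "\<tau> \<le> x" for \<tau> using eta_mono[OF that x(2)] .
  have eta_x: "0 < \<eta> x" using eta_pos x by auto
  have r: "(cmod (?u 0))\<^sup>2 + (cmod (?v 0))\<^sup>2 \<le> M\<^sup>2" "0 \<le> M"
    using M1 by (simp_all add: M_def power2_eq_square algebra_simps)
  have uv: "cmod (?u \<tau>) \<le> B" "cmod (?v \<tau>) \<le> B" if "0 \<le> \<tau>" "\<tau> \<le> x" for \<tau>
  proof -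
    have "cmod z * \<eta> \<tau> \<le> S" using eta_le[OF that] x(3) by (metis mult_left_mono norm_ge_zero)
    then have "M * exp (cmod z * \<eta> \<tau>) \<le> B" using r(2) by (simp add: B_def mult_left_mono)
    then show "cmod (?u \<tau>) \<le> B" "cmod (?v \<tau>) \<le> B"
      using solution_bound[OF sol_weyl[of z] that(1) _ r(2) r(1)] that x by (meson order_trans)+
  qed
  \<comment> \<open>\<open>v\<close> moves only through \<open>a\<close> and \<open>b\<close>. In
    the majorant the weighted bound for \<open>|b|\<close> is enlarged by
    \<open>\<epsilon> * a / 2\<close> so that the trace appears.\<close>
  have e2\<tau>: "cmod (?v \<tau> - m z) \<le> 2 * \<epsilon> * B * S" if \<tau>: "0 \<le> \<tau>" "\<tau> \<le> x" for \<tau>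
  proof -
    have \<tau>X: "\<tau> \<le> X" using \<tau> x by simp
    have "norm (?v \<tau> - ?v 0) \<le> (cmod z * B) * ((1 + 1 / (2 * \<epsilon>)) * integral {0..\<tau>} a + \<epsilon> / 2 * \<eta> \<tau>)
          - (cmod z * B) * ((1 + 1 / (2 * \<epsilon>)) * integral {0..0} a + \<epsilon> / 2 * \<eta> 0)"
    proof (rule primitive_on_norm_le[OF _ _ \<tau>(1)])
      show "primitive_on \<tau> ?v (\<lambda>x. - z * (of_real (a x) * ?u x + of_real (b x) * ?v x))"
        using primitive_on_mono[OF _ \<tau>X] sol_weyl[of z] unfolding solution_def by blast
      show "primitive_on \<tau> (\<lambda>x. (cmod z * B) * ((1 + 1 / (2 * \<epsilon>)) * integral {0..x} a + \<epsilon> / 2 * \<eta> x))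
        (\<lambda>x. (cmod z * B) * ((1 + 1 / (2 * \<epsilon>)) * a x + \<epsilon> / 2 * (a x + c x)))"
        by (intro primitive_on_cmult primitive_on_add primitive_on_mono[OF prA \<tau>X] primitive_on_mono[OF eta_primitive \<tau>X])
      fix s assume s: "0 \<le> s" "s \<le> \<tau>"
      have "cmod (of_real (a s) * ?u s + of_real (b s) * ?v s) \<le> a s * B + \<bar>b s\<bar> * B"
        using uv[of s] s \<tau> nonneg[of s]
        by (intro order.trans[OF norm_triangle_ineq] add_mono) (auto simp: norm_mult intro!: mult_left_mono)
      also have "\<dots> = B * (a s + \<bar>b s\<bar>)" by (simp add: algebra_simps)
      also have "\<dots> \<le> B * ((1 + 1 / (2 * \<epsilon>)) * a s + \<epsilon> / 2 * (a s + c s))"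
      proof (rule mult_left_mono[OF _ B0])
        have "a s + \<bar>b s\<bar> \<le> a s + (a s / (2 * \<epsilon>) + \<epsilon> * c s / 2)"
          using abs_b_le_weighted[OF \<epsilon>(1), of s] by simp
        also have "\<dots> \<le> a s + (a s / (2 * \<epsilon>) + \<epsilon> * c s / 2) + \<epsilon> * a s / 2" using nonneg[of s] \<epsilon> by simp
        also have "\<dots> = (1 + 1 / (2 * \<epsilon>)) * a s + \<epsilon> / 2 * (a s + c s)" by (simp add: algebra_simps add_divide_distrib)
        finally show "a s + \<bar>b s\<bar> \<le> (1 + 1 / (2 * \<epsilon>)) * a s + \<epsilon> / 2 * (a s + c s)" .
      qed
      finally have "cmod z * cmod (of_real (a s) * ?u s + of_real (b s) * ?v s) \<le> cmod z * (B * ((1 + 1 / (2 * \<epsilon>)) * a s + \<epsilon> / 2 * (a s + c s)))"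
        by (rule mult_left_mono) simp
      then show "norm (- z * (of_real (a s) * ?u s + of_real (b s) * ?v s)) \<le> (cmod z * B) * ((1 + 1 / (2 * \<epsilon>)) * a s + \<epsilon> / 2 * (a s + c s))"
        by (simp only: norm_mult norm_minus_cancel mult.assoc)
    qed
    then have "cmod (?v \<tau> - m z) \<le> (cmod z * B) * ((1 + 1 / (2 * \<epsilon>)) * integral {0..\<tau>} a + \<epsilon> / 2 * \<eta> \<tau>)" by simp
    also have "\<dots> \<le> (cmod z * B) * ((1 + 1 / (2 * \<epsilon>)) * (\<epsilon>\<^sup>2 * \<eta> x) + \<epsilon> / 2 * \<eta> x)"
      using A_mono[OF \<tau>] eta_le[OF \<tau>] B0 \<epsilon> by (intro mult_left_mono add_mono) auto
    also have "(1 + 1 / (2 * \<epsilon>)) * (\<epsilon>\<^sup>2 * \<eta> x) + \<epsilon> / 2 * \<eta> x = (\<epsilon> + \<epsilon>\<^sup>2) * \<eta> x"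
      using \<epsilon> by (simp add: field_simps power2_eq_square)
    also have "\<dots> \<le> (2 * \<epsilon>) * \<eta> x"
    proof (rule mult_right_mono)
      have "\<epsilon>\<^sup>2 \<le> \<epsilon>" using \<epsilon> by (simp add: power2_eq_square mult_left_le)
      then show "\<epsilon> + \<epsilon>\<^sup>2 \<le> 2 * \<epsilon>" by simp
    qed (use eta_x in simp)
    finally have "cmod (?v \<tau> - m z) \<le> (cmod z * B) * ((2 * \<epsilon>) * \<eta> x)" using B0 by (simp add: mult_left_mono)
    also have "\<dots> = 2 * \<epsilon> * B * (cmod z * \<eta> x)" by simp
    finally show ?thesis using x(3) by simp
  qed
  define C where "C = integral {0..x} c"
  \<comment> \<open>After subtraction of the main term, \<open>c\<close> multiplies
    \<open>v - m z\<close>, which the previous estimate controls, and \<open>b u\<close> is small in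
    the mean.\<close>
  have e1: "cmod (?u x - (1 + z * of_real C * m z)) \<le> \<epsilon> * B * S * (1 + 2 * S)"
  proof -
    have "norm ((?u x - m z * (z * of_real (integral {0..x} c))) - (?u 0 - m z * (z * of_real (integral {0..0} c))))
       \<le> cmod z * (B * (1 / (2 * \<epsilon>) * integral {0..x} a + \<epsilon> / 2 * \<eta> x) + (2 * \<epsilon> * B * S) * \<eta> x)
         - cmod z * (B * (1 / (2 * \<epsilon>) * integral {0..0} a + \<epsilon> / 2 * \<eta> 0) + (2 * \<epsilon> * B * S) * \<eta> 0)"
    proof (rule primitive_on_norm_le[where X=x])
      show "primitive_on x (\<lambda>x. ?u x - m z * (z * of_real (integral {0..x} c)))
         (\<lambda>x. z * (of_real (b x) * ?u x + of_real (c x) * ?v x) - m z * (z * of_real (c x)))"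
        using sol_weyl[of z] unfolding solution_def
        by (intro primitive_on_diff primitive_on_cmult primitive_on_of_real primitive_on_mono[OF prC x(2)])
          (auto intro: primitive_on_mono[OF _ x(2)])
      show "primitive_on x (\<lambda>x. cmod z * (B * (1 / (2 * \<epsilon>) * integral {0..x} a + \<epsilon> / 2 * \<eta> x) + (2 * \<epsilon> * B * S) * \<eta> x))
        (\<lambda>x. cmod z * (B * (1 / (2 * \<epsilon>) * a x + \<epsilon> / 2 * (a x + c x)) + (2 * \<epsilon> * B * S) * (a x + c x)))"
        by (intro primitive_on_cmult primitive_on_add primitive_on_mono[OF prA x(2)] primitive_on_mono[OF eta_primitive x(2)])
      show "0 \<le> x" using x by simp
      fix s assume s: "0 \<le> s" "s \<le> x"
      have "cmod (of_real (b s) * ?u s + of_real (c s) * (?v s - m z)) \<le> \<bar>b s\<bar> * B + c s * (2 * \<epsilon> * B * S)"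
        using uv[OF s] e2\<tau>[OF s] nonneg[of s]
        by (intro order.trans[OF norm_triangle_ineq] add_mono) (auto simp: norm_mult intro!: mult_left_mono)
      also have "\<dots> \<le> (1 / (2 * \<epsilon>) * a s + \<epsilon> / 2 * (a s + c s)) * B + (a s + c s) * (2 * \<epsilon> * B * S)"
      proof (intro add_mono mult_right_mono)
        have "\<bar>b s\<bar> \<le> a s / (2 * \<epsilon>) + \<epsilon> * c s / 2" by (rule abs_b_le_weighted[OF \<epsilon>(1)])
        also have "\<dots> \<le> (a s / (2 * \<epsilon>) + \<epsilon> * c s / 2) + \<epsilon> * a s / 2" using nonneg[of s] \<epsilon> by simp
        also have "\<dots> = 1 / (2 * \<epsilon>) * a s + \<epsilon> / 2 * (a s + c s)" by (simp add: algebra_simps add_divide_distrib)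
        finally show "\<bar>b s\<bar> \<le> 1 / (2 * \<epsilon>) * a s + \<epsilon> / 2 * (a s + c s)" .
      qed (use B0 \<epsilon> x nonneg[of s] in auto)
      also have "\<dots> = B * (1 / (2 * \<epsilon>) * a s + \<epsilon> / 2 * (a s + c s)) + (2 * \<epsilon> * B * S) * (a s + c s)"
        by (metis mult.commute)
      finally have "cmod z * cmod (of_real (b s) * ?u s + of_real (c s) * (?v s - m z))
          \<le> cmod z * (B * (1 / (2 * \<epsilon>) * a s + \<epsilon> / 2 * (a s + c s)) + (2 * \<epsilon> * B * S) * (a s + c s))"
        by (rule mult_left_mono) simp
      moreover have "z * (of_real (b s) * ?u s + of_real (c s) * ?v s) - m z * (z * of_real (c s))
         = z * (of_real (b s) * ?u s + of_real (c s) * (?v s - m z))" by (simp add: algebra_simps)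
      ultimately show "norm (z * (of_real (b s) * ?u s + of_real (c s) * ?v s) - m z * (z * of_real (c s)))
         \<le> cmod z * (B * (1 / (2 * \<epsilon>) * a s + \<epsilon> / 2 * (a s + c s)) + (2 * \<epsilon> * B * S) * (a s + c s))"
        by (simp only: norm_mult)
    qed
    then have "cmod (?u x - (1 + z * of_real C * m z)) \<le> cmod z * (B * (1 / (2 * \<epsilon>) * integral {0..x} a + \<epsilon> / 2 * \<eta> x) + (2 * \<epsilon> * B * S) * \<eta> x)"
      by (simp add: C_def algebra_simps)
    also have "\<dots> \<le> cmod z * (B * (1 / (2 * \<epsilon>) * (\<epsilon>\<^sup>2 * \<eta> x) + \<epsilon> / 2 * \<eta> x) + (2 * \<epsilon> * B * S) * \<eta> x)"
      using A B0 \<epsilon> by (intro mult_left_mono add_mono order.refl) auto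
    also have "\<dots> = \<epsilon> * B * (cmod z * \<eta> x) * (1 + 2 * S)"
      using \<epsilon> by (simp add: field_simps power2_eq_square)
    finally show ?thesis using x(3) by simp
  qed
  have eE: "cmod (?u x - (1 + z * of_real C * m z)) \<le> \<epsilon> * M * E" "cmod (?v x - m z) \<le> \<epsilon> * M * E"
  proof -
    have "\<epsilon> * B * S * (1 + 2 * S) \<le> \<epsilon> * B * S * (2 + 2 * S)" "2 * \<epsilon> * B * S \<le> \<epsilon> * B * S * (2 + 2 * S)"
      using \<epsilon> B0 x by (auto simp: algebra_simps)
    moreover have "\<epsilon> * B * S * (2 + 2 * S) = \<epsilon> * M * E" by (simp add: B_def E_def)
    ultimately show "cmod (?u x - (1 + z * of_real C * m z)) \<le> \<epsilon> * M * E" "cmod (?v x - m z) \<le> \<epsilon> * M * E"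
      using e1 e2\<tau>[of x] x by auto
  qed
  \<comment> \<open>At least half of the trace sits in \<open>c\<close>.\<close>
  have C_bounds: "\<eta> x / 2 \<le> C" "C \<le> \<eta> x"
  proof -
    have "\<eta> x = integral {0..x} a + C" unfolding \<eta>_def C_def
      by (rule Henstock_Kurzweil_Integration.integral_add[OF primitive_on_int[OF prA order.refl x(2)] primitive_on_int[OF prC order.refl x(2)]])
    moreover have "\<epsilon>\<^sup>2 * \<eta> x \<le> 1/2 * \<eta> x"
    proof (rule mult_right_mono)
      have "\<epsilon>\<^sup>2 \<le> (1/2)\<^sup>2" using \<epsilon> by (intro power_mono) auto
      then show "\<epsilon>\<^sup>2 \<le> 1/2" by (simp add: power2_eq_square)
    qed (use eta_x in simp)
    moreover have "0 \<le> integral {0..x} a"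
      by (rule integral_nonneg[OF primitive_on_int[OF prA order.refl x(2)]]) (rule nonneg)
    ultimately show "\<eta> x / 2 \<le> C" "C \<le> \<eta> x" using A by auto
  qed
  define p where "p = 1 + z * of_real C * m z"
  have C0: "0 \<le> C" using C_bounds eta_x by simp
  have pb: "cmod p \<le> (1 + S) * M"
  proof -
    have "cmod p \<le> 1 + cmod z * C * cmod (m z)"
      unfolding p_def using norm_triangle_ineq[of 1 "z * of_real C * m z"] C0 by (simp add: norm_mult)
    also have "cmod z * C \<le> S" using mult_left_mono[OF C_bounds(2), of "cmod z"] x(3) by simp
    finally have "cmod p \<le> 1 + S * cmod (m z)" by (simp add: mult_right_mono)
    also have "\<dots> \<le> (1 + S) * M" using x by (simp add: M_def algebra_simps)
    finally show ?thesis .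
  qed
  have "cnj (?u x) * ?v x = cnj p * m z + (cnj p * (?v x - m z) + cnj (?u x - p) * ?v x)"
    by (simp add: algebra_simps)
  then have "0 \<le> Im (cnj p * m z) + Im (cnj p * (?v x - m z) + cnj (?u x - p) * ?v x)"
    using weyl_nonneg[OF z(1), of x] x by (metis less_imp_le plus_complex.sel(2))
  \<comment> \<open>\<open>C\<close> is real, so the second term of \<open>p\<close> contributes
    \<open>C |m|^2 Im (cnj z)\<close>: the negative quadratic term that limits
    \<open>|m|\<close>.\<close>
  also have "Im (cnj p * m z) = Im (m z) - Im z * C * (cmod (m z))\<^sup>2"
    unfolding p_def cmod_power2 by (simp add: power2_eq_square algebra_simps)
  also have "Im (cnj p * (?v x - m z) + cnj (?u x - p) * ?v x) \<le> (1 + S) * M * (\<epsilon> * M * E) + \<epsilon> * M * E * B"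
  proof -
    have "Im (cnj p * (?v x - m z) + cnj (?u x - p) * ?v x) \<le> cmod (cnj p * (?v x - m z) + cnj (?u x - p) * ?v x)"
      using abs_Im_le_cmod abs_le_D1 by blast
    also have "\<dots> \<le> cmod (cnj p * (?v x - m z)) + cmod (cnj (?u x - p) * ?v x)"
      by (rule norm_triangle_ineq)
    also have "\<dots> = cmod p * cmod (?v x - m z) + cmod (?u x - p) * cmod (?v x)"
      by (simp only: norm_mult complex_mod_cnj)
    also have "\<dots> \<le> (1 + S) * M * (\<epsilon> * M * E) + \<epsilon> * M * E * B"
      using pb eE uv(2)[of x] x M1 \<epsilon> E0 by (intro add_mono mult_mono) (auto simp: p_def)
    finally show ?thesis .
  qed
  also have "(1 + S) * M * (\<epsilon> * M * E) + \<epsilon> * M * E * B = \<epsilon> * (E * (1 + S + exp S)) * M\<^sup>2"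
    by (simp add: B_def power2_eq_square algebra_simps)
  finally have main: "0 \<le> Im (m z) - Im z * C * (cmod (m z))\<^sup>2 + \<epsilon> * (E * (1 + S + exp S)) * M\<^sup>2" by simp
  have "\<sigma> * S / 2 \<le> Im z * C"
  proof -
    have "\<sigma> * S / 2 = (\<sigma> * cmod z) * (\<eta> x / 2)" using x(3) by auto
    also have "\<dots> \<le> Im z * (\<eta> x / 2)" using z eta_x by (intro mult_right_mono) auto
    also have "\<dots> \<le> Im z * C" using C_bounds z by (intro mult_left_mono) auto
    finally show ?thesis .
  qed
  then have "\<sigma> * S / 2 * (cmod (m z))\<^sup>2 \<le> Im z * C * (cmod (m z))\<^sup>2" by (rule mult_right_mono) simp
  moreover have "Im (m z) \<le> cmod (m z)" using abs_Im_le_cmod[of "m z"] by simp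
  ultimately show ?thesis using main by linarith
qed

end

context canonical_system
begin

lemma energy_absint:
  assumes "solution z u v"
  shows "energy u v absolutely_integrable_on {0..X}"
proof -
  have "(\<lambda>x. Re (form x (cnj (u x)) (cnj (v x)) (u x) (v x))) absolutely_integrable_on {0..X}"
    using absolutely_integrable_linear[OF form_absint[OF solution_cnj[OF assms] assms] bounded_linear_Re]
    by (simp add: comp_def)
  then show ?thesis by (simp add: energy_form)
qed

end

context weyl_family
begin

text \<open>Order of choices: \<open>S\<close> makes the quadratic coefficient
  \<open>k = \<sigma> S / 2\<close> large, then \<epsilon> is taken so small for this
  \<open>S\<close> that the error costs at most \<open>1 / k + k \<mu>^2 / 2\<close>, with
  \<open>\<mu> = |m z|\<close>. What remains is \<open>(k \<mu>)^2 <= 2 k \<mu> + 2\<close>, hence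
  \<open>k \<mu> < 3\<close>.\<close>

lemma cone_tendsto_zero:
  assumes A: "\<And>\<epsilon>. 0 < \<epsilon> \<Longrightarrow> \<exists>x1>0. \<forall>x. 0 < x \<and> x \<le> x1 \<longrightarrow> integral {0..x} a \<le> \<epsilon> * \<eta> x"
  shows "cone_tendsto m 0"
  unfolding cone_tendsto_def
proof (intro allI impI)
  fix \<sigma> \<epsilon>0 :: real assume \<sigma>: "0 < \<sigma>" and \<epsilon>0: "0 < \<epsilon>0"
  define S where "S = 8 / (\<sigma> * \<epsilon>0)"
  define k where "k = 4 / \<epsilon>0"
  have S0: "0 < S" and k0: "0 < k" using \<sigma> \<epsilon>0 by (auto simp: S_def k_def)
  have kS: "\<sigma> * S / 2 = k" using \<sigma> by (simp add: S_def k_def)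
  define C2 where "C2 = exp S * S * (2 + 2 * S) * (1 + S + exp S)"
  have C2: "0 < C2" using S0 unfolding C2_def by (intro mult_pos_pos add_pos_pos) auto
  define \<epsilon> where "\<epsilon> = min (1/2) (min (k / (4 * C2)) (1 / (2 * k * C2)))"
  have e0: "0 < \<epsilon>" "\<epsilon> \<le> 1/2" using k0 C2 by (auto simp: \<epsilon>_def)
  have "\<epsilon> \<le> k / (4 * C2)" "\<epsilon> \<le> 1 / (2 * k * C2)" by (auto simp: \<epsilon>_def)
  then have e1: "2 * (\<epsilon> * C2) \<le> k / 2" and e2: "2 * (\<epsilon> * C2) \<le> 1 / k"
    using C2 k0 by (auto simp: field_simps)
  obtain x1 where x1: "0 < x1" "\<And>x. 0 < x \<Longrightarrow> x \<le> x1 \<Longrightarrow> integral {0..x} a \<le> \<epsilon>\<^sup>2 * \<eta> x"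
    using A[of "\<epsilon>\<^sup>2"] e0 by auto
  define x2 where "x2 = min x1 X"
  have x2: "0 < x2" "x2 \<le> X" "x2 \<le> x1" using x1 X_pos by (auto simp: x2_def)
  have eta2: "0 < \<eta> x2" using eta_pos x2 by auto
  show "\<exists>R. \<forall>z. R \<le> cmod z \<and> 0 < cmod z \<and> \<sigma> * cmod z \<le> Im z \<longrightarrow> cmod (m z - 0) < \<epsilon>0"
  proof (intro exI allI impI)
    fix z assume z: "2 * S / \<eta> x2 \<le> cmod z \<and> 0 < cmod z \<and> \<sigma> * cmod z \<le> Im z"
    then have Imz: "0 < Im z" using \<sigma> by (meson less_le_trans mult_pos_pos)
    \<comment> \<open>The factor 2 in the threshold for \<open>|z|\<close> gives strictness, so that
      the point with \<open>\<eta> x = S / |z|\<close> lies below \<open>x2\<close>.\<close>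
    have "S / cmod z < \<eta> x2"
    proof -
      have "2 * S \<le> cmod z * \<eta> x2" using z eta2 by (simp add: divide_le_eq)
      then have "S < \<eta> x2 * cmod z" using S0 by (simp add: mult.commute)
      then show ?thesis using z by (simp add: divide_less_eq)
    qed
    moreover have "\<eta> x2 \<le> \<eta> X" using eta_mono[of x2 X] x2 by auto
    ultimately obtain x where x: "0 < x" "x \<le> X" "\<eta> x = S / cmod z"
      using eta_attains[of "S / cmod z"] S0 z by auto
    then have "x < x2" using eta_less_imp_less[of x2 x] x2 \<open>S / cmod z < \<eta> x2\<close> by auto
    then have "integral {0..x} a \<le> \<epsilon>\<^sup>2 * \<eta> x" using x1(2)[OF x(1)] x2 by linarith
    moreover have "cmod z * \<eta> x = S" using x z by auto
    ultimately have main: "k * (cmod (m z))\<^sup>2 \<le> cmod (m z) + \<epsilon> * C2 * (1 + cmod (m z))\<^sup>2"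
      using m_bound_step[of z \<sigma> x S \<epsilon>] Imz z x S0 e0 by (simp add: kS C2_def)
    define \<mu> where "\<mu> = cmod (m z)"
    have \<mu>0: "0 \<le> \<mu>" by (simp add: \<mu>_def)
    have "(1 + \<mu>)\<^sup>2 \<le> 2 * (1 + \<mu>\<^sup>2)"
      using zero_le_power2[of "1 - \<mu>"] by (simp add: power2_eq_square algebra_simps)
    then have "\<epsilon> * C2 * (1 + \<mu>)\<^sup>2 \<le> \<epsilon> * C2 * (2 * (1 + \<mu>\<^sup>2))"
      using e0 C2 by (intro mult_left_mono) auto
    also have "\<dots> = 2 * (\<epsilon> * C2) + 2 * (\<epsilon> * C2) * \<mu>\<^sup>2" by (simp add: algebra_simps)
    also have "\<dots> \<le> 1 / k + k / 2 * \<mu>\<^sup>2" using e1 e2 by (intro add_mono mult_right_mono) auto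
    finally have "k * \<mu>\<^sup>2 \<le> \<mu> + (1 / k + k / 2 * \<mu>\<^sup>2)" using main by (simp add: \<mu>_def)
    then have "(2 * k) * (k * \<mu>\<^sup>2) \<le> (2 * k) * (\<mu> + (1 / k + k / 2 * \<mu>\<^sup>2))"
      using k0 by (intro mult_left_mono) auto
    then have sq: "(k * \<mu>)\<^sup>2 \<le> 2 * (k * \<mu>) + 2"
    proof -
      have "(2 * k) * (k * \<mu>\<^sup>2) = 2 * (k * \<mu>)\<^sup>2" by (simp add: power2_eq_square)
      moreover have "(2 * k) * (\<mu> + (1 / k + k / 2 * \<mu>\<^sup>2)) = 2 * (k * \<mu>) + 2 + (k * \<mu>)\<^sup>2"
        using k0 by (simp add: power2_eq_square algebra_simps)
      ultimately show ?thesis using \<open>(2 * k) * (k * \<mu>\<^sup>2) \<le> _\<close> by linarith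
    qed
    have "k * \<mu> < 3"
    proof (rule ccontr)
      assume "\<not> k * \<mu> < 3"
      then have "3 * (k * \<mu>) \<le> (k * \<mu>)\<^sup>2" unfolding power2_eq_square by (intro mult_right_mono) auto
      then show False using sq \<open>\<not> k * \<mu> < 3\<close> by linarith
    qed
    then have "4 * \<mu> < 3 * \<epsilon>0" using \<epsilon>0 by (simp add: k_def field_simps)
    then show "cmod (m z - 0) < \<epsilon>0" using \<epsilon>0 \<mu>0 by (simp add: \<mu>_def)
  qed
qed

text \<open>At \<open>z = \<i> / \<eta>(x)\<close> the interval has unit length in the natural
  scale. A small \<open>Im m\<close> forces a small energy, so \<open>u\<close> stays near 1 and
  \<open>v\<close> near 0; the row \<open>a u + b v\<close> is controlled by trace and energy, hence
  \<open>a\<close> must be small in the mean.\<close>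

lemma integral_a_step:
  assumes x: "0 < x" "x \<le> X" and \<nu>: "0 < \<nu>" "\<nu> \<le> 1/2"
    and m: "cmod (m (\<i> / of_real (\<eta> x))) \<le> \<nu>\<^sup>2"
  shows "integral {0..x} a \<le> 4 * \<nu> * \<eta> x"
proof -
  define y where "y = 1 / \<eta> x"
  have eta_x: "0 < \<eta> x" using eta_pos x by auto
  have y0: "0 < y" and y\<eta>: "y * \<eta> x = 1" using eta_x by (auto simp: y_def)
  define z where "z = \<i> * of_real y"
  have zy: "\<i> / of_real (\<eta> x) = z" by (simp add: z_def y_def)
  have z: "Im z = y" "cmod z = y" using y0 by (auto simp: z_def norm_mult)
  let ?u = "uw z" and ?v = "vw z"
  let ?E = "energy ?u ?v"
  have prE: "primitive_on X (\<lambda>x. integral {0..x} ?E) ?E"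
    by (rule primitive_on_integral[OF energy_absint[OF sol_weyl]])
  have mz: "cmod (m z) \<le> \<nu>\<^sup>2" using m zy by simp
  have E_int: "y * integral {0..\<tau>} ?E \<le> \<nu>\<^sup>2" if "0 \<le> \<tau>" "\<tau> \<le> X" for \<tau>
    using weyl_energy[of z \<tau>] that z y0 mz abs_Im_le_cmod[of "m z"] by auto
  \<comment> \<open>Both components move by at most \<nu>; the trace and the energy contribute
    \<open>\<nu> / 2\<close> each.\<close>
  have near: "cmod (f \<tau> - f 0) \<le> \<nu>"
    if f: "primitive_on X f (\<lambda>x. w * g x)" "cmod w = y" "\<And>s. cmod (g s) \<le> \<nu> / 2 * (a s + c s) + ?E s / (2 * \<nu>)"
      and \<tau>: "0 \<le> \<tau>" "\<tau> \<le> x" for f g w \<tau>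
  proof -
    have \<tau>X: "\<tau> \<le> X" using \<tau> x by simp
    have "cmod (f \<tau> - f 0) \<le> y * (\<nu> / 2 * \<eta> \<tau> + 1 / (2 * \<nu>) * integral {0..\<tau>} ?E)
          - y * (\<nu> / 2 * \<eta> 0 + 1 / (2 * \<nu>) * integral {0..0} ?E)"
    proof (rule primitive_on_norm_le[OF primitive_on_mono[OF f(1) \<tau>X] _ \<tau>(1)])
      show "primitive_on \<tau> (\<lambda>\<tau>. y * (\<nu> / 2 * \<eta> \<tau> + 1 / (2 * \<nu>) * integral {0..\<tau>} ?E))
        (\<lambda>s. y * (\<nu> / 2 * (a s + c s) + 1 / (2 * \<nu>) * ?E s))"
        by (intro primitive_on_cmult primitive_on_add primitive_on_mono[OF prE \<tau>X] primitive_on_mono[OF eta_primitive \<tau>X])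
      fix s
      show "norm (w * g s) \<le> y * (\<nu> / 2 * (a s + c s) + 1 / (2 * \<nu>) * ?E s)"
        using mult_left_mono[OF f(3)[of s], of y] y0 by (simp add: norm_mult f(2))
    qed
    then have "cmod (f \<tau> - f 0) \<le> \<nu> / 2 * (y * \<eta> \<tau>) + 1 / (2 * \<nu>) * (y * integral {0..\<tau>} ?E)"
      by (simp add: algebra_simps)
    also have "\<dots> \<le> \<nu> / 2 * (y * \<eta> x) + 1 / (2 * \<nu>) * \<nu>\<^sup>2"
      using eta_mono[OF \<tau> x(2)] E_int[OF \<tau>(1) \<tau>X] y0 \<nu> by (intro add_mono mult_left_mono) auto
    also have "\<dots> = \<nu>" using \<nu> by (simp add: y\<eta> power2_eq_square)
    finally show ?thesis .
  qed
  have u_near: "cmod (?u \<tau> - 1) \<le> \<nu>" if "0 \<le> \<tau>" "\<tau> \<le> x" for \<tau>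
    using near[OF sol_weyl[of z, unfolded solution_def, THEN conjunct1] z(2) energy_bound_weighted(1)[OF \<nu>(1)] that] by simp
  have v_near: "cmod (?v \<tau> - m z) \<le> \<nu>" if "0 \<le> \<tau>" "\<tau> \<le> x" for \<tau>
    using near[OF sol_weyl[of z, unfolded solution_def, THEN conjunct2] _ energy_bound_weighted(2)[OF \<nu>(1)] that] z(2) by simp
  have \<nu>2: "\<nu>\<^sup>2 \<le> \<nu> / 2" using \<nu> unfolding power2_eq_square by (simp add: mult_left_mono[of \<nu> "1/2" \<nu>, simplified])
  have a_le: "a s \<le> 3 * \<nu> * (a s + c s) + 1 / \<nu> * ?E s" if s: "0 \<le> s" "s \<le> x" for s
  proof -
    have u1: "1 / 2 \<le> cmod (?u s)"
    proof -
      have "cmod 1 \<le> cmod (?u s) + cmod (?u s - 1)"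
        by (metis norm_minus_commute norm_triangle_sub)
      then show ?thesis using u_near[OF s] \<nu> by simp
    qed
    have v1: "cmod (?v s) \<le> 3 / 2 * \<nu>"
    proof -
      have "cmod (?v s) \<le> cmod (m z) + cmod (?v s - m z)"
        by (rule norm_triangle_sub)
      then show ?thesis using v_near[OF s] mz \<nu>2 by simp
    qed
    \<comment> \<open>\<open>a u\<close> is the row \<open>a u + b v\<close> minus
      \<open>b v\<close>, and \<open>|u|\<close> is at least 1/2.\<close>
    have "a s * (1 / 2) \<le> a s * cmod (?u s)" using u1 nonneg by (intro mult_left_mono) auto
    also have "\<dots> = cmod ((of_real (a s) * ?u s + of_real (b s) * ?v s) - of_real (b s) * ?v s)"
      using nonneg[of s] by (simp add: norm_mult)
    also have "\<dots> \<le> cmod (of_real (a s) * ?u s + of_real (b s) * ?v s) + cmod (of_real (b s) * ?v s)"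
      by (rule norm_triangle_ineq4)
    also have "cmod (of_real (b s) * ?v s) \<le> (a s + c s) / 2 * (3 / 2 * \<nu>)"
      unfolding norm_mult using abs_b_le[of s] v1 nonneg[of s] by (intro mult_mono) auto
    also have "cmod (of_real (a s) * ?u s + of_real (b s) * ?v s) \<le> \<nu> / 2 * (a s + c s) + ?E s / (2 * \<nu>)"
      by (rule energy_bound_weighted(2)[OF \<nu>(1)])
    finally have "a s * (1 / 2) \<le> \<nu> / 2 * (a s + c s) + ?E s / (2 * \<nu>) + (a s + c s) / 2 * (3 / 2 * \<nu>)" by simp
    also have "\<dots> = (5 / 4 * (\<nu> * (a s + c s))) + 1 / 2 * (1 / \<nu> * ?E s)" by (simp add: field_simps)
    finally have "a s \<le> 5 / 2 * (\<nu> * (a s + c s)) + 1 / \<nu> * ?E s" by simp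
    moreover have "0 \<le> \<nu> * (a s + c s)" using \<nu> nonneg[of s] by simp
    ultimately show ?thesis by simp
  qed
  have "integral {0..x} a - integral {0..0} a \<le> 3 * \<nu> * \<eta> x + 1 / \<nu> * integral {0..x} ?E - (3 * \<nu> * \<eta> 0 + 1 / \<nu> * integral {0..0} ?E)"
    by (rule primitive_on_le[OF primitive_on_mono[OF primitive_on_integral[OF abs_int(1)] x(2)]
          primitive_on_add[OF primitive_on_cmult[OF primitive_on_mono[OF eta_primitive x(2)]]
            primitive_on_cmult[OF primitive_on_mono[OF prE x(2)]]] less_imp_le[OF x(1)] a_le])
  then have "integral {0..x} a \<le> 3 * \<nu> * \<eta> x + 1 / \<nu> * integral {0..x} ?E" by simp
  moreover have "1 / \<nu> * integral {0..x} ?E \<le> 1 / \<nu> * (\<nu>\<^sup>2 * \<eta> x)"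
    using E_int[of x] x eta_x \<nu> by (intro mult_left_mono) (auto simp: y_def divide_le_eq)
  moreover have "1 / \<nu> * (\<nu>\<^sup>2 * \<eta> x) = \<nu> * \<eta> x" using \<nu> by (simp add: power2_eq_square)
  ultimately show ?thesis by simp
qed

lemma small_eta:
  assumes "0 < s" obtains x1 where "0 < x1" "x1 \<le> X" "\<And>x. 0 < x \<Longrightarrow> x \<le> x1 \<Longrightarrow> \<eta> x \<le> s"
proof -
  have "0 < \<eta> X" using eta_pos X_pos by simp
  then obtain x1 where x1: "0 < x1" "x1 \<le> X" "\<eta> x1 = min s (\<eta> X)"
    using eta_attains[of "min s (\<eta> X)"] assms by auto
  show ?thesis
  proof (rule that[OF x1(1,2)])
    fix x assume "0 < x" "x \<le> x1"
    then have "\<eta> x \<le> \<eta> x1" using eta_mono[of x x1] x1 by simp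
    then show "\<eta> x \<le> s" using x1 by simp
  qed
qed

text \<open>Only points of the imaginary axis enter, hence the cone with \<sigma> = 1.\<close>

lemma integral_a_small:
  assumes m: "cone_tendsto m 0" and \<epsilon>: "0 < \<epsilon>"
  shows "\<exists>x1>0. \<forall>x. 0 < x \<and> x \<le> x1 \<longrightarrow> integral {0..x} a \<le> \<epsilon> * \<eta> x"
proof -
  define \<nu> where "\<nu> = min (1/2) (\<epsilon> / 4)"
  have \<nu>: "0 < \<nu>" "\<nu> \<le> 1/2" "4 * \<nu> \<le> \<epsilon>" using \<epsilon> by (auto simp: \<nu>_def)
  obtain R where R: "\<And>z. R \<le> cmod z \<and> 0 < cmod z \<and> 1 * cmod z \<le> Im z \<Longrightarrow> cmod (m z - 0) < \<nu>\<^sup>2"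
    using m \<nu>(1) unfolding cone_tendsto_def by (metis zero_less_one zero_less_power)
  obtain x1 where x1: "0 < x1" "x1 \<le> X" "\<And>x. 0 < x \<Longrightarrow> x \<le> x1 \<Longrightarrow> \<eta> x \<le> 1 / (\<bar>R\<bar> + 1)"
    by (rule small_eta[of "1 / (\<bar>R\<bar> + 1)"]) auto
  show ?thesis
  proof (intro exI[of _ x1] conjI allI impI x1(1))
    fix x assume x: "0 < x \<and> x \<le> x1"
    have e0: "0 < \<eta> x" using eta_pos x x1 by auto
    have "\<bar>R\<bar> + 1 \<le> 1 / \<eta> x" using x1(3)[of x] x e0 by (simp add: field_simps)
    then have "cmod (m (\<i> / of_real (\<eta> x)) - 0) < \<nu>\<^sup>2"
      using e0 by (intro R) (auto simp: norm_divide)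
    then have "integral {0..x} a \<le> 4 * \<nu> * \<eta> x"
      using x x1 \<nu> by (intro integral_a_step) auto
    also have "\<dots> \<le> \<epsilon> * \<eta> x" using \<nu> e0 by (intro mult_right_mono) auto
    finally show "integral {0..x} a \<le> \<epsilon> * \<eta> x" .
  qed
qed

end

section \<open>The limit in the upper half-plane\<close>

context canonical_system
begin

text \<open>Encodes the trace-free part of \<open>H\<close>:
  \<open>|\<kappa>|^2 = t^2 - 4 det H\<close> with \<open>t\<close> the trace, and \<kappa> vanishes
  exactly where \<open>H\<close> is a multiple of the identity.\<close>

definition \<kappa> :: "real \<Rightarrow> complex" where
  "\<kappa> x = of_real (a x) - of_real (c x) + 2 * \<i> * of_real (b x)"

definition K :: "real \<Rightarrow> complex" where "K x = integral {0..x} \<kappa>"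

lemma kappa_absint: "\<kappa> absolutely_integrable_on {0..X}"
proof -
  have "(\<lambda>x. complex_of_real (f x)) absolutely_integrable_on {0..X}"
    if "f absolutely_integrable_on {0..X}" for f
    using absolutely_integrable_linear[OF that bounded_linear_of_real[where 'a=complex]] by (simp add: comp_def)
  note h = this[OF abs_int(1)] this[OF abs_int(2)] this[OF abs_int(3)]
  have "(\<lambda>x. 2 * \<i> * complex_of_real (b x)) absolutely_integrable_on {0..X}"
    using absolutely_integrable_linear[OF h(2) bounded_linear_mult_right[of "2 * \<i>"]] by (simp add: comp_def)
  then show ?thesis unfolding \<kappa>_def[abs_def] using h by simp
qed

lemma K_primitive: "primitive_on X K \<kappa>"
  using primitive_on_integral[OF kappa_absint] unfolding K_def[abs_def] .

lemma K_0 [simp]: "K 0 = 0" by (simp add: K_def)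

lemma kappa_bound: "cmod (\<kappa> x) \<le> a x + c x"
proof (rule power2_le_imp_le)
  have "(cmod (\<kappa> x))\<^sup>2 = (a x - c x)\<^sup>2 + 4 * (b x)\<^sup>2"
    unfolding cmod_power2 \<kappa>_def by (simp add: power2_eq_square)
  also have "\<dots> \<le> (a x - c x)\<^sup>2 + 4 * (a x * c x)" using det_nonneg[of x] by simp
  also have "\<dots> = (a x + c x)\<^sup>2" by (simp add: power2_eq_square algebra_simps)
  finally show "(cmod (\<kappa> x))\<^sup>2 \<le> (a x + c x)\<^sup>2" .
qed (use nonneg[of x] in simp)

text \<open>\<open>v + \<i> u\<close> and \<open>v - \<i> u\<close> are eigen-coordinates of
  \<open>J\<close>. For \<kappa> = 0 the equations decouple, and the solutions are multiples of
  \<open>exp (\<i> z \<eta> / 2)\<close> and \<open>exp (- \<i> z \<eta> / 2)\<close>, decaying and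
  growing for \<open>Im z > 0\<close>.\<close>

lemma pq_primitive:
  assumes "solution z u v"
  defines "p \<equiv> \<lambda>x. v x + \<i> * u x" and "q \<equiv> \<lambda>x. v x - \<i> * u x"
  shows "primitive_on X p (\<lambda>x. (\<i> * z / 2) * (of_real (a x + c x) * p x - cnj (\<kappa> x) * q x))"
    and "primitive_on X q (\<lambda>x. (\<i> * z / 2) * (\<kappa> x * p x - of_real (a x + c x) * q x))"
proof -
  note s = assms(1)[unfolded solution_def]
  have eq: "(\<i> * z / 2) * (of_real (a x + c x) * p x - cnj (\<kappa> x) * q x)
      = - z * (of_real (a x) * u x + of_real (b x) * v x) + \<i> * (z * (of_real (b x) * u x + of_real (c x) * v x))"
    "(\<i> * z / 2) * (\<kappa> x * p x - of_real (a x + c x) * q x)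
      = - z * (of_real (a x) * u x + of_real (b x) * v x) - \<i> * (z * (of_real (b x) * u x + of_real (c x) * v x))" for x
    by (simp_all add: p_def q_def \<kappa>_def field_simps)
  show "primitive_on X p (\<lambda>x. (\<i> * z / 2) * (of_real (a x + c x) * p x - cnj (\<kappa> x) * q x))"
    unfolding eq unfolding p_def using s by (intro primitive_on_add primitive_on_cmult) auto
  show "primitive_on X q (\<lambda>x. (\<i> * z / 2) * (\<kappa> x * p x - of_real (a x + c x) * q x))"
    unfolding eq unfolding q_def using s by (intro primitive_on_diff primitive_on_cmult) auto
qed

lemma pq_norm_sq:
  "(cmod (w + \<i> * y))\<^sup>2 + (cmod (w - \<i> * y))\<^sup>2 = 2 * ((cmod y)\<^sup>2 + (cmod w)\<^sup>2)"
  unfolding cmod_power2 by (simp add: power2_eq_square algebra_simps)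

text \<open>Turns the Weyl inequality into \<open>|q| <= |p|\<close>.\<close>

lemma pq_norm_diff:
  "(cmod (w + \<i> * y))\<^sup>2 - (cmod (w - \<i> * y))\<^sup>2 = 4 * Im (cnj y * w)"
  unfolding cmod_power2 by (simp add: power2_eq_square algebra_simps)

text \<open>\<open>k\<close> is small only in the mean, so \<open>k G\<close> is integrated by parts
  onto the primitive \<open>K'\<close> of \<open>k\<close> (the prime is not a derivative here):
  \<open>F - K' G\<close> has the integrand \<open>- K' g\<close>. The price is that the integrand
  of \<open>G\<close> must be dominated by the trace.\<close>

lemma integral_by_parts_bound:
  fixes k K' F G g :: "real \<Rightarrow> complex"
  assumes x: "0 \<le> x" "x \<le> X"
    and K': "primitive_on x K' k" "K' 0 = 0" and G: "primitive_on x G g" and F: "primitive_on x F (\<lambda>s. k s * G s)"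
    and bK: "\<And>s. 0 \<le> s \<Longrightarrow> s \<le> x \<Longrightarrow> cmod (K' s) \<le> e"
    and bG: "cmod (G x) \<le> B" and bg: "\<And>s. 0 \<le> s \<Longrightarrow> s \<le> x \<Longrightarrow> cmod (g s) \<le> D * (a s + c s)"
  shows "cmod (F x - F 0) \<le> e * (B + D * \<eta> x)"
proof -
  have e0: "0 \<le> e" using bK[of 0] x K'(2) by simp
  have "norm ((F x - K' x * G x) - (F 0 - K' 0 * G 0)) \<le> e * (D * \<eta> x) - e * (D * \<eta> 0)"
  proof (rule primitive_on_norm_le[OF primitive_on_diff[OF F primitive_on_mult[OF K'(1) G]]
      primitive_on_cmult[OF primitive_on_cmult[OF primitive_on_mono[OF eta_primitive x(2)]]] x(1)])
    fix s assume s: "0 \<le> s" "s \<le> x"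
    have "norm (k s * G s - (K' s * g s + k s * G s)) = cmod (K' s) * cmod (g s)"
      by (simp add: norm_mult)
    also have "\<dots> \<le> e * (D * (a s + c s))" using bK[OF s] bg[OF s] e0 by (intro mult_mono) auto
    finally show "norm (k s * G s - (K' s * g s + k s * G s)) \<le> e * (D * (a s + c s))" .
  qed
  then have 1: "cmod (F x - K' x * G x - F 0) \<le> e * (D * \<eta> x)" by (simp add: K'(2))
  have 2: "cmod (K' x * G x) \<le> e * B" unfolding norm_mult using bK[of x] x bG e0 by (intro mult_mono) auto
  have "cmod (F x - F 0) = cmod ((F x - K' x * G x - F 0) + K' x * G x)" by simp
  also have "\<dots> \<le> e * (D * \<eta> x) + e * B" using norm_triangle_mono[OF 1 2] .
  finally show ?thesis by (simp add: algebra_simps)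
qed

end

section \<open>A vanishing mean of \<kappa> forces \<open>m\<close> to \<i>\<close>

context weyl_family
begin

text \<open>With \<open>w = \<i> z / 2\<close>, multiplying \<open>q\<close> by
  \<open>exp (w \<eta>)\<close> and \<open>p\<close> by \<open>exp (- w \<eta>)\<close> removes the
  diagonal terms; the others contain \<kappa> and cost O(\<epsilon>) by parts. So
  \<open>p(x)\<close> is nearly \<open>exp (w \<eta>) p(0)\<close> and \<open>q(0)\<close> nearly
  \<open>exp (w \<eta>) q(x)\<close>, and \<open>|q(x)| <= |p(x)|\<close> closes the chain. The
  initial values are \<open>p(0) = m + \<i>\<close> and \<open>q(0) = m - \<i>\<close>.\<close>

lemma m_near_i_step:
  fixes \<sigma> S \<epsilon> x :: real and z :: complex
  defines "C1 \<equiv> S / 2 + 3 * S\<^sup>2 / 4"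
  assumes z: "0 < Im z" "\<sigma> * cmod z \<le> Im z" and x: "0 < x" "x \<le> X" "cmod z * \<eta> x = S" "0 < S"
    and \<epsilon>: "0 < \<epsilon>" and bK: "\<And>s. 0 \<le> s \<Longrightarrow> s \<le> x \<Longrightarrow> cmod (K s) \<le> \<epsilon> * \<eta> x"
  shows "cmod (m z - \<i>) \<le> (exp (- \<sigma> * S / 2) + 4 * \<epsilon> * exp (2 * S) * C1) * cmod (m z + \<i>)"
proof -
  define w where "w = \<i> * z / 2"
  define p where "p s = vw z s + \<i> * uw z s" for s
  define q where "q s = vw z s - \<i> * uw z s" for s
  have x0: "0 \<le> x" using x by simp
  have eta_x: "0 < \<eta> x" using eta_pos x by auto
  have pq: "primitive_on x p (\<lambda>s. w * (of_real (a s + c s) * p s - cnj (\<kappa> s) * q s))"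
    "primitive_on x q (\<lambda>s. w * (\<kappa> s * p s - of_real (a s + c s) * q s))"
    using pq_primitive[OF sol_weyl[of z], THEN primitive_on_mono[OF _ x(2)]]
    unfolding p_def[abs_def] q_def[abs_def] w_def by simp_all
  have p0: "p 0 = m z + \<i>" and q0: "q 0 = m z - \<i>" by (simp_all add: p_def q_def)
  have q_le_p: "cmod (q s) \<le> cmod (p s)" if "0 \<le> s" "s \<le> x" for s
  proof (rule power2_le_imp_le)
    have "0 \<le> (cmod (p s))\<^sup>2 - (cmod (q s))\<^sup>2"
      unfolding p_def q_def pq_norm_diff using weyl_nonneg[OF z(1), of s] that x by simp
    then show "(cmod (q s))\<^sup>2 \<le> (cmod (p s))\<^sup>2" by simp
  qed simp
  define P where "P = cmod (m z + \<i>)"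
  have P0: "0 \<le> P" by (simp add: P_def)
  define B where "B = 2 * P * exp S"
  have B0: "0 \<le> B" using P0 by (simp add: B_def)
  have eS: "cmod z * \<eta> s \<le> S" if "0 \<le> s" "s \<le> x" for s
    using eta_mono[OF that x(2)] x(3) by (metis mult_left_mono norm_ge_zero)
  have pB: "cmod (p s) \<le> B" if s: "0 \<le> s" "s \<le> x" for s
  proof (rule power2_le_imp_le)
    have "(cmod (p s))\<^sup>2 \<le> (cmod (p s))\<^sup>2 + (cmod (q s))\<^sup>2" by simp
    also have "\<dots> = 2 * ((cmod (uw z s))\<^sup>2 + (cmod (vw z s))\<^sup>2)"
      unfolding p_def q_def pq_norm_sq ..
    also have "\<dots> \<le> 2 * (((cmod (uw z 0))\<^sup>2 + (cmod (vw z 0))\<^sup>2) * exp (2 * cmod z * \<eta> s))"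
      using growth[OF sol_weyl[of z] s(1)] s x by simp
    also have "\<dots> = ((cmod (p 0))\<^sup>2 + (cmod (q 0))\<^sup>2) * exp (2 * cmod z * \<eta> s)"
      unfolding p_def q_def pq_norm_sq by simp
    also have "\<dots> \<le> (4 * P\<^sup>2) * exp (2 * S)"
    proof (rule mult_mono)
      have "(cmod (q 0))\<^sup>2 \<le> (cmod (p 0))\<^sup>2" using q_le_p[of 0] x by (intro power_mono) auto
      then show "(cmod (p 0))\<^sup>2 + (cmod (q 0))\<^sup>2 \<le> 4 * P\<^sup>2" unfolding P_def p0[symmetric]
        using zero_le_power2[of "cmod (p 0)"] by linarith
      show "exp (2 * cmod z * \<eta> s) \<le> exp (2 * S)" using eS[OF s] by simp
    qed auto
    also have "\<dots> = B\<^sup>2" by (simp add: B_def power_mult_distrib flip: exp_double)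
    finally show "(cmod (p s))\<^sup>2 \<le> B\<^sup>2" .
  qed (rule B0)
  have qB: "cmod (q s) \<le> B" if s: "0 \<le> s" "s \<le> x" for s using q_le_p[OF s] pB[OF s] by simp
  have normw: "cmod w = cmod z / 2" by (simp add: w_def norm_mult)
  have Rew: "Re w = - Im z / 2" by (simp add: w_def)
  define \<theta> where "\<theta> s = exp (w * of_real (\<eta> s))" for s
  define \<theta>' where "\<theta>' s = exp (- w * of_real (\<eta> s))" for s
  have pr\<theta>: "primitive_on x \<theta> (\<lambda>s. w * of_real (a s + c s) * \<theta> s)"
    unfolding \<theta>_def[abs_def] by (rule primitive_on_exp[OF primitive_on_mono[OF eta_primitive x(2)]])
  have pr\<theta>': "primitive_on x \<theta>' (\<lambda>s. - w * of_real (a s + c s) * \<theta>' s)"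
    unfolding \<theta>'_def[abs_def] by (rule primitive_on_exp[OF primitive_on_mono[OF eta_primitive x(2)]])
  have n\<theta>: "cmod (\<theta> s) = exp (- Im z / 2 * \<eta> s)" for s by (simp add: \<theta>_def Rew)
  have n\<theta>': "cmod (\<theta>' s) = exp (Im z / 2 * \<eta> s)" for s by (simp add: \<theta>'_def Rew)
  have \<theta>1: "cmod (\<theta> s) \<le> 1" if "0 \<le> s" "s \<le> x" for s
    using eta_mono[of 0 s] that x z by (simp add: n\<theta>)
  have \<theta>'1: "cmod (\<theta>' s) \<le> exp S" if "0 \<le> s" "s \<le> x" for s
  proof -
    have "Im z / 2 * \<eta> s \<le> cmod z * \<eta> s"
      using eta_mono[of 0 s] that x z abs_Im_le_cmod[of z] by (intro mult_right_mono) auto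
    then show ?thesis using eS[OF that] by (simp add: n\<theta>')
  qed
  have \<theta>\<theta>': "\<theta> s * \<theta>' s = 1" for s by (simp add: \<theta>_def \<theta>'_def flip: exp_add)
  have three: "cmod (w * (w * y)) \<le> (cmod z)\<^sup>2 / 4 * (3 * C) * (a s + c s)"
    if "cmod y \<le> 3 * C * (a s + c s)" for y C s
  proof -
    have "cmod (w * (w * y)) = (cmod z)\<^sup>2 / 4 * cmod y" by (simp add: norm_mult normw power2_eq_square)
    also have "\<dots> \<le> (cmod z)\<^sup>2 / 4 * (3 * C * (a s + c s))" using that by (intro mult_left_mono) auto
    finally show ?thesis by (simp only: mult.assoc)
  qed
  \<comment> \<open>Common shape of the integrands of \<open>p \<theta>\<close> and
    \<open>q \<theta>'\<close>, up to the factor \<open>w\<close>.\<close>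
  have combine: "cmod ((2 * of_real (a s + c s) * y1 - k * y2) * t) \<le> 3 * (B * T) * (a s + c s)"
    if "cmod y1 \<le> B" "cmod y2 \<le> B" "cmod k \<le> a s + c s" "cmod t \<le> T" for y1 y2 k t s T
  proof -
    have T0: "0 \<le> T" using that(4) norm_ge_zero order_trans by blast
    have "cmod (2 * of_real (a s + c s) * y1 - k * y2) \<le> cmod (2 * of_real (a s + c s) * y1) + cmod (k * y2)"
      by (rule norm_triangle_ineq4)
    also have "\<dots> = 2 * (a s + c s) * cmod y1 + cmod k * cmod y2"
      using trace_pos[of s] by (simp add: norm_mult flip: of_real_add)
    also have "\<dots> \<le> 2 * (a s + c s) * B + (a s + c s) * B"
      using that trace_pos[of s] B0 by (intro add_mono mult_mono) auto
    also have "\<dots> = 3 * B * (a s + c s)" by (simp add: algebra_simps)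
    finally have "cmod (2 * of_real (a s + c s) * y1 - k * y2) * cmod t \<le> 3 * B * (a s + c s) * T"
      using that(4) trace_pos[of s] B0 by (intro mult_mono) auto
    then show ?thesis by (simp add: norm_mult mult_ac)
  qed
  have size: "(\<epsilon> * \<eta> x) * (cmod z / 2 * C + (cmod z)\<^sup>2 / 4 * (3 * C) * \<eta> x) = \<epsilon> * C * C1" for C
    unfolding C1_def x(3)[symmetric] by (simp add: power2_eq_square field_simps)
  have qe: "cmod (q x * \<theta> x - q 0 * \<theta> 0) \<le> \<epsilon> * B * C1"
    unfolding size[symmetric]
  proof (rule integral_by_parts_bound[OF x0 x(2) primitive_on_mono[OF K_primitive x(2)] K_0])
    show "primitive_on x (\<lambda>s. w * (p s * \<theta> s)) (\<lambda>s. w * (w * ((2 * of_real (a s + c s) * p s - cnj (\<kappa> s) * q s) * \<theta> s)))"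
      by (rule primitive_on_cong[OF primitive_on_cmult[OF primitive_on_mult[OF pq(1) pr\<theta>], of w]])
        (simp_all add: algebra_simps)
    show "primitive_on x (\<lambda>s. q s * \<theta> s) (\<lambda>s. \<kappa> s * (w * (p s * \<theta> s)))"
      by (rule primitive_on_cong[OF primitive_on_mult[OF pq(2) pr\<theta>]]) (simp_all add: algebra_simps)
    show "cmod (w * (p x * \<theta> x)) \<le> cmod z / 2 * B"
    proof -
      have "cmod (p x * \<theta> x) \<le> B * 1" unfolding norm_mult
        using pB[of x] \<theta>1[of x] x0 B0 by (intro mult_mono) auto
      then show ?thesis unfolding norm_mult[of w] normw by (intro mult_left_mono) auto
    qed
    fix s assume s: "0 \<le> s" "s \<le> x"
    show "cmod (K s) \<le> \<epsilon> * \<eta> x" by (rule bK[OF s])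
    show "cmod (w * (w * ((2 * of_real (a s + c s) * p s - cnj (\<kappa> s) * q s) * \<theta> s))) \<le> (cmod z)\<^sup>2 / 4 * (3 * B) * (a s + c s)"
      using combine[OF pB[OF s] qB[OF s] _ \<theta>1[OF s], of "cnj (\<kappa> s)" s] kappa_bound[of s] by (intro three) simp
  qed
  \<comment> \<open>The equation for \<open>p\<close> contains \<open>cnj \<kappa>\<close>, whereas
    \<open>K\<close> is the primitive of \<kappa>; conjugating everything makes the same lemma
    applicable.\<close>
  have pe: "cmod (cnj (p x * \<theta>' x) - cnj (p 0 * \<theta>' 0)) \<le> \<epsilon> * (B * exp S) * C1"
    unfolding size[symmetric]
  proof (rule integral_by_parts_bound[OF x0 x(2) primitive_on_mono[OF K_primitive x(2)] K_0])
    show "primitive_on x (\<lambda>s. cnj (- w * (q s * \<theta>' s))) (\<lambda>s. cnj (w * (w * ((2 * of_real (a s + c s) * q s - \<kappa> s * p s) * \<theta>' s))))"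
      by (rule primitive_on_cong[OF primitive_on_cnj[OF primitive_on_cmult[OF primitive_on_mult[OF pq(2) pr\<theta>'], of "-w"]]])
        (simp_all add: algebra_simps)
    show "primitive_on x (\<lambda>s. cnj (p s * \<theta>' s)) (\<lambda>s. \<kappa> s * cnj (- w * (q s * \<theta>' s)))"
      by (rule primitive_on_cong[OF primitive_on_cnj[OF primitive_on_mult[OF pq(1) pr\<theta>']]]) (simp_all add: algebra_simps)
    show "cmod (cnj (- w * (q x * \<theta>' x))) \<le> cmod z / 2 * (B * exp S)"
    proof -
      have "cmod (q x * \<theta>' x) \<le> B * exp S" unfolding norm_mult
        using qB[of x] \<theta>'1[of x] x0 B0 by (intro mult_mono) auto
      then have "cmod w * cmod (q x * \<theta>' x) \<le> cmod z / 2 * (B * exp S)" unfolding normw by (intro mult_left_mono) auto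
      then show ?thesis by (simp add: norm_mult mult_ac)
    qed
    fix s assume s: "0 \<le> s" "s \<le> x"
    show "cmod (K s) \<le> \<epsilon> * \<eta> x" by (rule bK[OF s])
    show "cmod (cnj (w * (w * ((2 * of_real (a s + c s) * q s - \<kappa> s * p s) * \<theta>' s)))) \<le> (cmod z)\<^sup>2 / 4 * (3 * (B * exp S)) * (a s + c s)"
      unfolding complex_mod_cnj
      using combine[OF qB[OF s] pB[OF s] kappa_bound[of s] \<theta>'1[OF s]] by (intro three) simp
  qed
  have \<theta>0: "\<theta> 0 = 1" "\<theta>' 0 = 1" by (simp_all add: \<theta>_def \<theta>'_def)
  have C1: "0 \<le> C1" using x by (simp add: C1_def)
  have "cmod (p x * \<theta>' x) \<le> P + \<epsilon> * (B * exp S) * C1"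
  proof -
    have "cmod (p x * \<theta>' x - p 0) \<le> \<epsilon> * (B * exp S) * C1"
      using pe \<theta>0 by (metis complex_cnj_diff complex_mod_cnj mult.right_neutral)
    then show ?thesis using norm_triangle_sub[of "p x * \<theta>' x" "p 0"] by (simp add: P_def p0)
  qed
  moreover have "cmod (p x) = cmod (\<theta> x) * cmod (p x * \<theta>' x)"
    using \<theta>\<theta>'[of x] by (metis mult.commute mult.left_commute mult.right_neutral norm_mult)
  moreover have \<theta>x: "cmod (\<theta> x) \<le> exp (- \<sigma> * S / 2)"
  proof -
    have "\<sigma> * S \<le> Im z * \<eta> x" using mult_right_mono[OF z(2), of "\<eta> x"] eta_x x(3) by (simp add: mult.assoc)
    then show ?thesis by (simp add: n\<theta>)
  qed
  ultimately have px: "cmod (p x) \<le> exp (- \<sigma> * S / 2) * P + \<epsilon> * (B * exp S) * C1"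
  proof -
    have "cmod (\<theta> x) * cmod (p x * \<theta>' x) \<le> cmod (\<theta> x) * (P + \<epsilon> * (B * exp S) * C1)"
      using \<open>cmod (p x * \<theta>' x) \<le> _\<close> by (intro mult_left_mono) auto
    also have "\<dots> = cmod (\<theta> x) * P + cmod (\<theta> x) * (\<epsilon> * (B * exp S) * C1)" by (simp add: distrib_left)
    also have "\<dots> \<le> exp (- \<sigma> * S / 2) * P + 1 * (\<epsilon> * (B * exp S) * C1)"
      using \<theta>x \<theta>1[of x] x0 P0 \<epsilon> B0 C1 by (intro add_mono mult_right_mono) auto
    finally show ?thesis using \<open>cmod (p x) = _\<close> by simp
  qed
  have "cmod (q 0) \<le> cmod (q x * \<theta> x) + \<epsilon> * B * C1"
    using norm_triangle_sub[of "q 0" "q x * \<theta> x"] qe \<theta>0 by (simp add: norm_minus_commute)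
  also have "cmod (q x * \<theta> x) \<le> cmod (p x) * 1"
    unfolding norm_mult using q_le_p[of x] \<theta>1[of x] x0 by (intro mult_mono) auto
  finally have "cmod (q 0) \<le> exp (- \<sigma> * S / 2) * P + \<epsilon> * (B * exp S) * C1 + \<epsilon> * B * C1" using px by simp
  also have "\<epsilon> * B * C1 \<le> \<epsilon> * (B * exp S) * C1"
    using \<epsilon> B0 C1 x by (intro mult_right_mono mult_left_mono) (auto simp: mult_le_cancel_left1)
  also have "exp (- \<sigma> * S / 2) * P + \<epsilon> * (B * exp S) * C1 + \<epsilon> * (B * exp S) * C1
     = (exp (- \<sigma> * S / 2) + 4 * \<epsilon> * exp (2 * S) * C1) * P"
    unfolding B_def exp_double power2_eq_square by (simp add: algebra_simps)
  finally show ?thesis by (simp add: q0 P_def)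
qed

text \<open>\<open>S\<close> makes \<open>exp (- \<sigma> S / 2)\<close> equal to
  \<open>\<gamma> / 2\<close>, and \<epsilon> makes the error the other \<open>\<gamma> / 2\<close>.
  From \<open>|m - \<i>| <= \<gamma> |m + \<i>|\<close> and \<open>\<gamma> <= 1/2\<close> follows
  \<open>|m - \<i>| <= 4 \<gamma>\<close>.\<close>

lemma cone_tendsto_i:
  assumes K_small: "\<And>\<epsilon>. 0 < \<epsilon> \<Longrightarrow> \<exists>x1>0. \<forall>x. 0 < x \<and> x \<le> x1 \<longrightarrow> cmod (K x) \<le> \<epsilon> * \<eta> x"
  shows "cone_tendsto m \<i>"
  unfolding cone_tendsto_def
proof (intro allI impI)
  fix \<sigma> \<epsilon>0 :: real assume \<sigma>: "0 < \<sigma>" and \<epsilon>0: "0 < \<epsilon>0"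
  define \<gamma> where "\<gamma> = min (1/2) (\<epsilon>0 / 5)"
  have \<gamma>: "0 < \<gamma>" "\<gamma> \<le> 1/2" "4 * \<gamma> < \<epsilon>0" using \<epsilon>0 by (auto simp: \<gamma>_def min_def)
  define S where "S = - 2 * ln (\<gamma> / 2) / \<sigma>"
  have "ln (\<gamma> / 2) < 0" using \<gamma> by (intro ln_less_zero) auto
  then have S0: "0 < S" using \<sigma> divide_neg_pos[of "2 * ln (\<gamma> / 2)" \<sigma>] by (simp add: S_def)
  have "- \<sigma> * S / 2 = ln (\<gamma> / 2)" using \<sigma> by (simp add: S_def)
  then have expS: "exp (- \<sigma> * S / 2) = \<gamma> / 2" using \<gamma> by simp
  define C1 where "C1 = S / 2 + 3 * S\<^sup>2 / 4"
  have C1: "0 < C1" using S0 by (simp add: C1_def add_pos_nonneg)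
  define \<epsilon> where "\<epsilon> = \<gamma> / (8 * exp (2 * S) * C1)"
  have e0: "0 < \<epsilon>" using \<gamma> C1 by (simp add: \<epsilon>_def)
  have e1: "4 * \<epsilon> * exp (2 * S) * C1 = \<gamma> / 2" using C1 by (simp add: \<epsilon>_def)
  obtain x1 where x1: "0 < x1" "\<And>x. 0 < x \<Longrightarrow> x \<le> x1 \<Longrightarrow> cmod (K x) \<le> \<epsilon> * \<eta> x"
    using K_small[OF e0] by auto
  define x2 where "x2 = min x1 X"
  have x2: "0 < x2" "x2 \<le> X" "x2 \<le> x1" using x1 X_pos by (auto simp: x2_def)
  have eta2: "0 < \<eta> x2" using eta_pos x2 by auto
  show "\<exists>R. \<forall>z. R \<le> cmod z \<and> 0 < cmod z \<and> \<sigma> * cmod z \<le> Im z \<longrightarrow> cmod (m z - \<i>) < \<epsilon>0"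
  proof (intro exI allI impI)
    fix z assume z: "2 * S / \<eta> x2 \<le> cmod z \<and> 0 < cmod z \<and> \<sigma> * cmod z \<le> Im z"
    then have Imz: "0 < Im z" using \<sigma> by (meson less_le_trans mult_pos_pos)
    have "S / cmod z < \<eta> x2"
    proof -
      have "2 * S \<le> cmod z * \<eta> x2" using z eta2 by (simp add: divide_le_eq)
      then have "S < \<eta> x2 * cmod z" using S0 by (simp add: mult.commute)
      then show ?thesis using z by (simp add: divide_less_eq)
    qed
    moreover have "\<eta> x2 \<le> \<eta> X" using eta_mono[of x2 X] x2 by auto
    ultimately obtain x where x: "0 < x" "x \<le> X" "\<eta> x = S / cmod z"
      using eta_attains[of "S / cmod z"] S0 z by auto
    then have xx2: "x < x2" using eta_less_imp_less[of x2 x] x2 \<open>S / cmod z < \<eta> x2\<close> by auto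
    \<comment> \<open>Integration by parts needs the bound on all of \<open>[0, x]\<close>, with the
      value of \<open>\<eta>\<close> at the endpoint; monotonicity supplies it. The hypothesis
      speaks of positive arguments, so 0 is treated apart.\<close>
    have "cmod (K s) \<le> \<epsilon> * \<eta> x" if s: "0 \<le> s" "s \<le> x" for s
    proof (cases "s = 0")
      case True
      have "0 \<le> \<eta> x" using eta_pos[OF x(1,2)] by simp
      then show ?thesis using True e0 by simp
    next
      case False
      then have "cmod (K s) \<le> \<epsilon> * \<eta> s" using x1(2)[of s] s xx2 x2 by auto
      also have "\<dots> \<le> \<epsilon> * \<eta> x" using eta_mono[OF s x(2)] e0 by (intro mult_left_mono) auto
      finally show ?thesis .
    qed
    moreover have "cmod z * \<eta> x = S" using x z by auto
    ultimately have "cmod (m z - \<i>) \<le> (exp (- \<sigma> * S / 2) + 4 * \<epsilon> * exp (2 * S) * (S / 2 + 3 * S\<^sup>2 / 4)) * cmod (m z + \<i>)"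
      using Imz z x S0 e0 by (intro m_near_i_step) auto
    then have main: "cmod (m z - \<i>) \<le> \<gamma> * cmod (m z + \<i>)"
      unfolding expS C1_def[symmetric] e1 by simp
    have "cmod (m z + \<i>) \<le> cmod (m z - \<i>) + cmod (2 * \<i>)"
      using norm_triangle_ineq[of "m z - \<i>" "2 * \<i>"] by (simp add: algebra_simps)
    then have "\<gamma> * cmod (m z + \<i>) \<le> \<gamma> * (cmod (m z - \<i>) + 2)"
      using \<gamma> by (intro mult_left_mono) (auto simp: norm_mult)
    also have "\<dots> \<le> 1/2 * cmod (m z - \<i>) + 2 * \<gamma>"
      using mult_right_mono[OF \<gamma>(2), of "cmod (m z - \<i>)"] by (simp add: distrib_left)
    finally show "cmod (m z - \<i>) < \<epsilon>0" using main \<gamma> by linarith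
  qed
qed

text \<open>The Wronskian with the second column is 1, so the Weyl solution never vanishes and the
  logarithm of its norm is defined.\<close>

lemma weyl_sol_nonzero:
  assumes "0 \<le> x" "x \<le> X"
  shows "0 < (cmod (uw z x))\<^sup>2 + (cmod (vw z x))\<^sup>2"
proof -
  have "v2 z x * uw z x - u2 z x * vw z x = 1"
    using primitive_on_eq[OF lagrange_form[OF sol2[of z] sol_weyl[of z]] assms] by (simp add: init)
  then have "uw z x \<noteq> 0 \<or> vw z x \<noteq> 0" by auto
  then show ?thesis by (auto simp: add_pos_nonneg add_nonneg_pos)
qed

text \<open>For \<open>z = i Y\<close> the quantities \<open>N = |p|\<^sup>2 + |q|\<^sup>2\<close>, \<open>\<rho> = |q|\<^sup>2 / N\<close> and \<open>V = q cnj p / N\<close> satisfy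
  \<open>(ln N)' = - Y t (1 - 2 \<rho>)\<close> and \<open>V' = - (Y / 2) (1 - 2 \<rho>) (\<kappa> - 2 t V)\<close> with \<open>t = tr H\<close>. Hence if \<open>N\<close>
  decays at nearly the maximal rate, then \<open>\<rho>\<close> and \<open>V\<close> are small in the mean, and so is \<open>\<kappa>\<close>.\<close>

lemma K_bound_step:
  assumes x: "0 < x" "x \<le> X" and y: "0 < y" and \<theta>: "0 < \<theta>"
  defines "z \<equiv> \<i> * of_real (y / \<eta> x)"
  assumes decay: "(cmod (uw z x))\<^sup>2 + (cmod (vw z x))\<^sup>2 \<le> 4 * exp (- 2 * \<alpha> * y) * ((cmod (uw z 0))\<^sup>2 + (cmod (vw z 0))\<^sup>2)"
  defines "\<omega> \<equiv> (ln 4 / y + (1 - 2 * \<alpha>)) / 2"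
  shows "cmod (K x) \<le> (2 / y + (2 + 1 / \<theta>) * \<omega> + \<theta>) * \<eta> x"
proof -
  have eta_x: "0 < \<eta> x" using eta_pos x by auto
  define Y where "Y = y / \<eta> x"
  have Y0: "0 < Y" using y eta_x by (simp add: Y_def)
  have x0: "0 \<le> x" using x by simp
  define p where "p s = vw z s + \<i> * uw z s" for s
  define q where "q s = vw z s - \<i> * uw z s" for s
  define t where "t s = a s + c s" for s
  have t0: "0 \<le> t s" for s using nonneg by (simp add: t_def)
  have iz: "\<i> * z / 2 = of_real (- Y / 2)" by (simp add: z_def Y_def)
  have pr_eta: "primitive_on x \<eta> t" using primitive_on_mono[OF eta_primitive x(2)] by (simp add: t_def[abs_def])
  have pq: "primitive_on x p (\<lambda>s. of_real (- Y / 2) * (of_real (t s) * p s - cnj (\<kappa> s) * q s))"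
    "primitive_on x q (\<lambda>s. of_real (- Y / 2) * (\<kappa> s * p s - of_real (t s) * q s))"
    using pq_primitive[OF sol_weyl[of z], THEN primitive_on_mono[OF _ x(2)]]
    unfolding p_def[abs_def] q_def[abs_def] iz t_def by simp_all
  define N where "N s = (cmod (p s))\<^sup>2 + (cmod (q s))\<^sup>2" for s
  define \<rho> where "\<rho> s = (cmod (q s))\<^sup>2 / N s" for s
  have N_eq: "N s = 2 * ((cmod (uw z s))\<^sup>2 + (cmod (vw z s))\<^sup>2)" for s
    unfolding N_def p_def q_def pq_norm_sq ..
  have N_pos: "0 < N s" if "0 \<le> s" "s \<le> x" for s
    unfolding N_eq using weyl_sol_nonzero[of s z] that x by simp
  have prN: "primitive_on x N (\<lambda>s. - Y * t s * ((cmod (p s))\<^sup>2 - (cmod (q s))\<^sup>2))"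
  proof (rule primitive_on_cong[OF primitive_on_add[OF primitive_on_cmod_sq[OF pq(1)] primitive_on_cmod_sq[OF pq(2)]]])
    show "N s = (cmod (p s))\<^sup>2 + (cmod (q s))\<^sup>2" for s by (simp add: N_def)
    show "- Y * t s * ((cmod (p s))\<^sup>2 - (cmod (q s))\<^sup>2)
      = 2 * Re (cnj (p s) * (of_real (- Y / 2) * (of_real (t s) * p s - cnj (\<kappa> s) * q s)))
      + 2 * Re (cnj (q s) * (of_real (- Y / 2) * (\<kappa> s * p s - of_real (t s) * q s)))" for s
      unfolding cmod_power2 by (simp add: power2_eq_square field_simps)
  qed
  have Dr: "((cmod (p s))\<^sup>2 - (cmod (q s))\<^sup>2) / N s = 1 - 2 * \<rho> s" if "0 \<le> s" "s \<le> x" for s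
  proof -
    have "(cmod (p s))\<^sup>2 - (cmod (q s))\<^sup>2 = N s - 2 * (cmod (q s))\<^sup>2" by (simp add: N_def)
    then show ?thesis unfolding \<rho>_def
      by (metis N_pos[OF that] diff_divide_distrib divide_self less_irrefl times_divide_eq_right)
  qed
  have rho01: "0 \<le> \<rho> s" "\<rho> s \<le> 1" if "0 \<le> s" "s \<le> x" for s
    using N_pos[OF that] by (auto simp: \<rho>_def N_def divide_le_eq)
  \<comment> \<open>Obtained by solving the equation for \<open>(ln N)'\<close> for
    \<open>t \<rho>\<close>: the deficit of \<open>N\<close> from the maximal decay is the integral
    of \<open>t \<rho>\<close>.\<close>
  define \<Phi> where "\<Phi> s = (1 / (2 * Y)) * (ln (N s) + Y * \<eta> s)" for s
  have pr\<Phi>: "primitive_on x \<Phi> (\<lambda>s. t s * \<rho> s)"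
  proof (rule primitive_on_cong[OF primitive_on_cmult[OF primitive_on_add[OF primitive_on_ln[OF prN x0 N_pos]
          primitive_on_cmult[OF pr_eta, of Y]], of "1 / (2 * Y)"]])
    fix s assume s: "0 \<le> s" "s \<le> x"
    show "\<Phi> s = 1 / (2 * Y) * (ln (N s) + Y * \<eta> s)" by (simp add: \<Phi>_def)
    have "- Y * t s * ((cmod (p s))\<^sup>2 - (cmod (q s))\<^sup>2) / N s = - Y * t s * (1 - 2 * \<rho> s)"
      using Dr[OF s] by (simp flip: times_divide_eq_right)
    then show "t s * \<rho> s = 1 / (2 * Y) * (- Y * t s * ((cmod (p s))\<^sup>2 - (cmod (q s))\<^sup>2) / N s + Y * t s)"
      using Y0 by (simp add: field_simps)
  qed
  \<comment> \<open>The maximal rate is \<alpha> = 1/2. In \<omega> the term \<open>ln 4 / y\<close>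
    stems from the factor 4 in \<open>decay\<close>, and \<open>1 - 2 * \<alpha>\<close> is the
    deficit of the rate.\<close>
  have \<Phi>_le: "\<Phi> x - \<Phi> 0 \<le> \<omega> * \<eta> x"
  proof -
    have N0: "0 < N 0" "0 < N x" using N_pos[of 0] N_pos[of x] x0 by auto
    have "4 * exp (- 2 * \<alpha> * y) * N 0 = 2 * (4 * exp (- 2 * \<alpha> * y) * ((cmod (uw z 0))\<^sup>2 + (cmod (vw z 0))\<^sup>2))"
      unfolding N_eq by (rule mult.left_commute)
    then have "N x \<le> 4 * exp (- 2 * \<alpha> * y) * N 0"
      using mult_left_mono[OF decay, of 2] by (simp only: N_eq zero_le_numeral)
    then have "ln (N x) \<le> ln (4 * exp (- 2 * \<alpha> * y) * N 0)"
      using N0 by (subst ln_le_cancel_iff) auto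
    also have "\<dots> = ln 4 + - 2 * \<alpha> * y + ln (N 0)"
      using N0 by (simp add: ln_mult)
    finally have l: "ln (N x) - ln (N 0) \<le> ln 4 - 2 * \<alpha> * y" by simp
    have "\<Phi> x - \<Phi> 0 = (1 / (2 * Y)) * (ln (N x) - ln (N 0) + Y * \<eta> x)"
      by (simp add: \<Phi>_def right_diff_distrib distrib_left)
    also have "\<dots> \<le> (1 / (2 * Y)) * (ln 4 - 2 * \<alpha> * y + Y * \<eta> x)"
      using l Y0 by (intro mult_left_mono) auto
    also have "Y * \<eta> x = y" using eta_x by (simp add: Y_def)
    also have "(1 / (2 * Y)) * (ln 4 - 2 * \<alpha> * y + y) = \<omega> * \<eta> x"
      using y eta_x by (simp add: \<omega>_def Y_def field_simps)
    finally show ?thesis .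
  qed
  define V where "V s = q s * cnj (p s) * of_real (1 / N s)" for s
  have normV: "cmod (V s) = cmod (q s) * cmod (p s) / N s" if "0 \<le> s" "s \<le> x" for s
    using N_pos[OF that] by (simp add: V_def norm_mult norm_divide)
  have prV: "primitive_on x V (\<lambda>s. of_real Y * of_real (1 - 2 * \<rho> s) * (of_real (t s) * V s - \<kappa> s / 2))"
  proof (rule primitive_on_cong[OF primitive_on_mult[OF primitive_on_mult[OF pq(2) primitive_on_cnj[OF pq(1)]]
          primitive_on_of_real[OF primitive_on_inverse[OF prN x0 N_pos]]]])
    fix s assume s: "0 \<le> s" "s \<le> x"
    show "V s = q s * cnj (p s) * of_real (1 / N s)" by (simp add: V_def)
    define d where "d = (cmod (p s))\<^sup>2 - (cmod (q s))\<^sup>2"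
    have d: "of_real d = p s * cnj (p s) - q s * cnj (q s)"
      unfolding d_def of_real_diff complex_norm_square ..
    have r: "1 - 2 * \<rho> s = d / N s" using Dr[OF s] by (simp add: d_def)
    have w': "q s * cnj (of_real (- Y / 2) * (of_real (t s) * p s - cnj (\<kappa> s) * q s))
        + of_real (- Y / 2) * (\<kappa> s * p s - of_real (t s) * q s) * cnj (p s) = of_real (- Y / 2) * \<kappa> s * of_real d"
      unfolding d by (simp add: algebra_simps)
    have inv': "- (- Y * t s * d) / (N s)\<^sup>2 = Y * t s * (d / N s) * (1 / N s)" by (simp add: power2_eq_square)
    show "of_real Y * of_real (1 - 2 * \<rho> s) * (of_real (t s) * V s - \<kappa> s / 2)
      = q s * cnj (p s) * of_real (- (- Y * t s * ((cmod (p s))\<^sup>2 - (cmod (q s))\<^sup>2)) / (N s)\<^sup>2)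
      + (q s * cnj (of_real (- Y / 2) * (of_real (t s) * p s - cnj (\<kappa> s) * q s))
        + of_real (- Y / 2) * (\<kappa> s * p s - of_real (t s) * q s) * cnj (p s)) * of_real (1 / N s)"
      unfolding w' d_def[symmetric] inv' r V_def by (simp add: algebra_simps)
  qed
  have V_le: "cmod (V s) \<le> 1 / 2" if s: "0 \<le> s" "s \<le> x" for s
  proof -
    have "2 * (cmod (q s) * cmod (p s)) \<le> N s"
      using sum_squares_bound[of "cmod (p s)" "cmod (q s)"] by (simp add: N_def mult_ac)
    then show ?thesis using N_pos[OF s] by (simp add: normV[OF s] field_simps)
  qed
  \<comment> \<open>\<open>|V|^2\<close> is at most \<rho>; the weight \<theta> avoids a square
    root, which could not be integrated against the bound for \<rho>.\<close>
  have V_rho: "cmod (V s) \<le> \<theta> / 2 + \<rho> s / (2 * \<theta>)" if s: "0 \<le> s" "s \<le> x" for s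
  proof (rule power2_le_imp_le)
    have "(cmod (p s))\<^sup>2 / N s \<le> 1" using N_pos[OF s] by (simp add: N_def divide_le_eq)
    then have "\<rho> s * ((cmod (p s))\<^sup>2 / N s) \<le> \<rho> s * 1"
      by (rule mult_left_mono[OF _ rho01(1)[OF s]])
    moreover have "(cmod (V s))\<^sup>2 = \<rho> s * ((cmod (p s))\<^sup>2 / N s)"
      unfolding normV[OF s] \<rho>_def by (simp add: power_divide power_mult_distrib power2_eq_square)
    ultimately have "(cmod (V s))\<^sup>2 \<le> \<rho> s * 1" by simp
    also have "\<dots> = 4 * (\<theta> / 2 * (\<rho> s / (2 * \<theta>)))" using \<theta> by simp
    also have "\<dots> \<le> (\<theta> / 2 + \<rho> s / (2 * \<theta>))\<^sup>2"
      using zero_le_power2[of "\<theta> / 2 - \<rho> s / (2 * \<theta>)"] unfolding power2_diff power2_sum by (simp only: mult.assoc)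
    finally show "(cmod (V s))\<^sup>2 \<le> (\<theta> / 2 + \<rho> s / (2 * \<theta>))\<^sup>2" .
  qed (use \<theta> rho01[OF s] in auto)
  \<comment> \<open>Adding \<open>(2 / Y) V\<close> cancels the main part of \<kappa>: the integrand
    left is \<open>2 \<rho> \<kappa> + 2 (1 - 2 \<rho>) t V\<close>, small in the mean, while
    \<open>V\<close> itself is bounded by 1/2.\<close>
  have "cmod ((K x + of_real (2 / Y) * V x) - (K 0 + of_real (2 / Y) * V 0))
     \<le> ((2 + 1 / \<theta>) * \<Phi> x + \<theta> * \<eta> x) - ((2 + 1 / \<theta>) * \<Phi> 0 + \<theta> * \<eta> 0)"
  proof (rule primitive_on_norm_le[OF primitive_on_add[OF primitive_on_mono[OF K_primitive x(2)] primitive_on_cmult[OF prV]]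
      primitive_on_add[OF primitive_on_cmult[OF pr\<Phi>] primitive_on_cmult[OF pr_eta]] x0])
    fix s assume s: "0 \<le> s" "s \<le> x"
    have "\<kappa> s + of_real (2 / Y) * (of_real Y * of_real (1 - 2 * \<rho> s) * (of_real (t s) * V s - \<kappa> s / 2))
       = \<kappa> s + 2 * of_real (1 - 2 * \<rho> s) * (of_real (t s) * V s - \<kappa> s / 2)"
      using Y0 by simp
    also have "\<dots> = of_real (2 * \<rho> s) * \<kappa> s + of_real (2 * (1 - 2 * \<rho> s) * t s) * V s"
      by (simp add: field_simps)
    also have "cmod \<dots> \<le> 2 * \<rho> s * t s + 2 * t s * (\<theta> / 2 + \<rho> s / (2 * \<theta>))"
    proof (intro order.trans[OF norm_triangle_ineq] add_mono)
      show "cmod (of_real (2 * \<rho> s) * \<kappa> s) \<le> 2 * \<rho> s * t s"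
        using rho01[OF s] kappa_bound[of s] unfolding norm_mult norm_of_real
        by (intro mult_mono) (auto simp: t_def)
      have "\<bar>2 * (1 - 2 * \<rho> s) * t s\<bar> \<le> 2 * t s"
      proof -
        have "\<bar>2 * (1 - 2 * \<rho> s) * t s\<bar> = 2 * \<bar>1 - 2 * \<rho> s\<bar> * t s" unfolding abs_mult using t0[of s] by simp
        also have "\<dots> \<le> 2 * 1 * t s" using rho01[OF s] t0[of s] by (intro mult_right_mono mult_left_mono) auto
        finally show ?thesis by simp
      qed
      then show "cmod (of_real (2 * (1 - 2 * \<rho> s) * t s) * V s) \<le> 2 * t s * (\<theta> / 2 + \<rho> s / (2 * \<theta>))"
        unfolding norm_mult norm_of_real using V_rho[OF s] t0[of s] by (intro mult_mono) auto
    qed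
    also have "\<dots> = (2 + 1 / \<theta>) * (t s * \<rho> s) + \<theta> * t s" using \<theta> by (simp add: field_simps)
    finally show "cmod (\<kappa> s + of_real (2 / Y) * (of_real Y * of_real (1 - 2 * \<rho> s) * (of_real (t s) * V s - \<kappa> s / 2)))
       \<le> (2 + 1 / \<theta>) * (t s * \<rho> s) + \<theta> * t s" .
  qed
  also have "\<dots> = (2 + 1 / \<theta>) * (\<Phi> x - \<Phi> 0) + \<theta> * \<eta> x" by (simp add: right_diff_distrib)
  also have "\<dots> \<le> (2 + 1 / \<theta>) * (\<omega> * \<eta> x) + \<theta> * \<eta> x"
    using \<Phi>_le \<theta> by (intro add_mono mult_left_mono) auto
  also have "K x + of_real (2 / Y) * V x - (K 0 + of_real (2 / Y) * V 0) = K x + of_real (2 / Y) * (V x - V 0)"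
    unfolding right_diff_distrib by simp
  finally have main: "cmod (K x + of_real (2 / Y) * (V x - V 0)) \<le> (2 + 1 / \<theta>) * (\<omega> * \<eta> x) + \<theta> * \<eta> x" .
  have "cmod (of_real (2 / Y) * (V x - V 0)) \<le> 2 / Y * (1 / 2 + 1 / 2)"
    unfolding norm_mult norm_of_real
    using V_le[of x] V_le[of 0] x0 Y0 by (intro mult_mono order.trans[OF norm_triangle_ineq4] add_mono) auto
  also have "\<dots> = 2 / y * \<eta> x" by (simp add: Y_def)
  finally have "cmod (K x) \<le> (2 + 1 / \<theta>) * (\<omega> * \<eta> x) + \<theta> * \<eta> x + 2 / y * \<eta> x"
    using main norm_triangle_ineq4[of "K x + of_real (2 / Y) * (V x - V 0)" "of_real (2 / Y) * (V x - V 0)"] by simp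
  then show ?thesis by (simp add: algebra_simps)
qed

text \<open>The Weyl solution with \<open>m z\<close> replaced by the expected limit \<i>. It is
  entire in \<open>z\<close>, and the Weyl solution differs from it by \<open>m z - \<i>\<close>
  times the second column.\<close>

definition u0 where "u0 z x = u1 z x + \<i> * u2 z x"
definition v0 where "v0 z x = v1 z x + \<i> * v2 z x"
definition p0 where "p0 z x = v0 z x + \<i> * u0 z x"
definition q0 where "q0 z x = v0 z x - \<i> * u0 z x"

lemma sol0: "solution z (u0 z) (v0 z)"
  using solution_linear[OF sol1[of z] sol2[of z], of 1 "\<i>"] by (simp add: u0_def[abs_def] v0_def[abs_def])

lemma sol0_init [simp]: "u0 z 0 = 1" "v0 z 0 = \<i>"
  by (simp_all add: u0_def v0_def init)

lemma pq0_bound: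
  assumes x: "0 \<le> x" "x \<le> X"
  shows "cmod (p0 z x) \<le> 2 * exp (cmod z * \<eta> x)" "cmod (q0 z x) \<le> 2 * exp (cmod z * \<eta> x)"
proof -
  have "(cmod (p0 z x))\<^sup>2 + (cmod (q0 z x))\<^sup>2 = 2 * ((cmod (u0 z x))\<^sup>2 + (cmod (v0 z x))\<^sup>2)"
    unfolding p0_def q0_def pq_norm_sq ..
  also have "\<dots> \<le> 2 * (((cmod (u0 z 0))\<^sup>2 + (cmod (v0 z 0))\<^sup>2) * exp (2 * cmod z * \<eta> x))"
    using growth[OF sol0[of z] x] by simp
  also have "\<dots> = (2 * exp (cmod z * \<eta> x))\<^sup>2"
    by (simp add: power_mult_distrib mult.assoc flip: exp_double)
  finally have *: "(cmod (p0 z x))\<^sup>2 + (cmod (q0 z x))\<^sup>2 \<le> (2 * exp (cmod z * \<eta> x))\<^sup>2" .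
  have "(cmod (p0 z x))\<^sup>2 \<le> (2 * exp (cmod z * \<eta> x))\<^sup>2" "(cmod (q0 z x))\<^sup>2 \<le> (2 * exp (cmod z * \<eta> x))\<^sup>2"
    using * zero_le_power2[of "cmod (p0 z x)"] zero_le_power2[of "cmod (q0 z x)"] by linarith+
  then show "cmod (p0 z x) \<le> 2 * exp (cmod z * \<eta> x)" "cmod (q0 z x) \<le> 2 * exp (cmod z * \<eta> x)"
    by (auto intro: power2_le_imp_le)
qed

lemma p0_holomorphic:
  assumes x: "0 \<le> x" "x \<le> X"
  shows "(\<lambda>z. p0 z x) holomorphic_on UNIV"
  unfolding p0_def
  using solution_holomorphic[of u0 v0 1 \<i> x] sol0 x by (intro holomorphic_intros) auto

text \<open>For real \<open>z\<close> the quantity \<open>Im (cnj u v)\<close> is conserved. It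
  equals 1 initially, so \<open>|p0|^2 - |q0|^2 = 4\<close>.\<close>

lemma p0_real_lower:
  assumes x: "0 \<le> x" "x \<le> X" and z: "Im z = 0"
  shows "2 \<le> cmod (p0 z x)"
proof -
  have "Im (cnj (u0 z x) * v0 z x) = 1"
    using primitive_on_eq[OF energy_primitive[OF sol0[of z]] x] z by simp
  then have "(cmod (p0 z x))\<^sup>2 - (cmod (q0 z x))\<^sup>2 = 4"
    unfolding p0_def q0_def pq_norm_diff by simp
  then have "4 \<le> (cmod (p0 z x))\<^sup>2" using zero_le_power2[of "cmod (q0 z x)"] by linarith
  moreover have "(2 :: real)\<^sup>2 = 4" by simp
  ultimately have "2\<^sup>2 \<le> (cmod (p0 z x))\<^sup>2" by (simp only:)
  then show ?thesis by (rule power2_le_imp_le) (rule norm_ge_zero)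
qed

text \<open>The analytic continuation of the same conservation law: the conjugate of the solution at
  \<open>cnj z\<close> has parameter \<open>z\<close>, so its Wronskian with the solution at
  \<open>z\<close> is constant.\<close>

lemma pq0_reflection:
  assumes x: "0 \<le> x" "x \<le> X"
  shows "cnj (p0 (cnj z) x) * p0 z x - cnj (q0 (cnj z) x) * q0 z x = 4"
proof -
  have "cnj (v0 (cnj z) x) * u0 z x - cnj (u0 (cnj z) x) * v0 z x = - 2 * \<i>"
    using primitive_on_eq[OF lagrange_form[OF solution_cnj[OF sol0[of "cnj z"]] sol0[of z]] x] by simp
  moreover have "cnj (p0 (cnj z) x) * p0 z x - cnj (q0 (cnj z) x) * q0 z x
     = 2 * \<i> * (cnj (v0 (cnj z) x) * u0 z x - cnj (u0 (cnj z) x) * v0 z x)"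
    by (simp add: p0_def q0_def algebra_simps)
  ultimately show ?thesis by simp
qed

text \<open>By the reflection identity \<open>p0\<close> and \<open>q0\<close> cannot both be small,
  and by the Weyl inequality \<open>|q0|\<close> exceeds \<open>|p0|\<close> at most by a multiple
  of \<open>|m - \<i>|\<close>. When \<open>m\<close> tends to \<i> this bounds \<open>p0\<close>
  from below and keeps zeros out of the upper half-plane.\<close>

lemma p0_lower:
  assumes x: "0 \<le> x" "x \<le> X" and z: "0 < Im z"
  shows "1 \<le> exp (cmod z * \<eta> x) * (cmod (p0 z x) + 2 * exp (cmod z * \<eta> x) * cmod (m z - \<i>))"
proof -
  define E where "E = exp (cmod z * \<eta> x)"
  define \<delta> where "\<delta> = cmod (m z - \<i>)"
  have E0: "0 < E" by (simp add: E_def)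
  have b2: "cmod (u2 z x) \<le> E" "cmod (v2 z x) \<le> E"
    using solution_bound[OF sol2[of z] x, of 1] by (simp_all add: init E_def)
  have b2': "cmod (v2 z x + \<i> * u2 z x) \<le> 2 * E" "cmod (v2 z x - \<i> * u2 z x) \<le> 2 * E"
    using b2 norm_triangle_ineq[of "v2 z x" "\<i> * u2 z x"] norm_triangle_ineq4[of "v2 z x" "\<i> * u2 z x"]
    by (simp_all add: norm_mult)
  have pw: "vw z x + \<i> * uw z x = p0 z x + (m z - \<i>) * (v2 z x + \<i> * u2 z x)"
    "vw z x - \<i> * uw z x = q0 z x + (m z - \<i>) * (v2 z x - \<i> * u2 z x)"
    by (simp_all add: p0_def q0_def u0_def v0_def uw_def vw_def algebra_simps)
  have d: "cmod ((m z - \<i>) * (v2 z x + \<i> * u2 z x)) \<le> \<delta> * (2 * E)" "cmod ((m z - \<i>) * (v2 z x - \<i> * u2 z x)) \<le> \<delta> * (2 * E)"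
    unfolding norm_mult \<delta>_def using b2' by (auto intro: mult_left_mono)
  have "cmod (vw z x - \<i> * uw z x) \<le> cmod (vw z x + \<i> * uw z x)"
  proof (rule power2_le_imp_le)
    have "0 \<le> (cmod (vw z x + \<i> * uw z x))\<^sup>2 - (cmod (vw z x - \<i> * uw z x))\<^sup>2"
      unfolding pq_norm_diff using weyl_nonneg[OF z x] by simp
    then show "(cmod (vw z x - \<i> * uw z x))\<^sup>2 \<le> (cmod (vw z x + \<i> * uw z x))\<^sup>2" by simp
  qed simp
  moreover have "cmod (q0 z x) \<le> cmod (vw z x - \<i> * uw z x) + \<delta> * (2 * E)"
    using norm_triangle_ineq4[of "vw z x - \<i> * uw z x" "(m z - \<i>) * (v2 z x - \<i> * u2 z x)"] d(2) unfolding pw(2) by simp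
  moreover have "cmod (vw z x + \<i> * uw z x) \<le> cmod (p0 z x) + \<delta> * (2 * E)"
    using norm_triangle_ineq[of "p0 z x" "(m z - \<i>) * (v2 z x + \<i> * u2 z x)"] d(1) unfolding pw(1) by simp
  ultimately have q0p0: "cmod (q0 z x) \<le> cmod (p0 z x) + 2 * (\<delta> * (2 * E))" by simp
  have "4 = cmod (cnj (p0 (cnj z) x) * p0 z x - cnj (q0 (cnj z) x) * q0 z x)"
    unfolding pq0_reflection[OF x] by simp
  also have "\<dots> \<le> cmod (p0 (cnj z) x) * cmod (p0 z x) + cmod (q0 (cnj z) x) * cmod (q0 z x)"
    by (rule order.trans[OF norm_triangle_ineq4]) (simp add: norm_mult)
  also have "\<dots> \<le> 2 * E * cmod (p0 z x) + 2 * E * (cmod (p0 z x) + 2 * (\<delta> * (2 * E)))"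
    using pq0_bound[OF x, of "cnj z"] q0p0 E0 by (intro add_mono mult_mono) (auto simp: E_def)
  also have "\<dots> = 4 * (E * (cmod (p0 z x) + 2 * E * \<delta>))" by (simp add: algebra_simps)
  finally show ?thesis by (simp add: E_def \<delta>_def)
qed

text \<open>Two rounds of successive approximation: crude bounds give
  \<open>p0 = 2 \<i> + O(r)\<close> and \<open>q0 = O(r)\<close> with
  \<open>r = |z| \<eta>(x)\<close>, and reinserting them yields the linear term. Since
  \<open>q0\<close> starts at 0, \<kappa> contributes only at second order, so the coefficient
  \<open>- \<eta>(x)\<close> is the same for every Hamiltonian.\<close>

lemma p0_at_0:
  assumes x: "0 \<le> x" "x \<le> X" and z: "cmod z * \<eta> x \<le> 1"
  shows "cmod (p0 z x - (2 * \<i> - z * of_real (\<eta> x))) \<le> 2 * exp 1 * (cmod z * \<eta> x)\<^sup>2"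
proof -
  define r where "r = cmod z * \<eta> x"
  have r0: "0 \<le> r" using eta_mono[of 0 x] x by (simp add: r_def)
  note pq = pq_primitive[OF sol0[of z], folded p0_def q0_def]
  have eb: "cmod (p0 z s) \<le> 2 * exp 1" "cmod (q0 z s) \<le> 2 * exp 1" if s: "0 \<le> s" "s \<le> x" for s
  proof -
    have "cmod z * \<eta> s \<le> cmod z * \<eta> x" using eta_mono[OF s x(2)] by (intro mult_left_mono) auto
    then have "exp (cmod z * \<eta> s) \<le> exp 1" using z by simp
    then show "cmod (p0 z s) \<le> 2 * exp 1" "cmod (q0 z s) \<le> 2 * exp 1"
      using pq0_bound[of s z] s x by (meson mult_left_mono order_trans zero_le_numeral)+
  qed
  have comb: "cmod ((\<i> * z / 2) * (w1 * y1 - w2 * y2)) \<le> cmod z * M * (a s + c s)"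
    if "cmod w1 \<le> a s + c s" "cmod w2 \<le> a s + c s" "cmod y1 \<le> M" "cmod y2 \<le> M" for w1 w2 y1 y2 M s
  proof -
    have M0: "0 \<le> M" using that(3) norm_ge_zero order_trans by blast
    have "cmod (w1 * y1 - w2 * y2) \<le> cmod w1 * cmod y1 + cmod w2 * cmod y2"
      by (rule order.trans[OF norm_triangle_ineq4]) (simp add: norm_mult)
    also have "\<dots> \<le> (a s + c s) * M + (a s + c s) * M"
      using that trace_pos[of s] M0 by (intro add_mono mult_mono) auto
    finally have "cmod z / 2 * cmod (w1 * y1 - w2 * y2) \<le> cmod z / 2 * ((a s + c s) * M + (a s + c s) * M)"
      by (intro mult_left_mono) auto
    moreover have "cmod (\<i> * z / 2) = cmod z / 2" by (simp add: norm_mult)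
    moreover have "cmod z / 2 * ((a s + c s) * M + (a s + c s) * M) = cmod z * M * (a s + c s)" by simp
    ultimately show ?thesis unfolding norm_mult[of "\<i> * z / 2"] by simp
  qed
  have tn: "cmod (of_real (a s + c s)) \<le> a s + c s" for s unfolding norm_of_real using nonneg[of s] by simp
  have kn: "cmod (cnj (\<kappa> s)) \<le> a s + c s" "cmod (\<kappa> s) \<le> a s + c s" for s using kappa_bound[of s] by simp_all
  have p00: "p0 z 0 = 2 * \<i>" "q0 z 0 = 0" by (simp_all add: p0_def q0_def)
  have near: "cmod (p0 z s - 2 * \<i>) \<le> 2 * exp 1 * r" "cmod (q0 z s) \<le> 2 * exp 1 * r" if s: "0 \<le> s" "s \<le> x" for s
  proof -
    have sX: "s \<le> X" using s x by simp
    have le: "cmod z * (2 * exp 1) * \<eta> s \<le> 2 * exp 1 * r"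
      using eta_mono[OF s x(2)] by (simp add: r_def mult_left_mono)
    have "cmod (p0 z s - p0 z 0) \<le> cmod z * (2 * exp 1) * \<eta> s - cmod z * (2 * exp 1) * \<eta> 0"
      by (rule primitive_on_norm_le[OF primitive_on_mono[OF pq(1) sX] primitive_on_cmult[OF primitive_on_mono[OF eta_primitive sX]] s(1)])
        (intro comb tn kn eb, use s in auto)
    then have "cmod (p0 z s - 2 * \<i>) \<le> cmod z * (2 * exp 1) * \<eta> s" by (simp add: p00)
    then show "cmod (p0 z s - 2 * \<i>) \<le> 2 * exp 1 * r" using le by (rule order.trans)
    have "cmod (q0 z s - q0 z 0) \<le> cmod z * (2 * exp 1) * \<eta> s - cmod z * (2 * exp 1) * \<eta> 0"
      by (rule primitive_on_norm_le[OF primitive_on_mono[OF pq(2) sX] primitive_on_cmult[OF primitive_on_mono[OF eta_primitive sX]] s(1)])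
        (intro comb tn kn eb, use s in auto)
    then have "cmod (q0 z s) \<le> cmod z * (2 * exp 1) * \<eta> s" by (simp add: p00)
    then show "cmod (q0 z s) \<le> 2 * exp 1 * r" using le by (rule order.trans)
  qed
  have "cmod ((p0 z x + z * of_real (\<eta> x)) - (p0 z 0 + z * of_real (\<eta> 0))) \<le> cmod z * (2 * exp 1 * r) * \<eta> x - cmod z * (2 * exp 1 * r) * \<eta> 0"
  proof (rule primitive_on_norm_le[OF _ primitive_on_cmult[OF primitive_on_mono[OF eta_primitive x(2)]] x(1)])
    show "primitive_on x (\<lambda>x. p0 z x + z * of_real (\<eta> x))
       (\<lambda>s. (\<i> * z / 2) * (of_real (a s + c s) * (p0 z s - 2 * \<i>) - cnj (\<kappa> s) * q0 z s))"
      by (rule primitive_on_cong[OF primitive_on_add[OF primitive_on_mono[OF pq(1) x(2)]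
           primitive_on_cmult[OF primitive_on_of_real[OF primitive_on_mono[OF eta_primitive x(2)]], of z]]])
        (simp_all add: algebra_simps)
    show "cmod ((\<i> * z / 2) * (of_real (a s + c s) * (p0 z s - 2 * \<i>) - cnj (\<kappa> s) * q0 z s)) \<le> cmod z * (2 * exp 1 * r) * (a s + c s)"
      if "0 \<le> s" "s \<le> x" for s
      by (intro comb tn kn near that)
  qed
  moreover have "(p0 z x + z * of_real (\<eta> x)) - (p0 z 0 + z * of_real (\<eta> 0)) = p0 z x - (2 * \<i> - z * of_real (\<eta> x))"
    by (simp add: p00)
  moreover have "cmod z * (2 * exp 1 * r) * \<eta> x - cmod z * (2 * exp 1 * r) * \<eta> 0 = 2 * exp 1 * (cmod z * \<eta> x)\<^sup>2"
    by (simp add: r_def power2_eq_square)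
  ultimately show ?thesis by (simp only:)
qed

text \<open>Compactness along a sequence that violates the claim. The limit function supplies a
  height \<open>y\<close> with almost maximal decay; being a strict inequality, this persists for
  some member of the sequence, where \<open>K_bound_step\<close> contradicts the choice of
  \<open>xs\<close>.\<close>

lemma K_small:
  assumes m: "cone_tendsto m \<i>" and \<epsilon>: "0 < \<epsilon>"
  shows "\<exists>x1>0. \<forall>x. 0 < x \<and> x \<le> x1 \<longrightarrow> cmod (K x) \<le> \<epsilon> * \<eta> x"
proof (rule ccontr)
  assume neg: "\<not> ?thesis"
  have "\<exists>x. 0 < x \<and> x \<le> X \<and> \<eta> x \<le> 1 / real (Suc n) \<and> \<epsilon> * \<eta> x < cmod (K x)" for n
  proof -
    obtain x1 where x1: "0 < x1" "x1 \<le> X" "\<And>x. 0 < x \<Longrightarrow> x \<le> x1 \<Longrightarrow> \<eta> x \<le> 1 / real (Suc n)"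
      by (rule small_eta[of "1 / real (Suc n)"]) auto
    then obtain x where "0 < x" "x \<le> x1" "\<not> cmod (K x) \<le> \<epsilon> * \<eta> x" using neg by blast
    then show ?thesis using x1 by (intro exI[of _ x]) auto
  qed
  then obtain xs where xs: "\<And>n. 0 < xs n" "\<And>n. xs n \<le> X" "\<And>n. \<eta> (xs n) \<le> 1 / real (Suc n)"
      "\<And>n. \<epsilon> * \<eta> (xs n) < cmod (K (xs n))"
    by metis
  define e where "e n = \<eta> (xs n)" for n
  have e0: "0 < e n" for n using eta_pos xs by (simp add: e_def)
  have x0: "0 \<le> xs n" for n using xs(1)[of n] by simp
  have scale: "cmod (z / of_real (e n)) * \<eta> (xs n) = cmod z" for z n
    using e0[of n] by (simp add: norm_divide flip: e_def)
  \<comment> \<open>Rescaled so that \<open>|\<zeta> n z| \<eta>(xs n) = |z|\<close>, which makes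
    all bounds independent of \<open>n\<close>.\<close>
  define \<zeta> where "\<zeta> n z = z / of_real (e n)" for n and z :: complex
  note scale' = scale[folded \<zeta>_def]
  define P where "P n z = p0 (\<zeta> n z) (xs n)" for n z
  have P_holo: "P n holomorphic_on UNIV" for n
  proof -
    have "(\<lambda>w. p0 w (xs n)) \<circ> (\<lambda>z. z / of_real (e n)) holomorphic_on UNIV"
      using e0[of n] by (intro holomorphic_on_compose holomorphic_intros holomorphic_on_subset[OF p0_holomorphic[OF x0 xs(2)]]) auto
    then show ?thesis by (simp add: P_def[abs_def] \<zeta>_def comp_def)
  qed
  have P_bound: "cmod (P n z) \<le> 2 * exp (cmod z)" for n z
    using pq0_bound(1)[OF x0 xs(2), of "\<zeta> n z" n] by (simp add: P_def scale')
  \<comment> \<open>The locally uniform bound makes the family normal; of the convergence only its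
    pointwise form is kept.\<close>
  have "\<exists>g r. g holomorphic_on UNIV \<and> strict_mono (r :: nat \<Rightarrow> nat) \<and> (\<forall>z. (\<lambda>n. P (r n) z) \<longlonglongrightarrow> g z)"
  proof (rule Montel[of UNIV "range P" P])
    show "\<exists>B. \<forall>h\<in>range P. \<forall>z\<in>C. cmod (h z) \<le> B" if "compact C" "C \<subseteq> UNIV" for C
    proof -
      obtain b where b: "\<And>z. z \<in> C \<Longrightarrow> cmod z \<le> b" using compact_imp_bounded[OF \<open>compact C\<close>]
        unfolding bounded_iff by blast
      have "cmod (P n z) \<le> 2 * exp b" if "z \<in> C" for n z
        using P_bound[of n z] b[OF that] by (meson exp_le_cancel_iff mult_left_mono order_trans zero_le_numeral)
      then show ?thesis by blast
    qed
    fix g and r :: "nat \<Rightarrow> nat"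
    assume "g holomorphic_on UNIV" "strict_mono r" "\<And>x. x \<in> UNIV \<Longrightarrow> (\<lambda>n. P (r n) x) \<longlonglongrightarrow> g x"
    then show "\<exists>g r. g holomorphic_on UNIV \<and> strict_mono (r :: nat \<Rightarrow> nat) \<and> (\<forall>z. (\<lambda>n. P (r n) z) \<longlonglongrightarrow> g z)"
      by blast
  qed (use P_holo in auto)
  then obtain g r where g: "g holomorphic_on UNIV" and r: "strict_mono (r :: nat \<Rightarrow> nat)"
    and lim: "\<And>z. (\<lambda>n. P (r n) z) \<longlonglongrightarrow> g z" by blast
  have e_lim: "e \<longlonglongrightarrow> 0"
  proof (rule tendsto_sandwich[OF always_eventually always_eventually tendsto_const])
    show "(\<lambda>n. 1 / real (Suc n)) \<longlonglongrightarrow> 0" using LIMSEQ_inverse_real_of_nat by (simp only: inverse_eq_divide)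
    show "\<forall>n. 0 \<le> e n" using e0 less_imp_le by blast
    show "\<forall>n. e n \<le> 1 / real (Suc n)" using xs(3) unfolding e_def by blast
  qed
  \<comment> \<open>Dilation keeps the ray through \<open>z\<close>, so one cone contains all
    \<open>\<zeta> n z\<close>, and these tend to infinity.\<close>
  have m_lim: "(\<lambda>n. cmod (m (\<zeta> n z) - \<i>)) \<longlonglongrightarrow> 0" if z: "0 < Im z" for z
  proof (rule LIMSEQ_I)
    fix d :: real assume d: "0 < d"
    have z0: "0 < cmod z" using z by auto
    define \<sigma> where "\<sigma> = Im z / cmod z"
    have \<sigma>: "0 < \<sigma>" using z z0 by (simp add: \<sigma>_def)
    obtain R where R: "\<And>w. R \<le> cmod w \<and> 0 < cmod w \<and> \<sigma> * cmod w \<le> Im w \<Longrightarrow> cmod (m w - \<i>) < d"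
      using m \<sigma> d unfolding cone_tendsto_def by meson
    have "\<forall>\<^sub>F n in sequentially. e n < cmod z / (\<bar>R\<bar> + 1)"
      using z0 by (intro order_tendstoD(2)[OF e_lim] divide_pos_pos) auto
    then obtain n0 where n0: "\<And>n. n \<ge> n0 \<Longrightarrow> e n < cmod z / (\<bar>R\<bar> + 1)"
      unfolding eventually_sequentially by blast
    show "\<exists>no. \<forall>n\<ge>no. norm (cmod (m (\<zeta> n z) - \<i>) - 0) < d"
    proof (intro exI allI impI)
      fix n assume "n0 \<le> n"
      then have "(\<bar>R\<bar> + 1) * e n < cmod z" using n0[of n] by (simp add: field_simps)
      then have "\<bar>R\<bar> + 1 < cmod (\<zeta> n z)" using e0[of n] by (simp add: \<zeta>_def norm_divide field_simps)
      then have "cmod (m (\<zeta> n z) - \<i>) < d"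
        using e0[of n] z0 by (intro R) (auto simp: \<zeta>_def \<sigma>_def norm_divide)
      then show "norm (cmod (m (\<zeta> n z) - \<i>) - 0) < d" by simp
    qed
  qed
  have g_real: "2 \<le> cmod (g (of_real s))" for s
  proof (rule tendsto_lowerbound[OF tendsto_norm[OF lim]])
    show "\<forall>\<^sub>F n in sequentially. 2 \<le> cmod (P (r n) (of_real s))"
      unfolding P_def by (intro always_eventually allI p0_real_lower x0 xs(2)) (simp add: \<zeta>_def)
  qed simp
  have Im_\<zeta>: "0 < Im (\<zeta> n z)" if "0 < Im z" for n z
    using that e0[of n] by (simp add: \<zeta>_def)
  \<comment> \<open>The term with \<open>m - \<i>\<close> in \<open>p0_lower\<close> disappears in
    the limit.\<close>
  have g_lower: "exp (- 1 * cmod z) \<le> cmod (g z)" if z: "0 < Im z" for z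
  proof -
    have "(\<lambda>n. exp (cmod z) * (cmod (P (r n) z) + 2 * exp (cmod z) * cmod (m (\<zeta> (r n) z) - \<i>)))
        \<longlonglongrightarrow> exp (cmod z) * (cmod (g z) + 2 * exp (cmod z) * 0)"
      using LIMSEQ_subseq_LIMSEQ[OF m_lim[OF z] r] by (intro tendsto_intros lim) (simp add: comp_def)
    then have "1 \<le> exp (cmod z) * (cmod (g z) + 2 * exp (cmod z) * 0)"
    proof (rule tendsto_lowerbound[OF _ always_eventually])
      have "1 \<le> exp (cmod z) * (cmod (P n z) + 2 * exp (cmod z) * cmod (m (\<zeta> n z) - \<i>))" for n
        using p0_lower[OF x0[of n] xs(2)[of n] Im_\<zeta>[OF z, of n]] unfolding P_def scale' .
      then show "\<forall>n. 1 \<le> exp (cmod z) * (cmod (P (r n) z) + 2 * exp (cmod z) * cmod (m (\<zeta> (r n) z) - \<i>))"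
        by blast
    qed simp
    then show ?thesis by (simp add: exp_minus field_simps)
  qed
  have g_0: "cmod (g z - (2 * \<i> - z)) \<le> 2 * exp 1 * (cmod z)\<^sup>2" if "cmod z \<le> 1" for z
  proof (rule tendsto_upperbound[OF tendsto_norm[OF tendsto_diff[OF lim tendsto_const]]])
    have "\<zeta> n z * of_real (\<eta> (xs n)) = z" for n using e0[of n] by (simp add: \<zeta>_def flip: e_def)
    then show "\<forall>\<^sub>F n in sequentially. cmod (P (r n) z - (2 * \<i> - z)) \<le> 2 * exp 1 * (cmod z)\<^sup>2"
      using p0_at_0[OF x0 xs(2), of "\<zeta> _ z"] that unfolding scale' P_def
      by (intro always_eventually allI) (metis scale')
  qed simp
  \<comment> \<open>Budget for the final estimate: \<theta> and \<open>2 / y\<close> take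
    \<open>\<epsilon> / 4\<close> each, half of \<open>D ln 4 / y\<close> and
    \<open>D \<beta>\<close> take \<open>\<epsilon> / 8\<close> each. Here \<beta> is the distance
    of \<alpha> from the critical rate 1/2, and \<open>Y0\<close> makes \<open>y\<close> large
    enough for the two terms with \<open>y\<close>.\<close>
  define \<theta> where "\<theta> = \<epsilon> / 4"
  define D where "D = 2 + 1 / \<theta>"
  have \<theta>: "0 < \<theta>" using \<epsilon> by (simp add: \<theta>_def)
  have D: "0 < D" using \<theta> by (simp add: D_def add_pos_pos)
  define \<beta> where "\<beta> = min (1 / 2) (\<epsilon> / (8 * D))"
  have \<beta>: "0 < \<beta>" "\<beta> \<le> 1 / 2" using \<epsilon> D by (auto simp: \<beta>_def)
  have D\<beta>: "D * \<beta> \<le> \<epsilon> / 8"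
  proof -
    have "\<beta> \<le> \<epsilon> / (8 * D)" by (simp add: \<beta>_def)
    then show ?thesis using D by (simp add: field_simps)
  qed
  define \<alpha> where "\<alpha> = 1 / 2 - \<beta>"
  define Y0 where "Y0 = 1 + 8 / \<epsilon> + 4 * D * ln 4 / \<epsilon>"
  obtain y where y: "Y0 \<le> y" "cmod (g (\<i> * of_real y)) < 2 * exp (- \<alpha> * y)"
    using small_value_on_imaginary_axis[OF g g_real g_lower _ g_0, of \<alpha> Y0] \<beta> by (auto simp: \<alpha>_def)
  have ln4: "0 \<le> ln (4 :: real)" by simp
  have parts: "0 \<le> 8 / \<epsilon>" "0 \<le> 4 * D * ln 4 / \<epsilon>" using \<epsilon> D ln4 by auto
  have y0: "0 < y" using y(1) parts unfolding Y0_def by linarith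
  have "8 / \<epsilon> \<le> y" "4 * D * ln 4 / \<epsilon> \<le> y" using y(1) parts unfolding Y0_def by linarith+
  then have y8: "2 / y \<le> \<epsilon> / 4" and yD: "D * ln 4 / y \<le> \<epsilon> / 4"
    using \<epsilon> y0 by (simp_all add: field_simps)
  define z where "z = \<i> * complex_of_real y"
  have z: "0 < Im z" "cmod z = y" using y0 by (simp_all add: z_def norm_mult)
  \<comment> \<open>Back to the Weyl solution, for which the decay is needed; at the single point
    \<open>z\<close> it has the same limit as \<open>P n z\<close>.\<close>
  define W where "W n = vw (\<zeta> n z) (xs n) + \<i> * uw (\<zeta> n z) (xs n)" for n
  have W_P: "cmod (W n - P n z) \<le> cmod (m (\<zeta> n z) - \<i>) * (2 * exp y)" for n
  proof -
    have b2: "cmod (u2 (\<zeta> n z) (xs n)) \<le> exp y" "cmod (v2 (\<zeta> n z) (xs n)) \<le> exp y"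
      using solution_bound[OF sol2[of "\<zeta> n z"] x0 xs(2), of 1 n] by (simp_all add: init scale' z)
    have "W n - P n z = (m (\<zeta> n z) - \<i>) * (v2 (\<zeta> n z) (xs n) + \<i> * u2 (\<zeta> n z) (xs n))"
      by (simp add: W_def P_def p0_def u0_def v0_def uw_def vw_def algebra_simps)
    also have "cmod \<dots> \<le> cmod (m (\<zeta> n z) - \<i>) * (2 * exp y)"
      unfolding norm_mult
      using b2 norm_triangle_ineq[of "v2 (\<zeta> n z) (xs n)" "\<i> * u2 (\<zeta> n z) (xs n)"]
      by (intro mult_left_mono) (auto simp: norm_mult)
    finally show ?thesis .
  qed
  have "(\<lambda>n. W (r n)) \<longlonglongrightarrow> g z"
  proof -
    have "(\<lambda>n. W n - P n z) \<longlonglongrightarrow> 0"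
      by (rule Lim_null_comparison[OF always_eventually tendsto_mult_left_zero[OF m_lim[OF z(1)]]]) (use W_P in blast)
    from LIMSEQ_subseq_LIMSEQ[OF this r] have "(\<lambda>n. W (r n) - P (r n) z) \<longlonglongrightarrow> 0"
      by (simp only: comp_def)
    then have "(\<lambda>n. (W (r n) - P (r n) z) + P (r n) z) \<longlonglongrightarrow> 0 + g z"
      by (intro tendsto_add lim)
    then show ?thesis by simp
  qed
  then have "\<forall>\<^sub>F n in sequentially. cmod (W (r n)) < 2 * exp (- \<alpha> * y)"
    using order_tendstoD(2)[OF tendsto_norm] y(2) by (fastforce simp: z_def)
  then obtain n where n: "cmod (W (r n)) < 2 * exp (- \<alpha> * y)"
    using eventually_happens trivial_limit_sequentially by blast
  define k where "k = r n"
  define x where "x = xs k"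
  have x: "0 < x" "x \<le> X" "0 \<le> x" using xs x0 by (simp_all add: x_def)
  have zx: "\<i> * of_real (y / \<eta> x) = \<zeta> k z" by (simp add: z_def \<zeta>_def x_def e_def)
  let ?z = "\<zeta> k z"
  \<comment> \<open>As \<open>|q| <= |p|\<close>, the value \<open>|W|\<close> alone controls the
    norm at \<open>x\<close>; the squared norm at 0 is \<open>1 + |m|^2\<close>, at least 1.\<close>
  have decay: "(cmod (uw ?z x))\<^sup>2 + (cmod (vw ?z x))\<^sup>2 \<le> 4 * exp (- 2 * \<alpha> * y) * ((cmod (uw ?z 0))\<^sup>2 + (cmod (vw ?z 0))\<^sup>2)"
  proof -
    have Wk: "W k = vw ?z x + \<i> * uw ?z x" by (simp add: W_def x_def)
    have "0 \<le> 4 * Im (cnj (uw ?z x) * vw ?z x)"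
      using weyl_nonneg[OF Im_\<zeta>[OF z(1)] x(3,2)] by simp
    then have "2 * ((cmod (uw ?z x))\<^sup>2 + (cmod (vw ?z x))\<^sup>2) \<le> 2 * (cmod (W k))\<^sup>2"
      unfolding Wk using pq_norm_sq[of "vw ?z x" "uw ?z x"] pq_norm_diff[of "vw ?z x" "uw ?z x"] by linarith
    also have "(cmod (W k))\<^sup>2 \<le> (2 * exp (- \<alpha> * y))\<^sup>2" using n by (intro power_mono) (auto simp: k_def)
    also have "(2 * exp (- \<alpha> * y))\<^sup>2 = 4 * exp (- 2 * \<alpha> * y)" by (simp add: power_mult_distrib flip: exp_double)
    finally have "(cmod (uw ?z x))\<^sup>2 + (cmod (vw ?z x))\<^sup>2 \<le> 4 * exp (- 2 * \<alpha> * y) * 1" by simp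
    also have "\<dots> \<le> 4 * exp (- 2 * \<alpha> * y) * ((cmod (uw ?z 0))\<^sup>2 + (cmod (vw ?z 0))\<^sup>2)"
      by (intro mult_left_mono) auto
    finally show ?thesis .
  qed
  have "cmod (K x) \<le> (2 / y + (2 + 1 / \<theta>) * ((ln 4 / y + (1 - 2 * \<alpha>)) / 2) + \<theta>) * \<eta> x"
    by (rule K_bound_step[OF x(1,2) y0 \<theta>]) (unfold zx, rule decay)
  also have "\<dots> \<le> \<epsilon> * \<eta> x"
  proof (rule mult_right_mono)
    have eq: "(2 + 1 / \<theta>) * ((ln 4 / y + (1 - 2 * \<alpha>)) / 2) = (D * ln 4 / y) / 2 + D * \<beta>"
      by (simp add: D_def[symmetric] \<alpha>_def algebra_simps add_divide_distrib)
    have sum: "p + (q / 2 + s) + t \<le> e" if "p \<le> e / 4" "q \<le> e / 4" "s \<le> e / 8" "t = e / 4" "0 < e" for p q s t e :: real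
      using that by linarith
    have "2 / y + (D * ln 4 / y / 2 + D * \<beta>) + \<theta> \<le> \<epsilon>"
      by (rule sum[OF y8 yD D\<beta> \<theta>_def \<epsilon>])
    then show "2 / y + (2 + 1 / \<theta>) * ((ln 4 / y + (1 - 2 * \<alpha>)) / 2) + \<theta> \<le> \<epsilon>"
      by (simp only: eq)
    show "0 \<le> \<eta> x" using eta_pos[OF x(1,2)] by simp
  qed
  finally show False using xs(4)[of k] by (simp add: x_def)
qed

end

section \<open>Square integrable solutions and changes of coordinates\<close>

lemma primitive_on_le_between:
  fixes f g :: "real \<Rightarrow> real"
  assumes "primitive_on X f f'" "primitive_on X g g'" "0 \<le> x" "x \<le> y" "y \<le> X"
    and "\<And>s. x \<le> s \<Longrightarrow> s \<le> y \<Longrightarrow> f' s \<le> g' s"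
  shows "f y - f x \<le> g y - g x"
proof -
  have "integral {x..y} f' \<le> integral {x..y} g'"
    using assms(6) primitive_on_int[OF assms(1,3,5)] primitive_on_int[OF assms(2,3,5)]
    by (intro integral_le) auto
  then show ?thesis
    using primitive_on_diff_eq[OF assms(1,3-5)] primitive_on_diff_eq[OF assms(2,3-5)] by simp
qed

section \<open>The limit point argument\<close>

context canonical_system
begin

lemma quadratic_nonneg: "0 \<le> a x * p\<^sup>2 + 2 * b x * (p * q) + c x * q\<^sup>2"
  using energy_bounds(3)[of "\<lambda>_. of_real p" "\<lambda>_. of_real q" x] by (simp add: energy_def)

text \<open>Let \<open>G\<close> be the symmetric matrix with entries \<open>g1\<close>,
  \<open>g2\<close>, \<open>g2\<close>, \<open>g3\<close>: its determinant is
  \<open>W\<^sup>2\<close> and \<open>tr (H G)\<close> is the energy. Evaluating \<open>H\<close> on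
  the columns of \<open>G\<close> gives \<open>tr (H G^2) >= 0\<close>, and
  \<open>G^2 = (tr G) G - (det G) I\<close> by Cayley-Hamilton.\<close>

lemma energy_wronskian:
  "(a x + c x) * (Im (cnj (u x) * v x))\<^sup>2 \<le> energy u v x * ((cmod (u x))\<^sup>2 + (cmod (v x))\<^sup>2)"
proof -
  define g1 g2 g3 W where "g1 = (cmod (u x))\<^sup>2" and "g2 = Re (cnj (u x) * v x)" and "g3 = (cmod (v x))\<^sup>2"
    and "W = Im (cnj (u x) * v x)"
  have W: "W\<^sup>2 = g1 * g3 - g2\<^sup>2"
    unfolding g1_def g2_def g3_def W_def cmod_power2 by (simp add: power2_eq_square algebra_simps)
  have E: "energy u v x = a x * g1 + 2 * b x * g2 + c x * g3"
    by (simp add: energy_def g1_def g2_def g3_def)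
  have "0 \<le> (a x * g1\<^sup>2 + 2 * b x * (g1 * g2) + c x * g2\<^sup>2) + (a x * g2\<^sup>2 + 2 * b x * (g2 * g3) + c x * g3\<^sup>2)"
    by (intro add_nonneg_nonneg quadratic_nonneg)
  also have "\<dots> = (a x * g1 + 2 * b x * g2 + c x * g3) * (g1 + g3) - (a x + c x) * (g1 * g3 - g2\<^sup>2)"
    by (simp add: power2_eq_square algebra_simps)
  finally have "(a x + c x) * W\<^sup>2 \<le> energy u v x * (g1 + g3)" unfolding W E by simp
  then show ?thesis by (simp add: W_def g1_def g3_def)
qed

lemma energy_primitive':
  assumes "solution z u v"
  shows "primitive_on X (\<lambda>x. integral {0..x} (energy u v)) (energy u v)"
  by (rule primitive_on_integral[OF energy_absint[OF assms]])

text \<open>Each component moves at speed at most \<open>|z| sqrt (t E)\<close>, with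
  \<open>t\<close> the trace and \<open>E\<close> the energy, and Cauchy-Schwarz would give growth
  of order \<open>sqrt (\<eta> M)\<close>. The weight
  \<open>\<nu> = 1 / sqrt (1 + \<eta> x)\<close>, fixed by the endpoint, has the same
  effect.\<close>

lemma sqrt_growth:
  assumes sol: "solution z u v" and x: "0 \<le> x" "x \<le> X" and M: "integral {0..x} (energy u v) \<le> M"
    and G: "cmod (u 0) + cmod z * (1 + M) / 2 \<le> G" "cmod (v 0) + cmod z * (1 + M) / 2 \<le> G"
  shows "(cmod (u x))\<^sup>2 + (cmod (v x))\<^sup>2 \<le> 2 * G\<^sup>2 * (1 + \<eta> x)"
proof -
  have eta0: "0 \<le> \<eta> x" using eta_mono[of 0 x] x by simp
  define r where "r = sqrt (1 + \<eta> x)"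
  have r1: "1 \<le> r" and r2: "r\<^sup>2 = 1 + \<eta> x" using eta0 by (simp_all add: r_def)
  define \<nu> where "\<nu> = 1 / r"
  have \<nu>: "0 < \<nu>" using r1 by (simp add: \<nu>_def)
  have E0: "0 \<le> integral {0..x} (energy u v)"
    by (rule integral_nonneg[OF primitive_on_int[OF energy_primitive'[OF sol] order.refl x(2)]]) (rule energy_bounds(3))
  then have M0: "0 \<le> M" using M by simp
  have est: "cmod (f x) \<le> G * r"
    if f: "primitive_on X f (\<lambda>s. w * g s)" "cmod w = cmod z" "\<And>s. cmod (g s) \<le> \<nu> / 2 * (a s + c s) + energy u v s / (2 * \<nu>)"
      and Gf: "cmod (f 0) + cmod z * (1 + M) / 2 \<le> G" for f g w
  proof -
    have "cmod (f x - f 0) \<le> cmod z * (\<nu> / 2 * \<eta> x + 1 / (2 * \<nu>) * integral {0..x} (energy u v))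
          - cmod z * (\<nu> / 2 * \<eta> 0 + 1 / (2 * \<nu>) * integral {0..0} (energy u v))"
    proof (rule primitive_on_norm_le[OF primitive_on_mono[OF f(1) x(2)] _ x(1)])
      show "primitive_on x (\<lambda>\<tau>. cmod z * (\<nu> / 2 * \<eta> \<tau> + 1 / (2 * \<nu>) * integral {0..\<tau>} (energy u v)))
        (\<lambda>s. cmod z * (\<nu> / 2 * (a s + c s) + 1 / (2 * \<nu>) * energy u v s))"
        by (intro primitive_on_cmult primitive_on_add primitive_on_mono[OF energy_primitive'[OF sol] x(2)] primitive_on_mono[OF eta_primitive x(2)])
      fix s
      show "norm (w * g s) \<le> cmod z * (\<nu> / 2 * (a s + c s) + 1 / (2 * \<nu>) * energy u v s)"
        using mult_left_mono[OF f(3)[of s], of "cmod z"] by (simp add: norm_mult f(2))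
    qed
    also have "\<dots> = cmod z * (\<nu> / 2 * \<eta> x + 1 / (2 * \<nu>) * integral {0..x} (energy u v))" by simp
    also have "\<dots> \<le> cmod z * (r / 2 + r / 2 * M)"
    proof (intro mult_left_mono add_mono)
      have "\<eta> x \<le> r * r" using r2 by (simp add: power2_eq_square)
      then show "\<nu> / 2 * \<eta> x \<le> r / 2" using r1 by (simp add: \<nu>_def field_simps)
      show "1 / (2 * \<nu>) * integral {0..x} (energy u v) \<le> r / 2 * M"
        using M r1 by (simp add: \<nu>_def mult_left_mono)
    qed simp
    also have "\<dots> = cmod z * (1 + M) / 2 * r" by (simp add: field_simps)
    finally have "cmod (f x) \<le> cmod (f 0) + cmod z * (1 + M) / 2 * r"
      using norm_triangle_sub[of "f x" "f 0"] by simp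
    also have "cmod (f 0) \<le> cmod (f 0) * r" using r1 by (simp add: mult_le_cancel_left1)
    also have "cmod (f 0) * r + cmod z * (1 + M) / 2 * r = (cmod (f 0) + cmod z * (1 + M) / 2) * r"
      by (simp add: distrib_right)
    also have "\<dots> \<le> G * r" using Gf r1 by (intro mult_right_mono) auto
    finally show ?thesis by simp
  qed
  have "cmod (u x) \<le> G * r"
    using est[OF sol[unfolded solution_def, THEN conjunct1] refl energy_bound_weighted(1)[OF \<nu>] G(1)] .
  moreover have "cmod (v x) \<le> G * r"
    using est[OF sol[unfolded solution_def, THEN conjunct2] _ energy_bound_weighted(2)[OF \<nu>] G(2)] by simp
  ultimately have "(cmod (u x))\<^sup>2 + (cmod (v x))\<^sup>2 \<le> (G * r)\<^sup>2 + (G * r)\<^sup>2"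
    by (intro add_mono power_mono) auto
  also have "\<dots> = 2 * G\<^sup>2 * (1 + \<eta> x)" unfolding power_mult_distrib r2 by simp
  finally show ?thesis .
qed

text \<open>The limit point argument: the energy dominates \<open>t W\<^sup>2 / (|u|\<^sup>2 + |v|\<^sup>2)\<close> with \<open>W = Im (cnj u v)\<close>, and a
  solution of finite energy grows at most like the square root of \<open>\<eta>\<close>. Once \<open>W\<close> is negative it stays
  away from \<open>0\<close>, and the energy is at least of logarithmic size.\<close>

lemma eta_log_bound:
  assumes sol: "solution z u v" and z: "0 < Im z" and M: "integral {0..X} (energy u v) \<le> M"
    and G: "cmod (u 0) + cmod z * (1 + M) / 2 \<le> G" "cmod (v 0) + cmod z * (1 + M) / 2 \<le> G" "0 < G"
    and x: "0 \<le> x" "x \<le> X" and w: "0 < w" "Im (cnj (u x) * v x) \<le> - w"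
  shows "ln (1 + \<eta> X) \<le> ln (1 + \<eta> x) + 2 * G\<^sup>2 * M / w\<^sup>2"
proof -
  note prE = energy_primitive'[OF sol]
  have E_nonneg: "0 \<le> integral {s..t} (energy u v)" if "0 \<le> s" "t \<le> X" for s t
    by (rule integral_nonneg[OF primitive_on_int[OF prE that]]) (rule energy_bounds(3))
  have split: "integral {0..t} (energy u v) - integral {0..s} (energy u v) = integral {s..t} (energy u v)" if "0 \<le> s" "s \<le> t" "t \<le> X" for s t
    using primitive_on_diff_eq[OF prE that] .
  have M': "integral {0..s} (energy u v) \<le> M" if "0 \<le> s" "s \<le> X" for s
    using split[of s X] E_nonneg[of s X] that M by auto
  \<comment> \<open>The energy will be at least \<open>k t / (1 + \<eta>)\<close> pointwise, with
    \<open>t\<close> the trace, and this integrates to a logarithm.\<close>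
  define k where "k = w\<^sup>2 / (2 * G\<^sup>2)"
  have k: "0 < k" using w G by (simp add: k_def)
  have prln: "primitive_on X (\<lambda>s. ln (1 + \<eta> s)) (\<lambda>s. (a s + c s) / (1 + \<eta> s))"
  proof (rule primitive_on_ln)
    show "primitive_on X (\<lambda>s. 1 + \<eta> s) (\<lambda>s. a s + c s)"
      using primitive_on_add[OF primitive_on_const eta_primitive, of 1] by simp
    show "0 \<le> X" using X_pos by simp
    show "0 < 1 + \<eta> s" if "0 \<le> s" "s \<le> X" for s using eta_mono[of 0 s] that by simp
  qed
  have "k * ln (1 + \<eta> X) - k * ln (1 + \<eta> x) \<le> integral {0..X} (energy u v) - integral {0..x} (energy u v)"
  proof (rule primitive_on_le_between[OF primitive_on_cmult[OF prln] prE x order.refl])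
    fix s assume s: "x \<le> s" "s \<le> X"
    then have s0: "0 \<le> s" using x by simp
    have eta0: "0 \<le> \<eta> s" using eta_mono[of 0 s] s s0 by simp
    have "Im (cnj (u s) * v s) - Im (cnj (u x) * v x) = integral {x..s} (\<lambda>t. - Im z * energy u v t)"
      by (rule primitive_on_diff_eq[OF energy_primitive[OF sol] x(1) s])
    also have "\<dots> = - Im z * integral {x..s} (energy u v)" by (rule integral_mult_right)
    also have "\<dots> \<le> 0" using z E_nonneg[OF x(1) s(2)] by simp
    finally have "w \<le> - Im (cnj (u s) * v s)" using w by simp
    then have "w\<^sup>2 \<le> (- Im (cnj (u s) * v s))\<^sup>2" by (rule power_mono) (use w in simp)
    then have "w\<^sup>2 \<le> (Im (cnj (u s) * v s))\<^sup>2" by (simp only: power2_minus)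
    then have "(a s + c s) * w\<^sup>2 \<le> (a s + c s) * (Im (cnj (u s) * v s))\<^sup>2"
      by (rule mult_left_mono) (use trace_pos[of s] in simp)
    also have "\<dots> \<le> energy u v s * ((cmod (u s))\<^sup>2 + (cmod (v s))\<^sup>2)" by (rule energy_wronskian)
    also have "\<dots> \<le> energy u v s * (2 * G\<^sup>2 * (1 + \<eta> s))"
      using sqrt_growth[OF sol s0 s(2) M'[OF s0 s(2)] G(1,2)] energy_bounds(3) by (rule mult_left_mono)
    finally have "(a s + c s) * w\<^sup>2 \<le> energy u v s * (2 * G\<^sup>2 * (1 + \<eta> s))" .
    moreover have "0 < 2 * G\<^sup>2 * (1 + \<eta> s)" using G eta0 by simp
    ultimately have "(a s + c s) * w\<^sup>2 / (2 * G\<^sup>2 * (1 + \<eta> s)) \<le> energy u v s" by (simp add: divide_le_eq)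
    moreover have "k * ((a s + c s) / (1 + \<eta> s)) = (a s + c s) * w\<^sup>2 / (2 * G\<^sup>2 * (1 + \<eta> s))"
      by (simp add: k_def)
    ultimately show "k * ((a s + c s) / (1 + \<eta> s)) \<le> energy u v s" by simp
  qed
  also have "\<dots> \<le> M" using M E_nonneg[of 0 x] x by simp
  finally have "k * (ln (1 + \<eta> X) - ln (1 + \<eta> x)) \<le> M" by (simp add: right_diff_distrib)
  then have "ln (1 + \<eta> X) - ln (1 + \<eta> x) \<le> M / k" using k by (simp add: le_divide_eq mult.commute)
  also have "M / k = 2 * G\<^sup>2 * M / w\<^sup>2" by (simp add: k_def)
  finally show ?thesis by simp
qed

text \<open>Congruence of \<open>H\<close> by the real matrix with rows \<open>(1, 0)\<close> and
  \<open>(x0, y0)\<close>, divided by its determinant \<open>y0\<close> so that \<open>J\<close> is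
  preserved. The determinant of \<open>H\<close> does not change.\<close>

lemma canonical_system_shift:
  fixes x0 y0 :: real
  assumes "0 < y0"
  shows "canonical_system X (\<lambda>s. (a s + 2 * x0 * b s + x0\<^sup>2 * c s) / y0) (\<lambda>s. b s + x0 * c s) (\<lambda>s. y0 * c s)"
proof
  show "0 < X" by (rule X_pos)
  show "(\<lambda>s. (a s + 2 * x0 * b s + x0\<^sup>2 * c s) / y0) absolutely_integrable_on {0..X}"
    unfolding add_divide_distrib using abs_int by (intro set_integral_add) auto
  show "(\<lambda>s. b s + x0 * c s) absolutely_integrable_on {0..X}" using abs_int by (intro set_integral_add) auto
  show "(\<lambda>s. y0 * c s) absolutely_integrable_on {0..X}" using abs_int by auto
next
  fix s
  have q: "0 \<le> a s + 2 * x0 * b s + x0\<^sup>2 * c s" using quadratic_nonneg[of s 1 x0] by (simp add: mult_ac)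
  then show "0 \<le> (a s + 2 * x0 * b s + x0\<^sup>2 * c s) / y0" using assms by simp
  show "0 \<le> y0 * c s" using assms nonneg by simp
  have "(a s + 2 * x0 * b s + x0\<^sup>2 * c s) * c s - (b s + x0 * c s)\<^sup>2 = a s * c s - (b s)\<^sup>2"
    by (simp add: power2_eq_square algebra_simps)
  then show "(b s + x0 * c s)\<^sup>2 \<le> (a s + 2 * x0 * b s + x0\<^sup>2 * c s) / y0 * (y0 * c s)"
    using det_nonneg[of s] assms by simp
  \<comment> \<open>The new trace could degenerate only where \<open>c\<close> vanishes; there
    \<open>b\<close> vanishes too and \<open>a\<close> is positive.\<close>
  show "0 < (a s + 2 * x0 * b s + x0\<^sup>2 * c s) / y0 + y0 * c s"
  proof (cases "c s = 0")
    case True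
    then have "b s = 0" "0 < a s" using det_nonneg[of s] trace_pos[of s] by auto
    then show ?thesis using True assms by simp
  next
    case False
    then have "0 < y0 * c s" using nonneg(2)[of s] assms by simp
    then show ?thesis using q assms by (simp add: add_nonneg_pos)
  qed
qed

end

context weyl_family
begin

text \<open>The second component becomes \<open>(v - x0 u) / y0\<close>. Initial values
  \<open>(1, x0)\<close> and \<open>(0, y0)\<close> turn into the unit vectors, which dictates the
  new columns, and \<open>Im (cnj u v)\<close> is merely divided by \<open>y0\<close> because
  \<open>x0\<close> is real.\<close>

lemma weyl_family_shift:
  fixes x0 y0 :: real
  assumes y0: "0 < y0"
  shows "weyl_family X (\<lambda>s. (a s + 2 * x0 * b s + x0\<^sup>2 * c s) / y0) (\<lambda>s. b s + x0 * c s) (\<lambda>s. y0 * c s)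
    (\<lambda>z s. u1 z s + of_real x0 * u2 z s)
    (\<lambda>z s. ((v1 z s + of_real x0 * v2 z s) - of_real x0 * (u1 z s + of_real x0 * u2 z s)) / of_real y0)
    (\<lambda>z s. of_real y0 * u2 z s) (\<lambda>z s. (of_real y0 * v2 z s - of_real x0 * (of_real y0 * u2 z s)) / of_real y0)
    (\<lambda>z. (m z - of_real x0) / of_real y0)"
proof -
  interpret T: canonical_system X "\<lambda>s. (a s + 2 * x0 * b s + x0\<^sup>2 * c s) / y0" "\<lambda>s. b s + x0 * c s" "\<lambda>s. y0 * c s"
    by (rule canonical_system_shift[OF y0])
  have shift: "T.solution z u (\<lambda>s. (v s - of_real x0 * u s) / of_real y0)" if sol: "solution z u v" for z u v
    unfolding T.solution_def
  proof
    note s = sol[unfolded solution_def]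
    show "primitive_on X u (\<lambda>x. z * (of_real (b x + x0 * c x) * u x + of_real (y0 * c x) * ((v x - of_real x0 * u x) / of_real y0)))"
      by (rule primitive_on_cong[OF s[THEN conjunct1]]) (use y0 in \<open>simp_all add: field_simps\<close>)
    have "primitive_on X (\<lambda>x. (1 / of_real y0) * (v x - of_real x0 * u x))
      (\<lambda>x. (1 / of_real y0) * (- z * (of_real (a x) * u x + of_real (b x) * v x) - of_real x0 * (z * (of_real (b x) * u x + of_real (c x) * v x))))"
      using s by (intro primitive_on_cmult primitive_on_diff) auto
    then show "primitive_on X (\<lambda>s. (v s - of_real x0 * u s) / of_real y0)
      (\<lambda>x. - z * (of_real ((a x + 2 * x0 * b x + x0\<^sup>2 * c x) / y0) * u x + of_real (b x + x0 * c x) * ((v x - of_real x0 * u x) / of_real y0)))"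
      by (rule primitive_on_cong) (use y0 in \<open>simp_all add: power2_eq_square field_simps\<close>)
  qed
  show ?thesis
  proof
    show "T.solution z (\<lambda>s. u1 z s + of_real x0 * u2 z s)
        (\<lambda>s. ((v1 z s + of_real x0 * v2 z s) - of_real x0 * (u1 z s + of_real x0 * u2 z s)) / of_real y0)" for z
      using shift[OF solution_linear[OF sol1[of z] sol2[of z], of 1 "of_real x0"]] by simp
    show "T.solution z (\<lambda>s. of_real y0 * u2 z s)
        (\<lambda>s. (of_real y0 * v2 z s - of_real x0 * (of_real y0 * u2 z s)) / of_real y0)" for z
      using shift[OF solution_linear[OF sol1[of z] sol2[of z], of 0 "of_real y0"]] by simp
    show "u1 z 0 + of_real x0 * u2 z 0 = 1"
      "((v1 z 0 + of_real x0 * v2 z 0) - of_real x0 * (u1 z 0 + of_real x0 * u2 z 0)) / of_real y0 = 0"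
      "of_real y0 * u2 z 0 = 0" "(of_real y0 * v2 z 0 - of_real x0 * (of_real y0 * u2 z 0)) / of_real y0 = 1" for z
      using y0 by (simp_all add: init)
  next
    fix z x assume z: "0 < Im z" "0 \<le> x" "x \<le> X"
    have U: "u1 z x + of_real x0 * u2 z x + (m z - of_real x0) / of_real y0 * (of_real y0 * u2 z x) = uw z x"
      using y0 by (simp add: uw_def field_simps)
    have V: "((v1 z x + of_real x0 * v2 z x) - of_real x0 * (u1 z x + of_real x0 * u2 z x)) / of_real y0
        + (m z - of_real x0) / of_real y0 * ((of_real y0 * v2 z x - of_real x0 * (of_real y0 * u2 z x)) / of_real y0)
        = (vw z x - of_real x0 * uw z x) / of_real y0"
      using y0 by (simp add: uw_def vw_def field_simps)
    have "Im (cnj (uw z x) * ((vw z x - of_real x0 * uw z x) / of_real y0)) = Im (cnj (uw z x) * vw z x) / y0"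
      by (simp add: algebra_simps diff_divide_distrib)
    then show "0 \<le> Im (cnj (u1 z x + of_real x0 * u2 z x + (m z - of_real x0) / of_real y0 * (of_real y0 * u2 z x))
       * (((v1 z x + of_real x0 * v2 z x) - of_real x0 * (u1 z x + of_real x0 * u2 z x)) / of_real y0
        + (m z - of_real x0) / of_real y0 * ((of_real y0 * v2 z x - of_real x0 * (of_real y0 * u2 z x)) / of_real y0)))"
      unfolding U V using weyl_nonneg[OF z] y0 by simp
  qed
qed

end

text \<open>\<open>Im z = |z| sin (Arg z)\<close> links the slope of the cone to the angles of the
  sector.\<close>

lemma sector_tendsto_iff_cone: "sector_tendsto m \<zeta> \<longleftrightarrow> cone_tendsto m \<zeta>"
proof
  assume S: "sector_tendsto m \<zeta>"
  show "cone_tendsto m \<zeta>"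
    unfolding cone_tendsto_def
  proof (intro allI impI)
    fix \<sigma> \<epsilon> :: real assume \<sigma>: "0 < \<sigma>" and \<epsilon>: "0 < \<epsilon>"
    \<comment> \<open>For \<sigma> above 1 the cone is empty; the minimum with 1 keeps the arcsine
      meaningful.\<close>
    define \<delta> where "\<delta> = arcsin (min \<sigma> 1)"
    have \<sigma>1: "0 < min \<sigma> 1" "min \<sigma> 1 \<le> 1" using \<sigma> by auto
    have sin\<delta>: "sin \<delta> = min \<sigma> 1" unfolding \<delta>_def using \<sigma>1 by (intro sin_arcsin) auto
    have \<delta>: "0 < \<delta>" "\<delta> \<le> pi / 2"
      using arcsin_less_arcsin[of 0 "min \<sigma> 1"] arcsin_ubound[of "min \<sigma> 1"] \<sigma>1 by (auto simp: \<delta>_def)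
    have "(m \<longlongrightarrow> \<zeta>) (inf at_infinity (principal (closed_sector \<delta> (pi - \<delta>))))"
      using S \<delta> unfolding sector_tendsto_def by auto
    then have "\<forall>\<^sub>F z in inf at_infinity (principal (closed_sector \<delta> (pi - \<delta>))). dist (m z) \<zeta> < \<epsilon>"
      using \<epsilon> by (rule tendstoD)
    then obtain R where R: "\<And>z. R \<le> norm z \<Longrightarrow> z \<in> closed_sector \<delta> (pi - \<delta>) \<Longrightarrow> dist (m z) \<zeta> < \<epsilon>"
      unfolding eventually_inf_principal eventually_at_infinity by blast
    show "\<exists>R. \<forall>z. R \<le> cmod z \<and> 0 < cmod z \<and> \<sigma> * cmod z \<le> Im z \<longrightarrow> cmod (m z - \<zeta>) < \<epsilon>"
    proof (intro exI allI impI)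
      fix z assume z: "R \<le> cmod z \<and> 0 < cmod z \<and> \<sigma> * cmod z \<le> Im z"
      then have z0: "z \<noteq> 0" by auto
      have Imz: "0 < Im z" using z \<sigma> by (meson less_le_trans mult_pos_pos)
      have Arg: "0 < Arg z" "Arg z < pi" using Arg_lt_pi[of z] Imz by auto
      have Im_sin: "Im z = cmod z * sin (Arg z)" by (metis Im_rcis rcis_cmod_Arg)
      have "min \<sigma> 1 * cmod z \<le> cmod z * sin (Arg z)"
        using z Im_sin by (smt (verit) mult_right_mono norm_ge_zero)
      then have sinA: "sin \<delta> \<le> sin (Arg z)" using z by (simp add: sin\<delta> mult.commute)
      have "\<delta> \<le> Arg z"
      proof (rule ccontr)
        assume "\<not> \<delta> \<le> Arg z"
        then have "sin (Arg z) < sin \<delta>" using Arg \<delta> by (intro sin_monotone_2pi) auto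
        then show False using sinA by simp
      qed
      moreover have "Arg z \<le> pi - \<delta>"
      proof (rule ccontr)
        assume "\<not> Arg z \<le> pi - \<delta>"
        then have "sin (pi - Arg z) < sin \<delta>" using Arg \<delta> by (intro sin_monotone_2pi) auto
        then show False using sinA by simp
      qed
      ultimately have "z \<in> closed_sector \<delta> (pi - \<delta>)" using z0 by (simp add: closed_sector_def)
      then show "cmod (m z - \<zeta>) < \<epsilon>" using R[of z] z by (simp add: dist_norm)
    qed
  qed
next
  assume C: "cone_tendsto m \<zeta>"
  show "sector_tendsto m \<zeta>"
    unfolding sector_tendsto_def
  proof (intro allI impI tendstoI)
    fix \<delta>1 \<delta>2 \<epsilon> :: real
    assume \<delta>: "0 < \<delta>1 \<and> \<delta>1 \<le> \<delta>2 \<and> \<delta>2 < pi" and \<epsilon>: "0 < \<epsilon>"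
    \<comment> \<open>Between \<open>\<delta>1\<close> and \<open>\<delta>2\<close> the sine is
      smallest at an endpoint.\<close>
    define \<sigma> where "\<sigma> = min (sin \<delta>1) (sin \<delta>2)"
    have \<sigma>: "0 < \<sigma>" using \<delta> by (auto simp: \<sigma>_def intro!: sin_gt_zero)
    obtain R where R: "\<And>z. R \<le> cmod z \<and> 0 < cmod z \<and> \<sigma> * cmod z \<le> Im z \<Longrightarrow> cmod (m z - \<zeta>) < \<epsilon>"
      using C \<sigma> \<epsilon> unfolding cone_tendsto_def by meson
    have "dist (m z) \<zeta> < \<epsilon>" if z: "R \<le> norm z" "z \<in> closed_sector \<delta>1 \<delta>2" for z
    proof -
      have z0: "z \<noteq> 0" and A: "\<delta>1 \<le> Arg z" "Arg z \<le> \<delta>2" using z by (auto simp: closed_sector_def)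
      have Im_sin: "Im z = cmod z * sin (Arg z)" by (metis Im_rcis rcis_cmod_Arg)
      have "\<sigma> \<le> sin (Arg z)"
      proof (cases "Arg z \<le> pi / 2")
        case True
        then have "sin \<delta>1 \<le> sin (Arg z)" using \<delta> A by (intro sin_monotone_2pi_le) auto
        then show ?thesis by (simp add: \<sigma>_def)
      next
        case False
        then have "sin (pi - \<delta>2) \<le> sin (pi - Arg z)" using \<delta> A by (intro sin_monotone_2pi_le) auto
        then show ?thesis by (simp add: \<sigma>_def)
      qed
      then have "\<sigma> * cmod z \<le> Im z" unfolding Im_sin by (metis mult.commute mult_right_mono norm_ge_zero)
      then show ?thesis using R[of z] z z0 by (simp add: dist_norm)
    qed
    then show "\<forall>\<^sub>F z in inf at_infinity (principal (closed_sector \<delta>1 \<delta>2)). dist (m z) \<zeta> < \<epsilon>"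
      unfolding eventually_inf_principal eventually_at_infinity by blast
  qed
qed

lemma cone_tendsto_affine:
  fixes x0 y0 :: real
  assumes "0 < y0"
  shows "cone_tendsto (\<lambda>z. (m z - of_real x0) / of_real y0) w \<longleftrightarrow> cone_tendsto m (of_real x0 + of_real y0 * w)"
proof -
  have eq: "cmod ((m z - of_real x0) / of_real y0 - w) < \<epsilon> \<longleftrightarrow> cmod (m z - (of_real x0 + of_real y0 * w)) < y0 * \<epsilon>" for z \<epsilon>
  proof -
    have "(m z - of_real x0) / of_real y0 - w = (m z - (of_real x0 + of_real y0 * w)) / of_real y0"
      using assms by (simp add: field_simps)
    then have "cmod ((m z - of_real x0) / of_real y0 - w) = cmod (m z - (of_real x0 + of_real y0 * w)) / y0"
      using assms by (simp add: norm_divide)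
    then show ?thesis using assms by (simp add: divide_less_eq mult.commute)
  qed
  show ?thesis
    unfolding cone_tendsto_def eq
  proof (intro iffI allI impI)
    fix \<sigma> \<epsilon> :: real
    assume *: "\<forall>\<sigma>>0. \<forall>\<epsilon>>0. \<exists>R. \<forall>z. R \<le> cmod z \<and> 0 < cmod z \<and> \<sigma> * cmod z \<le> Im z \<longrightarrow>
        cmod (m z - (of_real x0 + of_real y0 * w)) < y0 * \<epsilon>" and "0 < \<sigma>" "0 < \<epsilon>"
    then show "\<exists>R. \<forall>z. R \<le> cmod z \<and> 0 < cmod z \<and> \<sigma> * cmod z \<le> Im z \<longrightarrow> cmod (m z - (of_real x0 + of_real y0 * w)) < \<epsilon>"
      using *[rule_format, of \<sigma> "\<epsilon> / y0"] assms by simp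
  next
    fix \<sigma> \<epsilon> :: real
    assume *: "\<forall>\<sigma>>0. \<forall>\<epsilon>>0. \<exists>R. \<forall>z. R \<le> cmod z \<and> 0 < cmod z \<and> \<sigma> * cmod z \<le> Im z \<longrightarrow>
        cmod (m z - (of_real x0 + of_real y0 * w)) < \<epsilon>" and "0 < \<sigma>" "0 < \<epsilon>"
    then show "\<exists>R. \<forall>z. R \<le> cmod z \<and> 0 < cmod z \<and> \<sigma> * cmod z \<le> Im z \<longrightarrow> cmod (m z - (of_real x0 + of_real y0 * w)) < y0 * \<epsilon>"
      using *[rule_format, of \<sigma> "y0 * \<epsilon>"] assms by simp
  qed
qed

text \<open>The trace normalisation leaves two real conditions. They are the averages that must
  vanish after the shift by \<open>x0\<close> and the scaling by \<open>y0\<close>, up to a constant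
  factor. Subtracting \<open>2 * x0\<close> times the second from the first gives
  \<open>1 - s * \<gamma> x\<close>, which recovers \<gamma>.\<close>

lemma averages_tendsto_iff:
  fixes \<alpha> \<beta> \<gamma> :: "real \<Rightarrow> real" and x0 y0 :: real
  assumes sum: "\<forall>\<^sub>F x in F. \<alpha> x + \<gamma> x = 1"
  defines "s \<equiv> 1 + x0\<^sup>2 + y0\<^sup>2"
  shows "((\<alpha> \<longlongrightarrow> (x0\<^sup>2 + y0\<^sup>2) / s) F \<and> (\<beta> \<longlongrightarrow> - x0 / s) F \<and> (\<gamma> \<longlongrightarrow> 1 / s) F) \<longleftrightarrow>
    (((\<lambda>x. \<alpha> x + 2 * x0 * \<beta> x + (x0\<^sup>2 - y0\<^sup>2) * \<gamma> x) \<longlongrightarrow> 0) F \<and> ((\<lambda>x. \<beta> x + x0 * \<gamma> x) \<longlongrightarrow> 0) F)"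
    (is "?L \<longleftrightarrow> (?P \<longlongrightarrow> 0) F \<and> (?Q \<longlongrightarrow> 0) F")
proof
  have s0: "0 < s" unfolding s_def by (simp add: add_pos_nonneg)
  {
    assume L: ?L
    have "(?P \<longlongrightarrow> (x0\<^sup>2 + y0\<^sup>2) / s + 2 * x0 * (- x0 / s) + (x0\<^sup>2 - y0\<^sup>2) * (1 / s)) F"
      "(?Q \<longlongrightarrow> - x0 / s + x0 * (1 / s)) F"
      by (intro tendsto_add tendsto_mult tendsto_const L[THEN conjunct1] L[THEN conjunct2, THEN conjunct1]
          L[THEN conjunct2, THEN conjunct2])+
    moreover have "(x0\<^sup>2 + y0\<^sup>2) / s + 2 * x0 * (- x0 / s) + (x0\<^sup>2 - y0\<^sup>2) * (1 / s) = 0"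
      using s0 by (simp add: power2_eq_square field_simps)
    ultimately show "(?P \<longlongrightarrow> 0) F \<and> (?Q \<longlongrightarrow> 0) F" by simp
  next
    assume PQ: "(?P \<longlongrightarrow> 0) F \<and> (?Q \<longlongrightarrow> 0) F"
    have "((\<lambda>x. (1 - (?P x - 2 * x0 * ?Q x)) / s) \<longlongrightarrow> (1 - (0 - 2 * x0 * 0)) / s) F"
      using PQ s0 by (intro tendsto_intros) auto
    moreover have "\<forall>\<^sub>F x in F. (1 - (?P x - 2 * x0 * ?Q x)) / s = \<gamma> x"
      using sum
    proof eventually_elim
      case (elim x)
      have "?P x - 2 * x0 * ?Q x = \<alpha> x - (x0\<^sup>2 + y0\<^sup>2) * \<gamma> x" by (simp add: power2_eq_square algebra_simps)
      also have "\<dots> = 1 - s * \<gamma> x" using elim unfolding s_def by (simp add: distrib_right)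
      finally show ?case using s0 by simp
    qed
    ultimately have \<gamma>: "(\<gamma> \<longlongrightarrow> 1 / s) F" by (simp add: tendsto_cong)
    have "((\<lambda>x. ?Q x - x0 * \<gamma> x) \<longlongrightarrow> 0 - x0 * (1 / s)) F" using PQ by (intro tendsto_intros \<gamma>) auto
    then have \<beta>: "(\<beta> \<longlongrightarrow> - x0 / s) F" by simp
    have "((\<lambda>x. 1 - \<gamma> x) \<longlongrightarrow> 1 - 1 / s) F" by (intro tendsto_intros \<gamma>)
    moreover have "1 - 1 / s = (x0\<^sup>2 + y0\<^sup>2) / s" using s0 by (simp add: s_def field_simps)
    moreover have "\<forall>\<^sub>F x in F. 1 - \<gamma> x = \<alpha> x" using sum by eventually_elim simp
    ultimately have "(\<alpha> \<longlongrightarrow> (x0\<^sup>2 + y0\<^sup>2) / s) F" by (simp add: tendsto_cong)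
    then show ?L using \<beta> \<gamma> by simp
  }
qed

section \<open>Averages of \<open>H\<close> and the reduction to the two base cases\<close>

context canonical_system
begin

lemma eventually_in_domain: "\<forall>\<^sub>F x in at_right 0. 0 < x \<and> x \<le> X \<and> 0 < \<eta> x"
  unfolding eventually_at_right_field using X_pos eta_pos by (intro exI[of _ X]) auto

lemma small_iff_tendsto:
  fixes F :: "real \<Rightarrow> 'b::real_normed_vector"
  shows "(\<forall>\<epsilon>>0. \<exists>x1>0. \<forall>x. 0 < x \<and> x \<le> x1 \<longrightarrow> norm (F x) \<le> \<epsilon> * \<eta> x) \<longleftrightarrow>
    ((\<lambda>x. norm (F x) / \<eta> x) \<longlongrightarrow> 0) (at_right 0)" (is "?L \<longleftrightarrow> ?R")
proof
  assume L: ?L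
  show ?R
  proof (rule tendstoI)
    fix \<epsilon> :: real assume e: "0 < \<epsilon>"
    obtain x1 where x1: "0 < x1" "\<And>x. 0 < x \<Longrightarrow> x \<le> x1 \<Longrightarrow> norm (F x) \<le> \<epsilon> / 2 * \<eta> x"
      using L[rule_format, OF half_gt_zero[OF e]] by blast
    have "\<forall>\<^sub>F x in at_right 0. x < x1"
      unfolding eventually_at_right_field using x1(1) by (intro exI[of _ x1]) simp
    with eventually_in_domain show "\<forall>\<^sub>F x in at_right 0. dist (norm (F x) / \<eta> x) 0 < \<epsilon>"
    proof eventually_elim
      case (elim x)
      have "norm (F x) / \<eta> x \<le> \<epsilon> / 2" using x1(2)[of x] elim by (simp add: divide_le_eq)
      also have "\<dots> < \<epsilon>" using e by simp
      finally show ?case using elim by simp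
    qed
  qed
next
  assume R: ?R
  show ?L
  proof (intro allI impI)
    fix \<epsilon> :: real assume e: "0 < \<epsilon>"
    have "\<forall>\<^sub>F x in at_right 0. norm (F x) / \<eta> x < \<epsilon>" by (rule order_tendstoD(2)[OF R e])
    with eventually_in_domain have "\<forall>\<^sub>F x in at_right 0. norm (F x) \<le> \<epsilon> * \<eta> x"
      by eventually_elim (simp add: divide_less_eq)
    then obtain x1 where x1: "0 < x1" "\<And>x. 0 < x \<Longrightarrow> x < x1 \<Longrightarrow> norm (F x) \<le> \<epsilon> * \<eta> x"
      unfolding eventually_at_right_field by blast
    show "\<exists>x1>0. \<forall>x. 0 < x \<and> x \<le> x1 \<longrightarrow> norm (F x) \<le> \<epsilon> * \<eta> x"
      by (intro exI[of _ "x1 / 2"] conjI allI impI x1(2)) (use x1(1) in linarith)+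
  qed
qed

definition A where "A x = integral {0..x} a"
definition B where "B x = integral {0..x} b"
definition C where "C x = integral {0..x} c"

lemma ABC_primitive: "primitive_on X A a" "primitive_on X B b" "primitive_on X C c"
  unfolding A_def[abs_def] B_def[abs_def] C_def[abs_def] by (intro primitive_on_integral abs_int)+

lemma ABC_0 [simp]: "A 0 = 0" "B 0 = 0" "C 0 = 0" by (simp_all add: A_def B_def C_def)

lemma eta_eq: "0 \<le> x \<Longrightarrow> x \<le> X \<Longrightarrow> \<eta> x = A x + C x"
  using primitive_on_eq[OF primitive_on_add[OF ABC_primitive(1,3)]] by (simp add: \<eta>_def)

lemma K_eq:
  assumes "0 \<le> x" "x \<le> X"
  shows "K x = of_real (A x - C x) + 2 * \<i> * of_real (B x)"
proof -
  have "primitive_on X (\<lambda>x. of_real (A x - C x) + 2 * \<i> * of_real (B x)) \<kappa>"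
    by (rule primitive_on_cong[OF primitive_on_add[OF primitive_on_of_real[OF primitive_on_diff[OF ABC_primitive(1,3)]]
       primitive_on_cmult[OF primitive_on_of_real[OF ABC_primitive(2)]], of "2 * \<i>"]]) (simp_all add: \<kappa>_def)
  from primitive_on_eq[OF this assms] show ?thesis by (simp add: K_def)
qed

lemma A_nonneg: "0 \<le> x \<Longrightarrow> x \<le> X \<Longrightarrow> 0 \<le> A x"
  unfolding A_def by (rule integral_nonneg[OF primitive_on_int[OF ABC_primitive(1)]]) (auto simp: nonneg)

text \<open>Integrated form of the weighted inequality: \<open>B\<close> is small relative to
  \<open>\<eta>\<close> as soon as \<open>A\<close> is, which a real limit requires.\<close>

lemma B_bound:
  assumes "0 \<le> x" "x \<le> X" "0 < \<epsilon>"
  shows "\<bar>B x\<bar> \<le> A x / (2 * \<epsilon>) + \<epsilon> * C x / 2"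
proof -
  have "norm (B x - B 0) \<le> (1 / (2 * \<epsilon>) * A x + \<epsilon> / 2 * C x) - (1 / (2 * \<epsilon>) * A 0 + \<epsilon> / 2 * C 0)"
    by (rule primitive_on_norm_le[OF primitive_on_mono[OF ABC_primitive(2) assms(2)]
        primitive_on_add[OF primitive_on_cmult[OF primitive_on_mono[OF ABC_primitive(1) assms(2)]]
          primitive_on_cmult[OF primitive_on_mono[OF ABC_primitive(3) assms(2)]]] assms(1)])
      (use abs_b_le_weighted[OF assms(3)] in simp)
  then show ?thesis by simp
qed

end

context weyl_family
begin

lemma cone_tendsto_zero_iff: "cone_tendsto m 0 \<longleftrightarrow> ((\<lambda>x. A x / \<eta> x) \<longlongrightarrow> 0) (at_right 0)"
proof -
  have "cone_tendsto m 0 \<longleftrightarrow> (\<forall>\<epsilon>>0. \<exists>x1>0. \<forall>x. 0 < x \<and> x \<le> x1 \<longrightarrow> A x \<le> \<epsilon> * \<eta> x)"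
    using cone_tendsto_zero integral_a_small unfolding A_def by blast
  also have "\<dots> \<longleftrightarrow> (\<forall>\<epsilon>>0. \<exists>x1>0. \<forall>x. 0 < x \<and> x \<le> x1 \<longrightarrow> norm (A x) \<le> \<epsilon> * \<eta> x)" (is "?l = ?r")
  proof
    assume l: ?l
    show ?r
    proof (intro allI impI)
      fix \<epsilon> :: real assume "0 < \<epsilon>"
      then obtain x1 where x1: "0 < x1" "\<And>x. 0 < x \<Longrightarrow> x \<le> x1 \<Longrightarrow> A x \<le> \<epsilon> * \<eta> x"
        using l[rule_format, of \<epsilon>] by blast
      show "\<exists>x1>0. \<forall>x. 0 < x \<and> x \<le> x1 \<longrightarrow> norm (A x) \<le> \<epsilon> * \<eta> x"
      proof (intro exI[of _ "min x1 X"] conjI allI impI)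
        fix x assume x: "0 < x \<and> x \<le> min x1 X"
        then have "0 \<le> A x" by (intro A_nonneg) auto
        then show "norm (A x) \<le> \<epsilon> * \<eta> x" using x1(2)[of x] x by simp
      qed (use x1(1) X_pos in simp)
    qed
  next
    assume r: ?r
    show ?l
    proof (intro allI impI)
      fix \<epsilon> :: real assume "0 < \<epsilon>"
      then obtain x1 where x1: "0 < x1" "\<And>x. 0 < x \<Longrightarrow> x \<le> x1 \<Longrightarrow> norm (A x) \<le> \<epsilon> * \<eta> x"
        using r[rule_format, of \<epsilon>] by blast
      have "A x \<le> \<epsilon> * \<eta> x" if "0 < x \<and> x \<le> x1" for x
        using x1(2)[of x] that abs_ge_self[of "A x"] by simp
      then show "\<exists>x1>0. \<forall>x. 0 < x \<and> x \<le> x1 \<longrightarrow> A x \<le> \<epsilon> * \<eta> x" using x1(1) by blast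
    qed
  qed
  also have "\<dots> \<longleftrightarrow> ((\<lambda>x. norm (A x) / \<eta> x) \<longlongrightarrow> 0) (at_right 0)" by (rule small_iff_tendsto)
  also have "\<dots> \<longleftrightarrow> ((\<lambda>x. A x / \<eta> x) \<longlongrightarrow> 0) (at_right 0)"
    by (rule tendsto_cong, rule eventually_mono[OF eventually_in_domain]) (use A_nonneg in simp)
  finally show ?thesis .
qed

lemma cone_tendsto_i_iff: "cone_tendsto m \<i> \<longleftrightarrow> ((\<lambda>x. cmod (K x) / \<eta> x) \<longlongrightarrow> 0) (at_right 0)"
  unfolding small_iff_tendsto[symmetric] using cone_tendsto_i K_small by blast

text \<open>Translation by \<open>x0\<close> and scaling by \<open>d\<close> move \<zeta> to 0 or
  \<i>. The base cases then give limits relative to the trace integral \<open>T.\<eta>\<close> of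
  the transformed Hamiltonian, and the work left is to pass between the normalisations
  \<open>T.\<eta>\<close> and \<open>\<eta>\<close>.\<close>

lemma cone_tendsto_iff_averages:
  assumes \<zeta>: "0 \<le> Im \<zeta>"
  defines "s \<equiv> (cmod \<zeta>)\<^sup>2 + 1"
  shows "cone_tendsto m \<zeta> \<longleftrightarrow>
    ((\<lambda>x. A x / \<eta> x) \<longlongrightarrow> (cmod \<zeta>)\<^sup>2 / s) (at_right 0) \<and>
    ((\<lambda>x. B x / \<eta> x) \<longlongrightarrow> - Re \<zeta> / s) (at_right 0) \<and>
    ((\<lambda>x. C x / \<eta> x) \<longlongrightarrow> 1 / s) (at_right 0)"
proof -
  define x0 where "x0 = Re \<zeta>"
  define y0 where "y0 = Im \<zeta>"
  \<comment> \<open>Division by \<open>Im \<zeta>\<close> is impossible for real \<zeta>; there a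
    translation alone moves the limit to 0.\<close>
  define d where "d = (if y0 = 0 then 1 else y0)"
  have d: "0 < d" using \<zeta> by (auto simp: d_def y0_def)
  have s: "s = 1 + x0\<^sup>2 + y0\<^sup>2" unfolding s_def x0_def y0_def cmod_power2 by simp
  have cz: "(cmod \<zeta>)\<^sup>2 = x0\<^sup>2 + y0\<^sup>2" unfolding x0_def y0_def cmod_power2 by simp
  have s0: "0 < s" unfolding s by (simp add: add_pos_nonneg)
  define \<alpha> where "\<alpha> x = A x / \<eta> x" for x
  define \<beta> where "\<beta> x = B x / \<eta> x" for x
  define \<gamma> where "\<gamma> x = C x / \<eta> x" for x
  define P where "P x = \<alpha> x + 2 * x0 * \<beta> x + (x0\<^sup>2 - y0\<^sup>2) * \<gamma> x" for x
  define Q where "Q x = \<beta> x + x0 * \<gamma> x" for x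
  \<comment> \<open>The ratio \<open>T.\<eta> / \<eta>\<close> of the two normalisations.\<close>
  define N where "N x = (\<alpha> x + 2 * x0 * \<beta> x + x0\<^sup>2 * \<gamma> x) / d + d * \<gamma> x" for x
  have dom: "\<forall>\<^sub>F x in at_right 0. 0 < x \<and> x \<le> X \<and> 0 < \<eta> x" by (rule eventually_in_domain)
  have sum1: "\<forall>\<^sub>F x in at_right 0. \<alpha> x + \<gamma> x = 1"
    using dom
  proof eventually_elim
    case (elim x)
    then have "A x + C x = \<eta> x" using eta_eq[of x] by simp
    then show ?case using elim unfolding \<alpha>_def \<gamma>_def add_divide_distrib[symmetric] by simp
  qed
  have avg: "((\<alpha> \<longlongrightarrow> (x0\<^sup>2 + y0\<^sup>2) / s) (at_right 0) \<and> (\<beta> \<longlongrightarrow> - x0 / s) (at_right 0) \<and> (\<gamma> \<longlongrightarrow> 1 / s) (at_right 0))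
      \<longleftrightarrow> (P \<longlongrightarrow> 0) (at_right 0) \<and> (Q \<longlongrightarrow> 0) (at_right 0)"
    unfolding s P_def[abs_def] Q_def[abs_def] by (rule averages_tendsto_iff[OF sum1])
  interpret T: weyl_family X "\<lambda>s. (a s + 2 * x0 * b s + x0\<^sup>2 * c s) / d" "\<lambda>s. b s + x0 * c s" "\<lambda>s. d * c s"
    "\<lambda>z s. u1 z s + of_real x0 * u2 z s"
    "\<lambda>z s. ((v1 z s + of_real x0 * v2 z s) - of_real x0 * (u1 z s + of_real x0 * u2 z s)) / of_real d"
    "\<lambda>z s. of_real d * u2 z s" "\<lambda>z s. (of_real d * v2 z s - of_real x0 * (of_real d * u2 z s)) / of_real d"
    "\<lambda>z. (m z - of_real x0) / of_real d"
    by (rule weyl_family_shift[OF d])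
  have TA: "T.A x = (A x + 2 * x0 * B x + x0\<^sup>2 * C x) / d" if "0 \<le> x" "x \<le> X" for x
  proof -
    have "primitive_on X (\<lambda>x. (1 / d) * (A x + (2 * x0) * B x + x0\<^sup>2 * C x)) (\<lambda>x. (1 / d) * (a x + (2 * x0) * b x + x0\<^sup>2 * c x))"
      by (intro primitive_on_cmult primitive_on_add ABC_primitive)
    from primitive_on_eq[OF this that] show ?thesis using d by (simp add: T.A_def)
  qed
  have TB: "T.B x = B x + x0 * C x" if "0 \<le> x" "x \<le> X" for x
  proof -
    have "primitive_on X (\<lambda>x. B x + x0 * C x) (\<lambda>x. b x + x0 * c x)"
      by (intro primitive_on_cmult primitive_on_add ABC_primitive)
    from primitive_on_eq[OF this that] show ?thesis by (simp add: T.B_def)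
  qed
  have TC: "T.C x = d * C x" if "0 \<le> x" "x \<le> X" for x
    by (simp add: T.C_def C_def)
  have ratio: "\<forall>\<^sub>F x in at_right 0. T.\<eta> x / \<eta> x = N x \<and> T.A x / \<eta> x = (\<alpha> x + 2 * x0 * \<beta> x + x0\<^sup>2 * \<gamma> x) / d \<and>
      T.B x / \<eta> x = Q x \<and> T.C x / \<eta> x = d * \<gamma> x"
    using dom
  proof eventually_elim
    case (elim x)
    then have x: "0 \<le> x" "x \<le> X" by auto
    show ?case
      using elim unfolding T.eta_eq[OF x] TA[OF x] TB[OF x] TC[OF x] N_def \<alpha>_def \<beta>_def \<gamma>_def Q_def
      by (simp add: add_divide_distrib mult.commute[of d])
  qed
  \<comment> \<open>Bounds \<open>T.\<eta>\<close> by a multiple of \<open>\<eta>\<close>, so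
    whatever is small relative to \<open>T.\<eta>\<close> is small relative to
    \<open>\<eta>\<close>.\<close>
  define M where "M = (1 + \<bar>x0\<bar> + x0\<^sup>2) / d + d"
  have M0: "0 \<le> M" using d by (simp add: M_def)
  have T_le: "T.\<eta> x \<le> M * \<eta> x" if x: "0 \<le> x" "x \<le> X" for x
  proof -
    have "T.\<eta> x - T.\<eta> 0 \<le> M * \<eta> x - M * \<eta> 0"
    proof (rule primitive_on_le[OF primitive_on_mono[OF T.eta_primitive x(2)] primitive_on_cmult[OF primitive_on_mono[OF eta_primitive x(2)]] x(1)])
      fix t
      have "a t + 2 * x0 * b t + x0\<^sup>2 * c t \<le> (a t + c t) + \<bar>x0\<bar> * (a t + c t) + x0\<^sup>2 * (a t + c t)"
      proof (intro add_mono)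
        have "2 * x0 * b t \<le> \<bar>x0\<bar> * (2 * \<bar>b t\<bar>)" by (simp add: abs_mult[symmetric])
        also have "\<dots> \<le> \<bar>x0\<bar> * (a t + c t)" using abs_b_le[of t] by (intro mult_left_mono) auto
        finally show "2 * x0 * b t \<le> \<bar>x0\<bar> * (a t + c t)" .
      qed (use nonneg[of t] in \<open>auto intro: mult_left_mono\<close>)
      also have "\<dots> = (1 + \<bar>x0\<bar> + x0\<^sup>2) * (a t + c t)" by (simp add: distrib_right)
      finally have "(a t + 2 * x0 * b t + x0\<^sup>2 * c t) / d \<le> (1 + \<bar>x0\<bar> + x0\<^sup>2) * (a t + c t) / d"
        using d by (intro divide_right_mono) auto
      moreover have "d * c t \<le> d * (a t + c t)" using d nonneg[of t] by (intro mult_left_mono) auto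
      ultimately show "(a t + 2 * x0 * b t + x0\<^sup>2 * c t) / d + d * c t \<le> M * (a t + c t)"
        by (simp add: M_def distrib_right)
    qed
    then show ?thesis by simp
  qed
  have transfer: "((\<lambda>x. f x / \<eta> x) \<longlongrightarrow> 0) (at_right 0)"
    if lim: "((\<lambda>x. \<bar>f x\<bar> / T.\<eta> x) \<longlongrightarrow> 0) (at_right 0)" for f
  proof (rule Lim_null_comparison)
    have "((\<lambda>x. \<bar>f x\<bar> / T.\<eta> x * M) \<longlongrightarrow> 0 * M) (at_right 0)" by (intro tendsto_intros lim)
    then show "((\<lambda>x. \<bar>f x\<bar> / T.\<eta> x * M) \<longlongrightarrow> 0) (at_right 0)" by simp
    show "\<forall>\<^sub>F x in at_right 0. norm (f x / \<eta> x) \<le> \<bar>f x\<bar> / T.\<eta> x * M"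
      using dom T.eventually_in_domain
    proof eventually_elim
      case (elim x)
      have "T.\<eta> x \<le> M * \<eta> x" using T_le[of x] elim by simp
      then have "\<bar>f x\<bar> * T.\<eta> x \<le> \<bar>f x\<bar> * (M * \<eta> x)" by (intro mult_left_mono) auto
      then show ?case using elim by (simp add: field_simps)
    qed
  qed
  \<comment> \<open>The converse passage uses that \<open>N\<close> has a nonzero limit, which the
    limits of the averages provide in both cases.\<close>
  have from_eta: "((\<lambda>x. f x / T.\<eta> x) \<longlongrightarrow> 0) (at_right 0)"
    if lim: "((\<lambda>x. f x / \<eta> x) \<longlongrightarrow> 0) (at_right 0)" and N: "(N \<longlongrightarrow> l) (at_right 0)" "l \<noteq> 0" for f l
  proof -
    have lim0: "((\<lambda>x. (f x / \<eta> x) / N x) \<longlongrightarrow> 0 / l) (at_right 0)" by (intro tendsto_intros lim N)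
    have "\<forall>\<^sub>F x in at_right 0. (f x / \<eta> x) / N x = f x / T.\<eta> x"
      using dom ratio by eventually_elim (auto simp: field_simps)
    from Lim_transform_eventually[OF lim0 this] show ?thesis by simp
  qed
  have core: "cone_tendsto m \<zeta> \<longleftrightarrow> (P \<longlongrightarrow> 0) (at_right 0) \<and> (Q \<longlongrightarrow> 0) (at_right 0)"
  proof (cases "y0 = 0")
    case True
    then have d1: "d = 1" by (simp add: d_def)
    have "\<zeta> = of_real x0 + of_real d * 0" using True by (simp add: complex_eq_iff x0_def y0_def)
    then have "cone_tendsto m \<zeta> \<longleftrightarrow> cone_tendsto (\<lambda>z. (m z - of_real x0) / of_real d) 0"
      using cone_tendsto_affine[OF d, of m x0 0] by simp
    also have "\<dots> \<longleftrightarrow> ((\<lambda>x. T.A x / T.\<eta> x) \<longlongrightarrow> 0) (at_right 0)" by (rule T.cone_tendsto_zero_iff)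
    also have "\<dots> \<longleftrightarrow> (P \<longlongrightarrow> 0) (at_right 0) \<and> (Q \<longlongrightarrow> 0) (at_right 0)"
    proof
      assume l: "((\<lambda>x. T.A x / T.\<eta> x) \<longlongrightarrow> 0) (at_right 0)"
      then have "((\<lambda>x. \<bar>T.A x\<bar> / T.\<eta> x) \<longlongrightarrow> 0) (at_right 0)"
        by (rule Lim_transform_eventually) (rule eventually_mono[OF T.eventually_in_domain], use T.A_nonneg in simp)
      then have "((\<lambda>x. T.A x / \<eta> x) \<longlongrightarrow> 0) (at_right 0)" by (rule transfer)
      then have "(P \<longlongrightarrow> 0) (at_right 0)"
        by (rule Lim_transform_eventually) (rule eventually_mono[OF ratio], simp add: P_def d1 True)
      \<comment> \<open>The base case speaks of \<open>A\<close> only; \<open>B\<close> follows from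
        \<open>T.B_bound\<close> with \<open>T.A\<close> at most
        \<open>\<epsilon>\<^sup>2 * T.\<eta>\<close>.\<close>
      moreover have "((\<lambda>x. \<bar>T.B x\<bar> / T.\<eta> x) \<longlongrightarrow> 0) (at_right 0)"
      proof -
        have "((\<lambda>x. norm (T.B x) / T.\<eta> x) \<longlongrightarrow> 0) (at_right 0)"
          unfolding T.small_iff_tendsto[symmetric]
        proof (intro allI impI)
          fix \<epsilon> :: real assume e: "0 < \<epsilon>"
          have l': "((\<lambda>x. norm (T.A x) / T.\<eta> x) \<longlongrightarrow> 0) (at_right 0)"
            using \<open>((\<lambda>x. \<bar>T.A x\<bar> / T.\<eta> x) \<longlongrightarrow> 0) (at_right 0)\<close> by simp
          have "0 < \<epsilon>\<^sup>2" using e by simp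
          then obtain x1 where x1: "0 < x1" "\<And>x. 0 < x \<Longrightarrow> x \<le> x1 \<Longrightarrow> norm (T.A x) \<le> \<epsilon>\<^sup>2 * T.\<eta> x"
            using T.small_iff_tendsto[of T.A, THEN iffD2, OF l', rule_format, of "\<epsilon>\<^sup>2"] by blast
          show "\<exists>x1>0. \<forall>x. 0 < x \<and> x \<le> x1 \<longrightarrow> norm (T.B x) \<le> \<epsilon> * T.\<eta> x"
          proof (intro exI[of _ "min x1 X"] conjI allI impI)
            fix x assume x: "0 < x \<and> x \<le> min x1 X"
            then have x': "0 \<le> x" "x \<le> X" by auto
            have "\<bar>T.B x\<bar> \<le> T.A x / (2 * \<epsilon>) + \<epsilon> * T.C x / 2" by (rule T.B_bound[OF x' e])
            also have "\<dots> \<le> \<epsilon>\<^sup>2 * T.\<eta> x / (2 * \<epsilon>) + \<epsilon> * T.\<eta> x / 2"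
              using x1(2)[of x] x e T.eta_eq[OF x'] T.A_nonneg[OF x']
              by (intro add_mono divide_right_mono mult_left_mono) auto
            also have "\<dots> = \<epsilon> * T.\<eta> x" using e by (simp add: power2_eq_square)
            finally show "norm (T.B x) \<le> \<epsilon> * T.\<eta> x" by simp
          qed (use x1 X_pos in auto)
        qed
        then show ?thesis by simp
      qed
      then have "((\<lambda>x. T.B x / \<eta> x) \<longlongrightarrow> 0) (at_right 0)" by (rule transfer)
      then have "(Q \<longlongrightarrow> 0) (at_right 0)"
        by (rule Lim_transform_eventually) (rule eventually_mono[OF ratio], simp)
      ultimately show "(P \<longlongrightarrow> 0) (at_right 0) \<and> (Q \<longlongrightarrow> 0) (at_right 0)" by simp
    next
      assume PQ: "(P \<longlongrightarrow> 0) (at_right 0) \<and> (Q \<longlongrightarrow> 0) (at_right 0)"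
      then have \<gamma>l: "(\<gamma> \<longlongrightarrow> 1 / s) (at_right 0)" using avg by blast
      have "((\<lambda>x. P x + \<gamma> x) \<longlongrightarrow> 0 + 1 / s) (at_right 0)" using PQ \<gamma>l by (intro tendsto_add) auto
      moreover have "N = (\<lambda>x. P x + \<gamma> x)" by (simp add: fun_eq_iff N_def P_def d1 True)
      ultimately have "(N \<longlongrightarrow> 1 / s) (at_right 0)" by simp
      moreover have "((\<lambda>x. T.A x / \<eta> x) \<longlongrightarrow> 0) (at_right 0)"
        using PQ[THEN conjunct1]
        by (rule Lim_transform_eventually) (rule eventually_mono[OF ratio], simp add: P_def d1 True)
      ultimately show "((\<lambda>x. T.A x / T.\<eta> x) \<longlongrightarrow> 0) (at_right 0)" using s0 by (intro from_eta) auto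
    qed
    finally show ?thesis .
  next
    case False
    then have dy: "d = y0" and y0: "0 < y0" using \<zeta> by (auto simp: d_def y0_def)
    have "\<zeta> = of_real x0 + of_real d * \<i>" by (simp add: complex_eq_iff x0_def y0_def dy)
    then have "cone_tendsto m \<zeta> \<longleftrightarrow> cone_tendsto (\<lambda>z. (m z - of_real x0) / of_real d) \<i>"
      using cone_tendsto_affine[OF d, of m x0 \<i>] by simp
    also have "\<dots> \<longleftrightarrow> ((\<lambda>x. cmod (T.K x) / T.\<eta> x) \<longlongrightarrow> 0) (at_right 0)" by (rule T.cone_tendsto_i_iff)
    also have "\<dots> \<longleftrightarrow> (P \<longlongrightarrow> 0) (at_right 0) \<and> (Q \<longlongrightarrow> 0) (at_right 0)"
    proof -
      \<comment> \<open>For \<open>d = Im \<zeta>\<close> the two conditions are, up to constant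
        factors, the real and imaginary parts of the average of \<open>T.\<kappa>\<close>.\<close>
      have Keq: "\<forall>\<^sub>F x in at_right 0. T.K x / of_real (\<eta> x) = of_real (P x / d) + 2 * \<i> * of_real (Q x)"
        using dom ratio
      proof eventually_elim
        case (elim x)
        then have x: "0 \<le> x" "x \<le> X" by auto
        have "T.K x / of_real (\<eta> x) = of_real (T.A x / \<eta> x - T.C x / \<eta> x) + 2 * \<i> * of_real (T.B x / \<eta> x)"
          unfolding T.K_eq[OF x] by (simp add: add_divide_distrib diff_divide_distrib)
        also have "T.A x / \<eta> x - T.C x / \<eta> x = P x / d"
          using elim d by (simp add: P_def dy field_simps power2_eq_square)
        finally show ?case using elim by simp
      qed
      show ?thesis
      proof
        assume "((\<lambda>x. cmod (T.K x) / T.\<eta> x) \<longlongrightarrow> 0) (at_right 0)"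
        then have "((\<lambda>x. \<bar>cmod (T.K x)\<bar> / T.\<eta> x) \<longlongrightarrow> 0) (at_right 0)" by simp
        then have "((\<lambda>x. cmod (T.K x) / \<eta> x) \<longlongrightarrow> 0) (at_right 0)" by (rule transfer)
        then have "((\<lambda>x. cmod (T.K x / of_real (\<eta> x))) \<longlongrightarrow> 0) (at_right 0)"
          by (rule Lim_transform_eventually) (rule eventually_mono[OF dom], simp add: norm_divide)
        then have "((\<lambda>x. T.K x / of_real (\<eta> x)) \<longlongrightarrow> 0) (at_right 0)" by (rule tendsto_norm_zero_cancel)
        then have l: "((\<lambda>x. of_real (P x / d) + 2 * \<i> * of_real (Q x)) \<longlongrightarrow> 0) (at_right 0)"
          by (rule Lim_transform_eventually[OF _ Keq])
        have l12: "((\<lambda>x. P x / d) \<longlongrightarrow> 0) (at_right 0)" "((\<lambda>x. 2 * Q x) \<longlongrightarrow> 0) (at_right 0)"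
          using tendsto_Re[OF l] tendsto_Im[OF l] by simp_all
        show "(P \<longlongrightarrow> 0) (at_right 0) \<and> (Q \<longlongrightarrow> 0) (at_right 0)"
          using tendsto_mult[OF tendsto_const[of d] l12(1)] tendsto_mult[OF tendsto_const[of "1 / 2"] l12(2)] d by simp
      next
        assume PQ: "(P \<longlongrightarrow> 0) (at_right 0) \<and> (Q \<longlongrightarrow> 0) (at_right 0)"
        then have \<gamma>l: "(\<gamma> \<longlongrightarrow> 1 / s) (at_right 0)" using avg by blast
        have "((\<lambda>x. P x / d + 2 * d * \<gamma> x) \<longlongrightarrow> 0 / d + 2 * d * (1 / s)) (at_right 0)"
          using PQ d by (intro tendsto_intros \<gamma>l) auto
        moreover have "N = (\<lambda>x. P x / d + 2 * d * \<gamma> x)"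
          using d by (simp add: fun_eq_iff N_def P_def dy field_simps power2_eq_square)
        ultimately have Nl: "(N \<longlongrightarrow> 2 * d / s) (at_right 0)" by simp
        have "((\<lambda>x. complex_of_real (P x / d) + 2 * \<i> * of_real (Q x)) \<longlongrightarrow> of_real (0 / d) + 2 * \<i> * of_real 0) (at_right 0)"
          using PQ d by (intro tendsto_intros) auto
        then have "((\<lambda>x. T.K x / of_real (\<eta> x)) \<longlongrightarrow> 0) (at_right 0)"
          using Lim_transform_eventually[OF _ eventually_mono[OF Keq]] by (smt (verit) add.right_neutral div_0 mult_zero_right of_real_0)
        then have "((\<lambda>x. cmod (T.K x / of_real (\<eta> x))) \<longlongrightarrow> 0) (at_right 0)" by (rule tendsto_norm_zero)
        then have "((\<lambda>x. cmod (T.K x) / \<eta> x) \<longlongrightarrow> 0) (at_right 0)"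
          by (rule Lim_transform_eventually) (rule eventually_mono[OF dom], simp add: norm_divide)
        then show "((\<lambda>x. cmod (T.K x) / T.\<eta> x) \<longlongrightarrow> 0) (at_right 0)"
          using Nl d s0 by (intro from_eta) auto
      qed
    qed
    finally show ?thesis .
  qed
  show ?thesis unfolding core avg[symmetric] cz \<alpha>_def[abs_def] \<beta>_def[abs_def] \<gamma>_def[abs_def] x0_def ..
qed

end

section \<open>The matrix formulation\<close>

lemma primitive_on_spike:
  fixes f :: "real \<Rightarrow> 'a::euclidean_space"
  assumes "primitive_on X f g" "negligible S" "\<And>x. 0 \<le> x \<Longrightarrow> x \<le> X \<Longrightarrow> x \<notin> S \<Longrightarrow> g1 x = g x"
  shows "primitive_on X f g1"
  unfolding primitive_on_def
proof (intro conjI ballI)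
  show "g1 absolutely_integrable_on {0..X}"
    by (rule absolutely_integrable_spike[OF _ assms(2)]) (use assms in \<open>auto simp: primitive_on_def\<close>)
  fix x assume x: "x \<in> {0..X}"
  have "integral {0..x} g1 = integral {0..x} g"
    by (rule integral_spike[OF assms(2)]) (use assms(3) x in simp)
  then show "f x - f 0 = integral {0..x} g1" using assms(1) x by (simp add: primitive_on_def)
qed

lemma interval_0_exhaustion:
  assumes "0 < L"
  obtains X :: "nat \<Rightarrow> real" where "\<And>n. 0 < X n" "\<And>n. X n \<in> interval_0 L" "incseq X"
    "interval_0 L = (\<Union>n. {0..X n})"
proof (cases L)
  case (real l)
  then have l: "0 < l" using assms by simp
  \<comment> \<open>The offset 2 makes the first endpoint \<open>l / 2\<close>, hence
    positive.\<close>
  define X where "X n = l * (1 - 1 / real (n + 2))" for n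
  have inc: "incseq X" unfolding incseq_def X_def using l by (auto intro!: mult_left_mono simp: frac_le)
  have sub: "X n < l" for n using l by (simp add: X_def algebra_simps)
  show ?thesis
  proof (rule that[of X])
    show "0 < X n" for n using l by (simp add: X_def)
    then show "X n \<in> interval_0 L" for n using sub[of n] less_imp_le[of 0 "X n"] real by (simp add: interval_0_def)
    show "incseq X" by (rule inc)
    show "interval_0 L = (\<Union>n. {0..X n})"
    proof
      show "(\<Union>n. {0..X n}) \<subseteq> interval_0 L"
      proof
        fix x assume "x \<in> (\<Union>n. {0..X n})"
        then obtain n where "0 \<le> x" "x \<le> X n" by auto
        then show "x \<in> interval_0 L" using sub[of n] real by (simp add: interval_0_def)
      qed
      show "interval_0 L \<subseteq> (\<Union>n. {0..X n})"
      proof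
        fix x assume "x \<in> interval_0 L"
        then have x: "0 \<le> x" "x < l" using real by (auto simp: interval_0_def)
        obtain n :: nat where n: "l / (l - x) < real n" using reals_Archimedean2 by blast
        then have "l < real n * (l - x)" using x by (simp add: divide_less_eq)
        also have "\<dots> \<le> real (n + 2) * (l - x)" using x by (intro mult_right_mono) auto
        finally have "x \<le> X n" unfolding X_def by (simp add: field_simps)
        then show "x \<in> (\<Union>n. {0..X n})" using x by auto
      qed
    qed
  qed
next
  case PInf
  show ?thesis
  proof (rule that[of "\<lambda>n. real (n + 1)"])
    show "interval_0 L = (\<Union>n. {0..real (n + 1)})"
    proof
      show "interval_0 L \<subseteq> (\<Union>n. {0..real (n + 1)})"
      proof
        fix x assume "x \<in> interval_0 L"
        moreover obtain n where "x < real n" using reals_Archimedean2 by blast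
        ultimately show "x \<in> (\<Union>n. {0..real (n + 1)})" by (auto simp: interval_0_def intro!: exI[of _ n])
      qed
    qed (auto simp: PInf interval_0_def)
  qed (auto simp: PInf interval_0_def incseq_def)
qed (use assms in auto)

lemma interval_0_down: "x \<in> interval_0 L \<Longrightarrow> 0 \<le> y \<Longrightarrow> y \<le> x \<Longrightarrow> y \<in> interval_0 L"
  unfolding interval_0_def using le_less_trans[of "ereal y" "ereal x" L] by auto

lemma symmetric_entries:
  fixes M :: "real^2^2"
  assumes "transpose M = M"
  shows "M $ 2 $ 1 = M $ 1 $ 2"
proof -
  have "M $ 2 $ 1 = transpose M $ 1 $ 2" by (simp add: transpose_def)
  then show ?thesis by (simp only: assms)
qed

lemma psd_entries:
  fixes M :: "real^2^2"
  assumes sym: "transpose M = M" and psd: "\<And>v. 0 \<le> v \<bullet> (M *v v)" and "M \<noteq> 0"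
  shows "0 \<le> M $ 1 $ 1" "0 \<le> M $ 2 $ 2" "(M $ 1 $ 2)\<^sup>2 \<le> M $ 1 $ 1 * M $ 2 $ 2" "0 < M $ 1 $ 1 + M $ 2 $ 2"
proof -
  note s = symmetric_entries[OF sym]
  have q: "0 \<le> M $ 1 $ 1 * p\<^sup>2 + 2 * M $ 1 $ 2 * (p * r) + M $ 2 $ 2 * r\<^sup>2" for p r
    using psd[of "vector [p, r]"]
    by (simp add: inner_vec_def matrix_vector_mult_def sum_2 vector_2 s power2_eq_square algebra_simps)
  show a: "0 \<le> M $ 1 $ 1" using q[of 1 0] by simp
  show c: "0 \<le> M $ 2 $ 2" using q[of 0 1] by simp
  show d: "(M $ 1 $ 2)\<^sup>2 \<le> M $ 1 $ 1 * M $ 2 $ 2"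
  proof (cases "M $ 2 $ 2 = 0")
    case True
    have "M $ 1 $ 2 = 0"
    proof (rule ccontr)
      assume n: "M $ 1 $ 2 \<noteq> 0"
      \<comment> \<open>With a vanishing lower corner the form is affine in the second entry of the
        test vector; this entry gives it the value -1.\<close>
      have "0 \<le> M $ 1 $ 1 * 1\<^sup>2 + 2 * M $ 1 $ 2 * (1 * (- (M $ 1 $ 1 + 1) / (2 * M $ 1 $ 2))) + M $ 2 $ 2 * (- (M $ 1 $ 1 + 1) / (2 * M $ 1 $ 2))\<^sup>2"
        by (rule q)
      also have "\<dots> = -1" using n True by (simp add: field_simps)
      finally show False by simp
    qed
    then show ?thesis using True by simp
  next
    case False
    then have c': "0 < M $ 2 $ 2" using c by simp
    \<comment> \<open>The test vector \<open>(c, - b)\<close> yields \<open>c\<close> times the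
      determinant.\<close>
    have "0 \<le> M $ 2 $ 2 * (M $ 1 $ 1 * (M $ 2 $ 2) - (M $ 1 $ 2)\<^sup>2)"
      using q[of "M $ 2 $ 2" "- M $ 1 $ 2"] by (simp add: power2_eq_square algebra_simps)
    then show ?thesis using c' by (simp add: zero_le_mult_iff)
  qed
  show "0 < M $ 1 $ 1 + M $ 2 $ 2"
  proof (rule ccontr)
    assume "\<not> ?thesis"
    then have 0: "M $ 1 $ 1 = 0" "M $ 2 $ 2 = 0" using a c by auto
    then have "M $ 1 $ 2 = 0" using d by simp
    then have "M = 0" using 0 s by (simp add: vec_eq_iff forall_2)
    then show False using \<open>M \<noteq> 0\<close> by simp
  qed
qed

lemma trace_2: "trace (M :: 'a::semiring_1^2^2) = M $ 1 $ 1 + M $ 2 $ 2"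
  by (simp add: trace_def sum_2)

lemma Jmat_entries:
  fixes V :: "complex^2^2"
  shows "(Jmat ** V) $ 1 $ j = - V $ 2 $ j" "(Jmat ** V) $ 2 $ j = V $ 1 $ j"
  by (simp_all add: Jmat_def matrix_matrix_mult_def sum_2 vector_2)

lemma rhs_entries:
  fixes M :: "real^2^2" and V :: "complex^2^2"
  shows "(mat z ** map_matrix complex_of_real M ** V) $ i $ j
    = z * (of_real (M $ i $ 1) * V $ 1 $ j + of_real (M $ i $ 2) * V $ 2 $ j)"
proof -
  have "i = 1 \<or> i = 2" using exhaust_2 by auto
  then show ?thesis
    by (auto simp: matrix_matrix_mult_def mat_def map_matrix_def sum_2 algebra_simps)
qed

lemma bounded_linear_entry: "bounded_linear (\<lambda>M :: 'a::real_normed_vector^2^2. M $ i $ j)"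
  using bounded_linear_compose[OF bounded_linear_vec_nth bounded_linear_vec_nth] .

text \<open>Replacing \<open>H\<close> by the identity on a null set makes the pointwise conditions hold everywhere.\<close>

lemma hamiltonian_scalar:
  assumes "hamiltonian L H"
  obtains a b c :: "real \<Rightarrow> real" and S where "negligible S"
    and "\<And>x. x \<in> interval_0 L \<Longrightarrow> x \<notin> S \<Longrightarrow>
      H x $ 1 $ 1 = a x \<and> H x $ 1 $ 2 = b x \<and> H x $ 2 $ 1 = b x \<and> H x $ 2 $ 2 = c x"
    and "\<And>X. X \<in> interval_0 L \<Longrightarrow> 0 < X \<Longrightarrow> canonical_system X a b c"
proof -
  note h = assms[unfolded hamiltonian_def]
  have "AE x in lebesgue. x \<in> interval_0 L \<longrightarrow> (\<forall>v. 0 \<le> v \<bullet> (H x *v v)) \<and> H x \<noteq> 0" using h by blast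
  then obtain S where S: "negligible S"
    "{x. \<not> (x \<in> interval_0 L \<longrightarrow> (\<forall>v. 0 \<le> v \<bullet> (H x *v v)) \<and> H x \<noteq> 0)} \<subseteq> S"
    unfolding eventually_ae_filter_negligible by blast
  define good where "good x \<longleftrightarrow> x \<in> interval_0 L \<and> x \<notin> S" for x
  define a where "a x = (if good x then H x $ 1 $ 1 else 1)" for x
  define b where "b x = (if good x then H x $ 1 $ 2 else 0)" for x
  define c where "c x = (if good x then H x $ 2 $ 2 else 1)" for x
  have tr: "transpose (H x) = H x" if "x \<in> interval_0 L" for x using h that by blast
  have ent: "0 \<le> H x $ 1 $ 1 \<and> 0 \<le> H x $ 2 $ 2 \<and> (H x $ 1 $ 2)\<^sup>2 \<le> H x $ 1 $ 1 * H x $ 2 $ 2 \<and> 0 < H x $ 1 $ 1 + H x $ 2 $ 2"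
    if "good x" for x
    using psd_entries[of "H x"] tr[of x] S(2) that unfolding good_def by blast
  have ai: "(\<lambda>x. H x $ i $ j) absolutely_integrable_on {0..X}" if "X \<in> interval_0 L" for X i j
    using absolutely_integrable_linear[where f=H and s="{0..X}", OF _ bounded_linear_entry[of i j]] h that by (simp add: comp_def)
  show ?thesis
  proof (rule that[of S a b c])
    show "negligible S" by (rule S(1))
    fix x assume "x \<in> interval_0 L" "x \<notin> S"
    then show "H x $ 1 $ 1 = a x \<and> H x $ 1 $ 2 = b x \<and> H x $ 2 $ 1 = b x \<and> H x $ 2 $ 2 = c x"
      using symmetric_entries[OF tr[of x]] by (simp add: a_def b_def c_def good_def)
  next
    fix X assume X: "X \<in> interval_0 L" "0 < X"
    have in_good: "good x" if "x \<in> {0..X} - S" for x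
      using that interval_0_down[OF X(1), of x] by (auto simp: good_def)
    show "canonical_system X a b c"
    proof
      show "0 < X" by (rule X(2))
      show "a absolutely_integrable_on {0..X}"
        by (rule absolutely_integrable_spike[OF ai[OF X(1), of 1 1] S(1)]) (use in_good in \<open>simp add: a_def\<close>)
      show "b absolutely_integrable_on {0..X}"
        by (rule absolutely_integrable_spike[OF ai[OF X(1), of 1 2] S(1)]) (use in_good in \<open>simp add: b_def\<close>)
      show "c absolutely_integrable_on {0..X}"
        by (rule absolutely_integrable_spike[OF ai[OF X(1), of 2 2] S(1)]) (use in_good in \<open>simp add: c_def\<close>)
    qed (use ent in \<open>auto simp: a_def b_def c_def\<close>)
  qed
qed

text \<open>Two null sets are absorbed by changing the integrand: the one where the scalar
  coefficients differ from \<open>H\<close>, and the one where the differential equation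
  fails.\<close>

lemma fundamental_solution_scalar:
  assumes sys: "canonical_system X a b c" and X: "X \<in> interval_0 L"
    and S: "negligible S" "\<And>x. x \<in> interval_0 L \<Longrightarrow> x \<notin> S \<Longrightarrow>
      H x $ 1 $ 1 = a x \<and> H x $ 1 $ 2 = b x \<and> H x $ 2 $ 1 = b x \<and> H x $ 2 $ 2 = c x"
    and U: "fundamental_solution L H z U"
  shows "canonical_system.solution X a b c z (\<lambda>x. U x $ 1 $ j) (\<lambda>x. U x $ 2 $ j)"
proof -
  interpret canonical_system X a b c by (rule sys)
  obtain U' where U': "\<And>x. x \<in> interval_0 L \<Longrightarrow> U' absolutely_integrable_on {0..x} \<and> U x = U 0 + integral {0..x} U'"
    and ae: "AE x in lebesgue. x \<in> interval_0 L \<longrightarrow> Jmat ** U' x = mat z ** map_matrix complex_of_real (H x) ** U x"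
    using U unfolding fundamental_solution_def by blast
  obtain S' where S': "negligible S'"
    "{x. \<not> (x \<in> interval_0 L \<longrightarrow> Jmat ** U' x = mat z ** map_matrix complex_of_real (H x) ** U x)} \<subseteq> S'"
    using ae unfolding eventually_ae_filter_negligible by blast
  have "primitive_on X U U'"
    unfolding primitive_on_def
  proof (intro conjI ballI)
    show "U' absolutely_integrable_on {0..X}" using U'[OF X] by blast
    fix x assume "x \<in> {0..X}"
    then have "U x = U 0 + integral {0..x} U'" using U'[OF interval_0_down[OF X, of x]] by auto
    then show "U x - U 0 = integral {0..x} U'" by (metis add_diff_cancel_left')
  qed
  then have pr: "primitive_on X (\<lambda>x. U x $ i $ j) (\<lambda>x. U' x $ i $ j)" for i
    by (rule primitive_on_linear[OF _ bounded_linear_entry])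
  have neg: "negligible (S \<union> S')" using S(1) S'(1) by (rule negligible_Un)
  have eq: "U' x $ 1 $ j = z * (of_real (b x) * U x $ 1 $ j + of_real (c x) * U x $ 2 $ j) \<and>
       U' x $ 2 $ j = - z * (of_real (a x) * U x $ 1 $ j + of_real (b x) * U x $ 2 $ j)"
    if "0 \<le> x" "x \<le> X" "x \<notin> S \<union> S'" for x
  proof -
    have x: "x \<in> interval_0 L" using interval_0_down[OF X] that by blast
    then have m: "Jmat ** U' x = mat z ** map_matrix complex_of_real (H x) ** U x" using S'(2) that by blast
    have e1: "- U' x $ 2 $ j = z * (of_real (H x $ 1 $ 1) * U x $ 1 $ j + of_real (H x $ 1 $ 2) * U x $ 2 $ j)"
      unfolding Jmat_entries(1)[symmetric] m rhs_entries ..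
    have e2: "U' x $ 1 $ j = z * (of_real (H x $ 2 $ 1) * U x $ 1 $ j + of_real (H x $ 2 $ 2) * U x $ 2 $ j)"
      unfolding Jmat_entries(2)[symmetric] m rhs_entries ..
    have "U' x $ 2 $ j = - (- U' x $ 2 $ j)" by simp
    also have "\<dots> = - z * (of_real (H x $ 1 $ 1) * U x $ 1 $ j + of_real (H x $ 1 $ 2) * U x $ 2 $ j)"
      unfolding e1 by simp
    finally show ?thesis using S(2)[OF x] that e2 by simp
  qed
  show ?thesis
    unfolding solution_def
    by (intro conjI; rule primitive_on_spike[OF pr neg]) (use eq in auto)
qed

text \<open>Monotone convergence along an exhaustion turns the infinite nonnegative integral over
  \<open>[0, L)\<close> into unbounded integrals over compact intervals.\<close>

lemma eta_unbounded:
  assumes H: "hamiltonian L H"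
    and S: "negligible S" "\<And>x. x \<in> interval_0 L \<Longrightarrow> x \<notin> S \<Longrightarrow>
      H x $ 1 $ 1 = a x \<and> H x $ 1 $ 2 = b x \<and> H x $ 2 $ 1 = b x \<and> H x $ 2 $ 2 = c x"
    and sys: "\<And>X. X \<in> interval_0 L \<Longrightarrow> 0 < X \<Longrightarrow> canonical_system X a b c"
  shows "\<exists>X\<in>interval_0 L. 0 < X \<and> R < integral {0..X} (\<lambda>s. a s + c s)"
proof (rule ccontr)
  assume neg: "\<not> ?thesis"
  have "0 < L" using H by (simp add: hamiltonian_def)
  then obtain X where X: "\<And>n. 0 < X n" "\<And>n :: nat. X n \<in> interval_0 L" "incseq X"
    and I: "interval_0 L = (\<Union>n. {0..X n})"
    by (rule interval_0_exhaustion) blast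
  define f where "f n x = ennreal (indicator {0..X n} x *\<^sub>R (a x + c x))" for n x
  have nn: "0 \<le> a x + c x" for x using canonical_system.nonneg[OF sys[OF X(2) X(1)]] by (simp add: add_nonneg_nonneg)
  have int: "integrable lebesgue (\<lambda>x. indicator {0..X n} x *\<^sub>R (a x + c x))" for n
    using canonical_system.trace_abs_int[OF sys[OF X(2) X(1)], of n] by (simp add: set_integrable_def)
  have "(\<integral>\<^sup>+ x. f n x \<partial>lebesgue) \<le> ennreal R" for n
  proof -
    have "(\<integral>\<^sup>+ x. f n x \<partial>lebesgue) = ennreal (integral\<^sup>L lebesgue (\<lambda>x. indicator {0..X n} x *\<^sub>R (a x + c x)))"
      unfolding f_def by (rule nn_integral_eq_integral[OF int]) (use nn in auto)
    also have "integral\<^sup>L lebesgue (\<lambda>x. indicator {0..X n} x *\<^sub>R (a x + c x)) = integral {0..X n} (\<lambda>s. a s + c s)"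
      using set_lebesgue_integral_eq_integral(2)[OF canonical_system.trace_abs_int[OF sys[OF X(2) X(1)], of n]]
      by (simp add: set_lebesgue_integral_def)
    also have "ennreal \<dots> \<le> ennreal R" using neg X(1,2)[of n] by (intro ennreal_leI) force
    finally show ?thesis .
  qed
  then have le_R: "(SUP n. (\<integral>\<^sup>+ x. f n x \<partial>lebesgue)) \<le> ennreal R" by (rule SUP_least)
  have sup_eq: "(\<integral>\<^sup>+ x. (SUP n. f n x) \<partial>lebesgue) = (SUP n. (\<integral>\<^sup>+ x. f n x \<partial>lebesgue))"
  proof (rule nn_integral_monotone_convergence_SUP)
    show "incseq f"
    proof (intro incseq_SucI le_funI)
      fix n x
      have "X n \<le> X (Suc n)" using X(3) by (simp add: incseq_SucD)
      then show "f n x \<le> f (Suc n) x" unfolding f_def using nn[of x] by (intro ennreal_leI) (auto simp: indicator_def)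
    qed
    show "f n \<in> borel_measurable lebesgue" for n
      unfolding f_def using borel_measurable_integrable[OF int[of n]] by (intro measurable_compose[OF _ measurable_ennreal])
  qed
  have le_sup: "(\<integral>\<^sup>+ x\<in>interval_0 L. ennreal (trace (H x)) \<partial>lebesgue) \<le> (\<integral>\<^sup>+ x. (SUP n. f n x) \<partial>lebesgue)"
  proof (rule nn_integral_mono_AE)
    have "AE x in lebesgue. x \<notin> S" using S(1) by (simp add: AE_not_in negligible_iff_null_sets)
    then show "AE x in lebesgue. ennreal (trace (H x)) * indicator (interval_0 L) x \<le> (SUP n. f n x)"
    proof eventually_elim
      case (elim x)
      show ?case
      proof (cases "x \<in> interval_0 L")
        case True
        then obtain n where n: "x \<in> {0..X n}" using I by blast
        have "ennreal (trace (H x)) * indicator (interval_0 L) x = f n x"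
          using True n S(2)[OF True elim] by (simp add: f_def trace_2)
        also have "\<dots> \<le> (SUP n. f n x)" by (rule SUP_upper) simp
        finally show ?thesis .
      qed simp
    qed
  qed
  have "(\<integral>\<^sup>+ x\<in>interval_0 L. ennreal (trace (H x)) \<partial>lebesgue) = \<infinity>"
    using H unfolding hamiltonian_def by blast
  then have "(\<infinity> :: ennreal) \<le> ennreal R" using order.trans[OF le_sup] le_R unfolding sup_eq by metis
  then show False by (simp add: top_unique)
qed

text \<open>Square integrability bounds the energy by one constant for all \<open>X\<close>. Were
  the imaginary part negative at \<open>x\<close>, \<open>eta_log_bound\<close> would bound
  \<open>\<eta> X\<close> uniformly in \<open>X\<close>, against the divergence of the trace
  integral.\<close>

lemma weyl_solution_nonneg:
  assumes H: "hamiltonian L H"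
    and S: "negligible S" "\<And>x. x \<in> interval_0 L \<Longrightarrow> x \<notin> S \<Longrightarrow>
      H x $ 1 $ 1 = a x \<and> H x $ 1 $ 2 = b x \<and> H x $ 2 $ 1 = b x \<and> H x $ 2 $ 2 = c x"
    and sys: "\<And>X. X \<in> interval_0 L \<Longrightarrow> 0 < X \<Longrightarrow> canonical_system X a b c"
    and sol: "\<And>X. X \<in> interval_0 L \<Longrightarrow> 0 < X \<Longrightarrow> canonical_system.solution X a b c z (\<lambda>x. f x $ 1) (\<lambda>x. f x $ 2)"
    and L2: "in_L2 L H f" and z: "0 < Im z" and x: "x \<in> interval_0 L"
  shows "0 \<le> Im (cnj (f x $ 1) * f x $ 2)"
proof (rule ccontr)
  assume "\<not> ?thesis"
  define w where "w = - Im (cnj (f x $ 1) * f x $ 2)"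
  have w: "0 < w" using \<open>\<not> _\<close> by (simp add: w_def)
  define u where "u x = f x $ 1" for x
  define v where "v x = f x $ 2" for x
  define F where "F x = (\<Sum>i\<in>UNIV. cnj (f x $ i) * (map_matrix complex_of_real (H x) *v f x) $ i)" for x
  define E where "E x = a x * (cmod (u x))\<^sup>2 + 2 * b x * Re (cnj (u x) * v x) + c x * (cmod (v x))\<^sup>2" for x
  have F_abs: "F absolutely_integrable_on interval_0 L" using L2 unfolding in_L2_def F_def .
  have F_E: "F x = of_real (E x)" if "x \<in> interval_0 L" "x \<notin> S" for x
    using S(2)[OF that] unfolding F_def E_def u_def v_def cmod_power2
    by (simp add: sum_2 matrix_vector_mult_def map_matrix_def complex_eq_iff power2_eq_square algebra_simps)
  \<comment> \<open>\<open>M\<close>, \<open>G\<close> and \<open>R\<close> are fixed before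
    \<open>X\<close>, so that \<open>X\<close> can be taken far enough to violate the bound.\<close>
  define M where "M = integral (interval_0 L) (\<lambda>x. norm (F x))"
  define G where "G = max (cmod (u 0) + cmod z * (1 + M) / 2) (cmod (v 0) + cmod z * (1 + M) / 2) + 1"
  have x0: "0 \<le> x" using x by (simp add: interval_0_def)
  have M0: "0 \<le> M" unfolding M_def using F_abs
    by (intro integral_nonneg) (auto simp: absolutely_integrable_on_def)
  have "0 \<le> cmod (u 0) + cmod z * (1 + M) / 2" using M0 by simp
  then have G: "cmod (u 0) + cmod z * (1 + M) / 2 \<le> G" "cmod (v 0) + cmod z * (1 + M) / 2 \<le> G" "0 < G"
    by (auto simp: G_def)
  define \<eta>x where "\<eta>x = integral {0..x} (\<lambda>s. a s + c s)"
  define R where "R = ln (1 + \<eta>x) + 2 * G\<^sup>2 * M / w\<^sup>2"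
  obtain X where X: "X \<in> interval_0 L" "0 < X" "max \<eta>x (exp R) < integral {0..X} (\<lambda>s. a s + c s)"
    using eta_unbounded[OF H S sys, of "max \<eta>x (exp R)"] by blast
  interpret canonical_system X a b c by (rule sys[OF X(1,2)])
  have \<eta>X: "exp R < \<eta> X" "\<eta>x < \<eta> X" using X(3) by (simp_all add: \<eta>_def)
  \<comment> \<open>\<open>X\<close> lies beyond \<open>x\<close> because its trace integral is
    larger.\<close>
  have xX: "x \<le> X"
  proof (rule ccontr)
    assume "\<not> x \<le> X"
    then have "0 < x" using X(2) by simp
    interpret x: canonical_system x a b c by (rule sys[OF x \<open>0 < x\<close>])
    have "x.\<eta> X \<le> x.\<eta> x" using \<open>\<not> x \<le> X\<close> X(2) by (intro x.eta_mono) auto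
    then show False using \<eta>X(2) by (simp add: x.\<eta>_def \<eta>_def \<eta>x_def)
  qed
  have sl: "solution z u v" using sol[OF X(1,2)] by (simp add: u_def[abs_def] v_def[abs_def])
  have EE: "energy u v = E" by (simp add: fun_eq_iff energy_def E_def)
  have "integral {0..X} (energy u v) \<le> integral {0..X} (\<lambda>x. norm (F x))"
  proof -
    have sub: "{0..X} \<subseteq> interval_0 L" using interval_0_down[OF X(1)] by auto
    have "integral {0..X} (energy u v) = integral {0..X} (\<lambda>x. norm (F x))"
    proof (rule integral_spike[OF S(1)])
      fix s assume s: "s \<in> {0..X} - S"
      then have "F s = of_real (energy u v s)" using F_E[of s] sub by (auto simp: EE)
      then show "norm (F s) = energy u v s" using energy_bounds(3)[of u v s] by simp
    qed
    then show ?thesis by simp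
  qed
  also have "\<dots> \<le> M"
    unfolding M_def
  proof (rule integral_subset_le)
    show "{0..X} \<subseteq> interval_0 L" using interval_0_down[OF X(1)] by auto
    then show "(\<lambda>x. norm (F x)) integrable_on {0..X}"
      using absolutely_integrable_on_subinterval[OF F_abs] unfolding absolutely_integrable_on_def by blast
    show "(\<lambda>x. norm (F x)) integrable_on interval_0 L" using F_abs by (simp add: absolutely_integrable_on_def)
  qed simp
  finally have EM: "integral {0..X} (energy u v) \<le> M" .
  have "ln (1 + \<eta> X) \<le> ln (1 + \<eta> x) + 2 * G\<^sup>2 * M / w\<^sup>2"
    by (rule eta_log_bound[OF sl z EM G x0 xX w]) (simp add: w_def u_def v_def)
  also have "\<dots> = R" by (simp add: R_def \<eta>x_def \<eta>_def)
  finally have "ln (1 + \<eta> X) \<le> R" .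
  moreover have "0 < \<eta> X" using eta_pos X(2) by simp
  ultimately have "1 + \<eta> X \<le> exp R" by (metis add_pos_pos exp_le_cancel_iff exp_ln zero_less_one)
  then show False using \<eta>X(1) by simp
qed

lemma average_tendsto_iff:
  assumes ev: "\<forall>\<^sub>F x in at_right 0. eta H x = e x \<and> integral {0..x} H $ 1 $ 1 = A x \<and> integral {0..x} H $ 1 $ 2 = B x \<and>
      integral {0..x} H $ 2 $ 1 = B x \<and> integral {0..x} H $ 2 $ 2 = C x"
  shows "average_tendsto H a0 b0 c0 \<longleftrightarrow> ((\<lambda>x. A x / e x) \<longlongrightarrow> a0) (at_right 0) \<and>
    ((\<lambda>x. B x / e x) \<longlongrightarrow> b0) (at_right 0) \<and> ((\<lambda>x. C x / e x) \<longlongrightarrow> c0) (at_right 0)"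
proof -
  let ?f = "\<lambda>x. (1 / eta H x) *\<^sub>R integral {0..x} H"
  let ?l = "vector [vector [a0, b0], vector [b0, c0]] :: real^2^2"
  have "average_tendsto H a0 b0 c0 \<longleftrightarrow> (\<forall>i j. ((\<lambda>x. ?f x $ i $ j) \<longlongrightarrow> ?l $ i $ j) (at_right 0))"
    unfolding average_tendsto_def
  proof
    assume "(?f \<longlongrightarrow> ?l) (at_right 0)"
    then show "\<forall>i j. ((\<lambda>x. ?f x $ i $ j) \<longlongrightarrow> ?l $ i $ j) (at_right 0)"
      by (intro allI tendsto_vec_nth)
  next
    assume comp: "\<forall>i j. ((\<lambda>x. ?f x $ i $ j) \<longlongrightarrow> ?l $ i $ j) (at_right 0)"
    show "(?f \<longlongrightarrow> ?l) (at_right 0)"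
      by (intro vec_tendstoI) (rule comp[rule_format])
  qed
  also have "\<dots> \<longleftrightarrow> ((\<lambda>x. ?f x $ 1 $ 1) \<longlongrightarrow> a0) (at_right 0) \<and> ((\<lambda>x. ?f x $ 1 $ 2) \<longlongrightarrow> b0) (at_right 0) \<and>
      ((\<lambda>x. ?f x $ 2 $ 1) \<longlongrightarrow> b0) (at_right 0) \<and> ((\<lambda>x. ?f x $ 2 $ 2) \<longlongrightarrow> c0) (at_right 0)"
    by (simp only: forall_2 vector_2 conj_assoc)
  also have "((\<lambda>x. ?f x $ 1 $ 1) \<longlongrightarrow> a0) (at_right 0) \<longleftrightarrow> ((\<lambda>x. A x / e x) \<longlongrightarrow> a0) (at_right 0)"
    by (rule tendsto_cong) (rule eventually_mono[OF ev], simp)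
  also have "((\<lambda>x. ?f x $ 1 $ 2) \<longlongrightarrow> b0) (at_right 0) \<longleftrightarrow> ((\<lambda>x. B x / e x) \<longlongrightarrow> b0) (at_right 0)"
    by (rule tendsto_cong) (rule eventually_mono[OF ev], simp)
  also have "((\<lambda>x. ?f x $ 2 $ 1) \<longlongrightarrow> b0) (at_right 0) \<longleftrightarrow> ((\<lambda>x. B x / e x) \<longlongrightarrow> b0) (at_right 0)"
    by (rule tendsto_cong) (rule eventually_mono[OF ev], simp)
  also have "((\<lambda>x. ?f x $ 2 $ 2) \<longlongrightarrow> c0) (at_right 0) \<longleftrightarrow> ((\<lambda>x. C x / e x) \<longlongrightarrow> c0) (at_right 0)"
    by (rule tendsto_cong) (rule eventually_mono[OF ev], simp)
  finally show ?thesis by blast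
qed

text \<open>Any positive \<open>X\<close> in the domain serves for the family. The Weyl inequality
  on \<open>[0, X]\<close>, however, depends on the behaviour up to \<open>L\<close>, so the
  solution property is established on every \<open>[0, Y]\<close> first.\<close>

lemma weyl_family_exists:
  assumes H: "hamiltonian L H" and U: "\<And>z. fundamental_solution L H z (U z)" and m: "m_function L H U m"
  obtains X a b c where
    "weyl_family X a b c (\<lambda>z x. U z x $ 1 $ 1) (\<lambda>z x. U z x $ 2 $ 1) (\<lambda>z x. U z x $ 1 $ 2) (\<lambda>z x. U z x $ 2 $ 2) m"
    "\<And>x. 0 \<le> x \<Longrightarrow> x \<le> X \<Longrightarrow> eta H x = integral {0..x} (\<lambda>s. a s + c s) \<and>
      integral {0..x} H $ 1 $ 1 = integral {0..x} a \<and> integral {0..x} H $ 1 $ 2 = integral {0..x} b \<and>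
      integral {0..x} H $ 2 $ 1 = integral {0..x} b \<and> integral {0..x} H $ 2 $ 2 = integral {0..x} c"
proof -
  obtain a b c S where S: "negligible S"
    "\<And>x. x \<in> interval_0 L \<Longrightarrow> x \<notin> S \<Longrightarrow>
      H x $ 1 $ 1 = a x \<and> H x $ 1 $ 2 = b x \<and> H x $ 2 $ 1 = b x \<and> H x $ 2 $ 2 = c x"
    and sys: "\<And>X. X \<in> interval_0 L \<Longrightarrow> 0 < X \<Longrightarrow> canonical_system X a b c"
    by (rule hamiltonian_scalar[OF H]) (rule that; assumption)
  have "0 < L" using H by (simp add: hamiltonian_def)
  then obtain X where X: "0 < X" "X \<in> interval_0 L"
    by (rule interval_0_exhaustion) (use that in blast)
  note sol = fundamental_solution_scalar[OF sys _ S U]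
  define f where "f z x = U z x *v vector [1, m z]" for z x
  have f12: "f z x $ 1 = 1 * U z x $ 1 $ 1 + m z * U z x $ 1 $ 2" "f z x $ 2 = 1 * U z x $ 2 $ 1 + m z * U z x $ 2 $ 2" for z x
    by (simp_all add: f_def matrix_vector_mult_def sum_2 vector_2)
  have solf: "canonical_system.solution Y a b c z (\<lambda>x. f z x $ 1) (\<lambda>x. f z x $ 2)" if "Y \<in> interval_0 L" "0 < Y" for Y z
    unfolding f12
    by (rule canonical_system.solution_linear[OF sys[OF that] sol[OF that(1) that(2) that(1)] sol[OF that(1) that(2) that(1)]])
  have Im_nonneg: "0 \<le> Im (cnj (f z x $ 1) * f z x $ 2)" if "0 < Im z" "x \<in> interval_0 L" for z x
  proof (rule weyl_solution_nonneg[OF H S sys solf _ that])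
    have "z \<notin> \<real>" using that(1) by (auto simp: complex_is_Real_iff)
    then show "in_L2 L H (f z)" using m unfolding m_function_def f_def by blast
  qed
  show ?thesis
  proof (rule that[of X a b c])
    interpret canonical_system X a b c by (rule sys[OF X(2,1)])
    have init: "U z 0 = mat 1" for z using U[of z] unfolding fundamental_solution_def by blast
    show "weyl_family X a b c (\<lambda>z x. U z x $ 1 $ 1) (\<lambda>z x. U z x $ 2 $ 1) (\<lambda>z x. U z x $ 1 $ 2) (\<lambda>z x. U z x $ 2 $ 2) m"
    proof
      show "solution z (\<lambda>x. U z x $ 1 $ 1) (\<lambda>x. U z x $ 2 $ 1)" for z
        by (rule sol[OF X(2,1,2)])
      show "solution z (\<lambda>x. U z x $ 1 $ 2) (\<lambda>x. U z x $ 2 $ 2)" for z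
        by (rule sol[OF X(2,1,2)])
      show "U z 0 $ 1 $ 1 = 1" "U z 0 $ 2 $ 1 = 0" "U z 0 $ 1 $ 2 = 0" "U z 0 $ 2 $ 2 = 1" for z
        unfolding init by (simp_all add: mat_def)
      show "0 \<le> Im (cnj (U z x $ 1 $ 1 + m z * U z x $ 1 $ 2) * (U z x $ 2 $ 1 + m z * U z x $ 2 $ 2))"
        if "0 < Im z" "0 \<le> x" "x \<le> X" for z x
        using Im_nonneg[OF that(1) interval_0_down[OF X(2) that(2,3)]] unfolding f12 by simp
    qed
  next
    fix x assume x: "0 \<le> x" "x \<le> X"
    then have xI: "x \<in> interval_0 L" by (rule interval_0_down[OF X(2)])
    have Hs: "H s $ 1 $ 1 = a s \<and> H s $ 1 $ 2 = b s \<and> H s $ 2 $ 1 = b s \<and> H s $ 2 $ 2 = c s" if "s \<in> {0..x} - S" for s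
      using S(2)[of s] interval_0_down[OF xI, of s] that by auto
    have "H absolutely_integrable_on {0..x}" using H xI unfolding hamiltonian_def by blast
    then have Hint: "H integrable_on {0..x}" using set_lebesgue_integral_eq_integral(1) by blast
    have ent: "integral {0..x} H $ i $ j = integral {0..x} g" if "\<And>s. s \<in> {0..x} - S \<Longrightarrow> H s $ i $ j = g s" for i j g
    proof -
      have "integral {0..x} H $ i $ j = integral {0..x} (\<lambda>s. H s $ i $ j)"
        using Henstock_Kurzweil_Integration.integral_linear[OF Hint bounded_linear_entry[of i j]] by (simp add: comp_def)
      also have "\<dots> = integral {0..x} g" by (rule integral_spike[OF S(1)]) (use that in simp)
      finally show ?thesis .
    qed
    have "eta H x = integral {0..x} (\<lambda>s. a s + c s)"
      unfolding eta_def by (rule integral_spike[OF S(1)]) (use Hs in \<open>simp add: trace_2\<close>)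
    then show "eta H x = integral {0..x} (\<lambda>s. a s + c s) \<and>
      integral {0..x} H $ 1 $ 1 = integral {0..x} a \<and> integral {0..x} H $ 1 $ 2 = integral {0..x} b \<and>
      integral {0..x} H $ 2 $ 1 = integral {0..x} b \<and> integral {0..x} H $ 2 $ 2 = integral {0..x} c"
      using Hs by (intro conjI ent) auto
  qed
qed

text \<open>The normalised averages have trace 1. This gives the second claim, which
  \<open>zeta_of_average\<close> needs to recover the averages from \<zeta>; the third is uniqueness
  of limits.\<close>

lemma sector_tendsto_iff_average:
  assumes "hamiltonian L H" "\<And>z. fundamental_solution L H z (U z)" "m_function L H U m"
  shows "0 \<le> Im \<zeta> \<Longrightarrow> sector_tendsto m \<zeta> \<longleftrightarrow>
      average_tendsto H ((cmod \<zeta>)\<^sup>2 / ((cmod \<zeta>)\<^sup>2 + 1)) (- Re \<zeta> / ((cmod \<zeta>)\<^sup>2 + 1)) (1 / ((cmod \<zeta>)\<^sup>2 + 1))"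
    and "average_tendsto H a0 b0 c0 \<Longrightarrow> a0 + c0 = 1"
    and "average_tendsto H a0 b0 c0 \<Longrightarrow> average_tendsto H a1 b1 c1 \<Longrightarrow> a0 = a1 \<and> b0 = b1 \<and> c0 = c1"
proof -
  obtain X a b c where
    W: "weyl_family X a b c (\<lambda>z x. U z x $ 1 $ 1) (\<lambda>z x. U z x $ 2 $ 1) (\<lambda>z x. U z x $ 1 $ 2) (\<lambda>z x. U z x $ 2 $ 2) m"
    and I: "\<And>x. 0 \<le> x \<Longrightarrow> x \<le> X \<Longrightarrow> eta H x = integral {0..x} (\<lambda>s. a s + c s) \<and>
      integral {0..x} H $ 1 $ 1 = integral {0..x} a \<and> integral {0..x} H $ 1 $ 2 = integral {0..x} b \<and>
      integral {0..x} H $ 2 $ 1 = integral {0..x} b \<and> integral {0..x} H $ 2 $ 2 = integral {0..x} c"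
    by (rule weyl_family_exists[OF assms]) (rule that; assumption)
  interpret weyl_family X a b c "\<lambda>z x. U z x $ 1 $ 1" "\<lambda>z x. U z x $ 2 $ 1" "\<lambda>z x. U z x $ 1 $ 2" "\<lambda>z x. U z x $ 2 $ 2" m
    by (rule W)
  have ev: "\<forall>\<^sub>F x in at_right 0. eta H x = \<eta> x \<and> integral {0..x} H $ 1 $ 1 = A x \<and> integral {0..x} H $ 1 $ 2 = B x \<and>
      integral {0..x} H $ 2 $ 1 = B x \<and> integral {0..x} H $ 2 $ 2 = C x"
    by (rule eventually_mono[OF eventually_in_domain]) (use I in \<open>simp add: \<eta>_def A_def B_def C_def\<close>)
  note avg = average_tendsto_iff[OF ev]
  show "sector_tendsto m \<zeta> \<longleftrightarrow>
      average_tendsto H ((cmod \<zeta>)\<^sup>2 / ((cmod \<zeta>)\<^sup>2 + 1)) (- Re \<zeta> / ((cmod \<zeta>)\<^sup>2 + 1)) (1 / ((cmod \<zeta>)\<^sup>2 + 1))"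
    if "0 \<le> Im \<zeta>" for \<zeta>
    unfolding sector_tendsto_iff_cone avg by (rule cone_tendsto_iff_averages[OF that])
  show "a0 + c0 = 1" if av: "average_tendsto H a0 b0 c0" for a0 b0 c0
  proof -
    have "((\<lambda>x. A x / \<eta> x + C x / \<eta> x) \<longlongrightarrow> a0 + c0) (at_right 0)"
      using av unfolding avg by (intro tendsto_add) auto
    moreover have "\<forall>\<^sub>F x in at_right 0. A x / \<eta> x + C x / \<eta> x = 1"
    proof (rule eventually_mono[OF eventually_in_domain])
      fix x assume x: "0 < x \<and> x \<le> X \<and> 0 < \<eta> x"
      then have "A x + C x = \<eta> x" using eta_eq[of x] by simp
      then show "A x / \<eta> x + C x / \<eta> x = 1" unfolding add_divide_distrib[symmetric] using x by simp
    qed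
    ultimately have "((\<lambda>x. 1) \<longlongrightarrow> a0 + c0) (at_right (0 :: real))" by (rule Lim_transform_eventually)
    then show ?thesis using tendsto_unique[OF trivial_limit_at_right_real _ tendsto_const] by metis
  qed
  show "a0 = a1 \<and> b0 = b1 \<and> c0 = c1" if "average_tendsto H a0 b0 c0" "average_tendsto H a1 b1 c1" for a0 b0 c0 a1 b1 c1
    using that tendsto_unique[OF trivial_limit_at_right_real] unfolding avg by blast
qed

text \<open>From \<open>a0 + c0 = 1\<close> one gets \<open>|\<zeta>|^2 = a0 / c0\<close> and
  \<open>|\<zeta>|^2 + 1 = 1 / c0\<close>; the formulas are then read off.\<close>

lemma zeta_of_average:
  fixes a0 b0 c0 :: real
  assumes "0 < c0" "0 \<le> a0 * c0 - b0\<^sup>2" "a0 + c0 = 1"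
  defines "\<zeta> \<equiv> (\<i> * of_real (sqrt (a0 * c0 - b0\<^sup>2)) - of_real b0) / of_real c0"
  shows "0 \<le> Im \<zeta>" "a0 = (cmod \<zeta>)\<^sup>2 / ((cmod \<zeta>)\<^sup>2 + 1)" "b0 = - Re \<zeta> / ((cmod \<zeta>)\<^sup>2 + 1)" "c0 = 1 / ((cmod \<zeta>)\<^sup>2 + 1)"
proof -
  define h where "h = sqrt (a0 * c0 - b0\<^sup>2)"
  have h: "0 \<le> h" "h\<^sup>2 = a0 * c0 - b0\<^sup>2" using assms by (simp_all add: h_def)
  have \<zeta>: "Re \<zeta> = - b0 / c0" "Im \<zeta> = h / c0" by (simp_all add: \<zeta>_def h_def)
  show "0 \<le> Im \<zeta>" using \<zeta> h assms by simp
  have "(cmod \<zeta>)\<^sup>2 = (b0\<^sup>2 + h\<^sup>2) / c0\<^sup>2" unfolding cmod_power2 \<zeta> by (simp add: power_divide add_divide_distrib)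
  then have n: "(cmod \<zeta>)\<^sup>2 = a0 / c0" unfolding h using assms by (simp add: power2_eq_square)
  have s: "(cmod \<zeta>)\<^sup>2 + 1 = 1 / c0" unfolding n using assms by (simp add: add_divide_distrib[symmetric] divide_add_eq_iff)
  show "a0 = (cmod \<zeta>)\<^sup>2 / ((cmod \<zeta>)\<^sup>2 + 1)" "b0 = - Re \<zeta> / ((cmod \<zeta>)\<^sup>2 + 1)" "c0 = 1 / ((cmod \<zeta>)\<^sup>2 + 1)"
    unfolding s unfolding n \<zeta> using assms by simp_all
qed

text \<open>The determinant is \<open>(Im \<zeta> / s)^2\<close>, and \<open>Im \<zeta> >= 0\<close>
  selects the square root.\<close>

lemma average_of_zeta:
  fixes \<zeta> :: complex
  assumes "0 \<le> Im \<zeta>"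
  defines "s \<equiv> (cmod \<zeta>)\<^sup>2 + 1"
  defines "a0 \<equiv> (cmod \<zeta>)\<^sup>2 / s" and "b0 \<equiv> - Re \<zeta> / s" and "c0 \<equiv> 1 / s"
  shows "0 \<le> a0" "0 < c0" "0 \<le> a0 * c0 - b0\<^sup>2"
    and "\<zeta> = (\<i> * of_real (sqrt (a0 * c0 - b0\<^sup>2)) - of_real b0) / of_real c0"
proof -
  have s: "0 < s" unfolding s_def by (simp add: add_nonneg_pos)
  show "0 \<le> a0" "0 < c0" using s by (simp_all add: a0_def c0_def)
  have "a0 * c0 - b0\<^sup>2 = ((cmod \<zeta>)\<^sup>2 - (Re \<zeta>)\<^sup>2) / s\<^sup>2"
    by (simp add: a0_def b0_def c0_def power2_eq_square diff_divide_distrib)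
  then have h: "a0 * c0 - b0\<^sup>2 = (Im \<zeta> / s)\<^sup>2" unfolding cmod_power2 by (simp add: power_divide)
  then show "0 \<le> a0 * c0 - b0\<^sup>2" by simp
  have "sqrt (a0 * c0 - b0\<^sup>2) = Im \<zeta> / s" unfolding h using assms(1) s by simp
  then show "\<zeta> = (\<i> * of_real (sqrt (a0 * c0 - b0\<^sup>2)) - of_real b0) / of_real c0"
    using s by (simp add: b0_def c0_def complex_eq_iff)
qed

theorem corollary3p2:
  fixes L :: ereal and H :: "real \<Rightarrow> real^2^2"
    and U :: "complex \<Rightarrow> real \<Rightarrow> complex^2^2" and m :: "complex \<Rightarrow> complex"
  assumes "hamiltonian L H"
    and "\<And>z. fundamental_solution L H z (U z)"
    and "m_function L H U m"
  shows "((\<exists>a0 b0 c0 :: real. 0 \<le> a0 \<and> 0 < c0 \<and> 0 \<le> a0 * c0 - b0\<^sup>2 \<and> average_tendsto H a0 b0 c0)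
           \<longleftrightarrow> (\<exists>\<zeta>0 :: complex. 0 \<le> Im \<zeta>0 \<and> sector_tendsto m \<zeta>0))
       \<and> (\<forall>(a0::real) (b0::real) (c0::real) (\<zeta>0::complex) (h0::real).
            0 \<le> a0 \<and> 0 < c0 \<and> 0 \<le> a0 * c0 - b0\<^sup>2 \<and> average_tendsto H a0 b0 c0
            \<and> 0 \<le> Im \<zeta>0 \<and> sector_tendsto m \<zeta>0
            \<and> h0 = sqrt (a0 * c0 - b0\<^sup>2) \<longrightarrow>
            \<zeta>0 = (\<i> * complex_of_real h0 - complex_of_real b0) / complex_of_real c0
            \<and> a0 = (cmod \<zeta>0)\<^sup>2 / ((cmod \<zeta>0)\<^sup>2 + 1)
            \<and> b0 = - Re \<zeta>0 / ((cmod \<zeta>0)\<^sup>2 + 1)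
            \<and> c0 = 1 / ((cmod \<zeta>0)\<^sup>2 + 1))"
proof (intro conjI iffI allI impI)
  assume "\<exists>a0 b0 c0 :: real. 0 \<le> a0 \<and> 0 < c0 \<and> 0 \<le> a0 * c0 - b0\<^sup>2 \<and> average_tendsto H a0 b0 c0"
  then obtain a0 b0 c0 where av: "0 < c0" "0 \<le> a0 * c0 - b0\<^sup>2" "average_tendsto H a0 b0 c0" by blast
  note \<zeta> = zeta_of_average[OF av(1,2) sector_tendsto_iff_average(2)[OF assms av(3)]]
  show "\<exists>\<zeta>0 :: complex. 0 \<le> Im \<zeta>0 \<and> sector_tendsto m \<zeta>0"
    using \<zeta>(1) sector_tendsto_iff_average(1)[OF assms \<zeta>(1)] av(3) unfolding \<zeta>(2-4)[symmetric] by blast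
next
  assume "\<exists>\<zeta>0 :: complex. 0 \<le> Im \<zeta>0 \<and> sector_tendsto m \<zeta>0"
  then obtain \<zeta>0 where \<zeta>0: "0 \<le> Im \<zeta>0" "sector_tendsto m \<zeta>0" by blast
  show "\<exists>a0 b0 c0 :: real. 0 \<le> a0 \<and> 0 < c0 \<and> 0 \<le> a0 * c0 - b0\<^sup>2 \<and> average_tendsto H a0 b0 c0"
    using average_of_zeta(1-3)[OF \<zeta>0(1)] sector_tendsto_iff_average(1)[OF assms \<zeta>0(1)] \<zeta>0(2) by blast
next
  fix a0 b0 c0 h0 :: real and \<zeta>0 :: complex
  assume *: "0 \<le> a0 \<and> 0 < c0 \<and> 0 \<le> a0 * c0 - b0\<^sup>2 \<and> average_tendsto H a0 b0 c0
    \<and> 0 \<le> Im \<zeta>0 \<and> sector_tendsto m \<zeta>0 \<and> h0 = sqrt (a0 * c0 - b0\<^sup>2)"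
  then have "average_tendsto H ((cmod \<zeta>0)\<^sup>2 / ((cmod \<zeta>0)\<^sup>2 + 1)) (- Re \<zeta>0 / ((cmod \<zeta>0)\<^sup>2 + 1)) (1 / ((cmod \<zeta>0)\<^sup>2 + 1))"
    using sector_tendsto_iff_average(1)[OF assms] by blast
  \<comment> \<open>Both matrices are limits of the same averages, so they agree entrywise.\<close>
  then have v: "a0 = (cmod \<zeta>0)\<^sup>2 / ((cmod \<zeta>0)\<^sup>2 + 1) \<and> b0 = - Re \<zeta>0 / ((cmod \<zeta>0)\<^sup>2 + 1) \<and> c0 = 1 / ((cmod \<zeta>0)\<^sup>2 + 1)"
    using * sector_tendsto_iff_average(3)[OF assms] by blast
  then show "a0 = (cmod \<zeta>0)\<^sup>2 / ((cmod \<zeta>0)\<^sup>2 + 1)" "b0 = - Re \<zeta>0 / ((cmod \<zeta>0)\<^sup>2 + 1)" "c0 = 1 / ((cmod \<zeta>0)\<^sup>2 + 1)"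
    by blast+
  show "\<zeta>0 = (\<i> * complex_of_real h0 - complex_of_real b0) / complex_of_real c0"
    using average_of_zeta(4)[of \<zeta>0] * v by metis
qed

end
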